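(* Let $(H_0,\langle\cdot,\cdot\rangle_0)$ be a separable Hilbert space over $\mathbb{K}\in\{\mathbb{R},\mathbb{C}\}$ with orthonormal basis $(e_\nu)_{\nu\in\mathbb{N}_0}$, and let $(\alpha_{\nu,j})_{\nu,j\in\mathbb{N}}$ be real numbers with $\alpha_{\nu,j}\ge\max(\alpha_{\nu,1},\alpha_{1,j})$ for all $\nu,j\in\mathbb{N}$ and $\alpha_{1,1}>1$. Assume moreover that $$\liminf_{\nu,j\to\infty}\frac{\ln(\alpha_{\nu,j})}{\ln(\nu)\cdot\ln(j)}>0 .$$ Let $F,H,G$, $\gamma_j$, $\operatorname{decay}$ and $\operatorname{dec}(\cdot,\operatorname{App},\mathcal{A}^{\mathrm{all}})$ be as defined in the context. Then $$\operatorname{dec}(H,\operatorname{App},\mathcal{A}^{\mathrm{all}})=\tfrac12\min\left(\operatorname{decay}\big((\alpha_{\nu,1}^{-1})_{\nu\in\mathbb{N}}\big),\operatorname{decay}\big((\alpha_{1,j}^{-1})_{j\in\mathbb{N}}\big)\right),$$ $$\operatorname{dec}(F,\operatorname{App},\mathcal{A}^{\mathrm{all}})=\tfrac12\operatorname{decay}\big((\alpha_{1,j}^{-1})_{j\in\mathbb{N}}\big),$$ $$\operatorname{dec}(G,\operatorname{App},\mathcal{A}^{\mathrm{all}})=\tfrac12\min\left(\operatorname{decay}\big((\alpha_{\nu,1}^{-1})_{\nu\in\mathbb{N}}\big),\operatorname{decay}\big((\gamma_j)_{j\in\mathbb{N}}\big)\right).$$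
   Context: $\liminf_{\nu,j\to\infty}x_{\nu,j}:=\lim_{n\to\infty}\inf_{\nu,j\ge n}x_{\nu,j}$. $H_j:=\{f\in H_0:\sum_{\nu\in\mathbb{N}}\alpha_{\nu,j}|\langle f,e_\nu\rangle_0|^2<\infty\}$ with $\langle f,g\rangle_j:=\langle f,e_0\rangle_0\langle e_0,g\rangle_0+\sum_{\nu\in\mathbb{N}}\alpha_{\nu,j}\langle f,e_\nu\rangle_0\langle e_\nu,g\rangle_0$, $j\in\mathbb{N}$. $\gamma_j:=\sup_{\nu\in\mathbb{N}}\alpha_{\nu,1}/\alpha_{\nu,j}\in(0,1]$. $G_j:=H_1$ with $\langle f,g\rangle_{G_j}:=\langle f,e_0\rangle_0\langle e_0,g\rangle_0+\frac1{\gamma_j}\sum_{\nu\in\mathbb{N}}\alpha_{\nu,1}\langle f,e_\nu\rangle_0\langle e_\nu,g\rangle_0$. $F_j:=\operatorname{span}\{e_0,e_1\}$ with $\langle f,g\rangle_{F_j}:=\langle f,e_0\rangle_0\langle e_0,g\rangle_0+\alpha_{1,j}\langle f,e_1\rangle_0\langle e_1,g\rangle_0$. $F:=\bigotimes_jF_j$, $H:=\bigotimes_jH_j$, $G:=\bigotimes_jG_j$, $\mathcal{Z}:=\bigotimes_jH_0$ ($j$ ranging over $\mathbb{N}$) are von Neumann's incomplete tensor products based on the unit vector $e_0$ in each factor: the completion of the span of elementary tensors $\otimes_jf_j$ with $f_j\ne e_0$ for only finitely many $j$, with respect to $\langle\otimes_jf_j,\otimes_jg_j\rangle=\prod_j\langle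 f_j,g_j\rangle$. For $\mathcal{X}\in\{F,H,G\}$, $\operatorname{App}:\mathcal{X}\hookrightarrow\mathcal{Z}$ is the canonical embedding, $\mathcal{A}^{\mathrm{all}}_n:=\{\sum_{i=1}^n\lambda_i(\cdot)\,z_i:\lambda_i\in\mathcal{X}^*,\ z_i\in\mathcal{Z}\}$ where $\mathcal{X}^*$ is the dual space, $$\operatorname{err}_n(\mathcal{X},\operatorname{App},\mathcal{A}^{\mathrm{all}}):=\inf_{A\in\mathcal{A}^{\mathrm{all}}_n}\sup\{\|\operatorname{App}(f)-A(f)\|_{\mathcal{Z}}:f\in\mathcal{X},\|f\|_{\mathcal{X}}\le1\},$$ and $\operatorname{dec}(\mathcal{X},\operatorname{App},\mathcal{A}^{\mathrm{all}}):=\operatorname{decay}\big((\operatorname{err}_n(\mathcal{X},\operatorname{App},\mathcal{A}^{\mathrm{all}}))_{n\in\mathbb{N}}\big)$. For a sequence $x=(x_i)_{i\in\mathbb{N}}$ of positive reals, $\operatorname{decay}(x):=\sup\{\tau>0:\sum_{i\in\mathbb{N}}x_i^{1/\tau}<\infty\}\in[0,\infty]$, with $\sup\emptyset:=0$. *)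

theory Defs
  imports "HOL-Analysis.Analysis" "HOL-Library.Poly_Mapping"
begin

text \<open>
  Throughout, the positive integers are rendered as the set \<open>{1..}\<close> of type \<^typ>\<open>nat\<close>; values of
  sequences and arrays at index \<open>0\<close> are irrelevant, except for the basis \<open>e\<close>, which is indexed by
  all of \<^typ>\<open>nat\<close>.
\<close>

text \<open>
  The scalar field.  The axioms make \<open>x + kcnj x\<close> and \<open>x * kcnj x\<close> real for each \<open>x\<close>, so each scalar
  is a root of a real quadratic and the only models are the reals with the identity and the
  complex numbers with complex conjugation.
\<close>

class real_or_complex = real_normed_field +
  fixes kcnj :: "'a \<Rightarrow> 'a"
  assumes kcnj_add: "kcnj (x + y) = kcnj x + kcnj y"
    and kcnj_mult: "kcnj (x * y) = kcnj x * kcnj y"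
    and mult_kcnj: "x * kcnj x = ((norm x)\<^sup>2) *\<^sub>R 1"

instantiation real :: real_or_complex
begin
definition kcnj_real :: "real \<Rightarrow> real" where "kcnj_real x = x"
instance by standard (simp_all add: kcnj_real_def power2_eq_square)
end

instantiation complex :: real_or_complex
begin
definition kcnj_complex :: "complex \<Rightarrow> complex" where "kcnj_complex x = cnj x"
instance
proof
  fix x :: complex
  show "x * kcnj x = ((norm x)\<^sup>2) *\<^sub>R 1"
    using complex_norm_square[of x] by (simp add: kcnj_complex_def scaleR_conv_of_real)
qed (simp_all add: kcnj_complex_def)
end


subsection \<open>Hilbert spaces and orthonormal bases\<close>

definition cauchy_wrt :: "('v::minus \<Rightarrow> real) \<Rightarrow> (nat \<Rightarrow> 'v) \<Rightarrow> bool" where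
  "cauchy_wrt nrm s \<longleftrightarrow> (\<forall>\<epsilon>>0. \<exists>N. \<forall>m\<ge>N. \<forall>n\<ge>N. nrm (s m - s n) < \<epsilon>)"

locale hilbert_space = vector_space smul
  for smul :: "'k::real_or_complex \<Rightarrow> 'a::ab_group_add \<Rightarrow> 'a" +
  fixes ip :: "'a \<Rightarrow> 'a \<Rightarrow> 'k"
  assumes ip_add_left: "ip (x + y) z = ip x z + ip y z"
    and ip_scale_left: "ip (smul c x) z = c * ip x z"
    and ip_commute: "ip y x = kcnj (ip x y)"
    and ip_pos: "x \<noteq> 0 \<Longrightarrow> \<exists>r>0. ip x x = of_real r"
    and complete: "cauchy_wrt (\<lambda>x. sqrt (norm (ip x x))) s \<Longrightarrow>
      \<exists>l. (\<lambda>n. sqrt (norm (ip (s n - l) (s n - l)))) \<longlonglongrightarrow> 0"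

definition orthonormal_basis ::
  "('k::real_or_complex \<Rightarrow> 'a::ab_group_add \<Rightarrow> 'a) \<Rightarrow> ('a \<Rightarrow> 'a \<Rightarrow> 'k) \<Rightarrow> (nat \<Rightarrow> 'a) \<Rightarrow> bool" where
  "orthonormal_basis smul ip e \<longleftrightarrow>
     (\<forall>\<mu> \<nu>. ip (e \<mu>) (e \<nu>) = (if \<mu> = \<nu> then 1 else 0)) \<and>
     (\<forall>f. \<forall>\<epsilon>>0. \<exists>g\<in>module.span smul (range e). sqrt (norm (ip (f - g) (f - g))) < \<epsilon>)"


subsection \<open>The spaces \<open>H\<^sub>j\<close>, \<open>G\<^sub>j\<close>, \<open>F\<^sub>j\<close>\<close>

record ('k, 'v) ip_space =
  vecs :: "'v set"
  inn :: "'v \<Rightarrow> 'v \<Rightarrow> 'k"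

definition ip_norm :: "('k::real_or_complex, 'v) ip_space \<Rightarrow> 'v \<Rightarrow> real" where
  "ip_norm X x = sqrt (norm (inn X x x))"

definition space_H0 :: "('a \<Rightarrow> 'a \<Rightarrow> 'k) \<Rightarrow> nat \<Rightarrow> ('k, 'a) ip_space" where
  "space_H0 ip j = \<lparr> vecs = UNIV, inn = ip \<rparr>"

definition space_H ::
  "('a \<Rightarrow> 'a \<Rightarrow> 'k::real_or_complex) \<Rightarrow> (nat \<Rightarrow> 'a) \<Rightarrow> (nat \<Rightarrow> nat \<Rightarrow> real) \<Rightarrow> nat \<Rightarrow> ('k, 'a) ip_space"
where
  "space_H ip e \<alpha> j =
     \<lparr> vecs = {f. (\<lambda>\<nu>. \<alpha> \<nu> j * (norm (ip f (e \<nu>)))\<^sup>2) summable_on {1..}},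
       inn = (\<lambda>f g. ip f (e 0) * ip (e 0) g +
                (\<Sum>\<^sub>\<infinity>\<nu>\<in>{1..}. of_real (\<alpha> \<nu> j) * ip f (e \<nu>) * ip (e \<nu>) g)) \<rparr>"

definition gam :: "(nat \<Rightarrow> nat \<Rightarrow> real) \<Rightarrow> nat \<Rightarrow> real" where
  "gam \<alpha> j = (SUP \<nu>\<in>{1..}. \<alpha> \<nu> 1 / \<alpha> \<nu> j)"

definition space_G ::
  "('a \<Rightarrow> 'a \<Rightarrow> 'k::real_or_complex) \<Rightarrow> (nat \<Rightarrow> 'a) \<Rightarrow> (nat \<Rightarrow> nat \<Rightarrow> real) \<Rightarrow> nat \<Rightarrow> ('k, 'a) ip_space"
where
  "space_G ip e \<alpha> j =
     \<lparr> vecs = vecs (space_H ip e \<alpha> 1),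
       inn = (\<lambda>f g. ip f (e 0) * ip (e 0) g +
                of_real (1 / gam \<alpha> j) *
                (\<Sum>\<^sub>\<infinity>\<nu>\<in>{1..}. of_real (\<alpha> \<nu> 1) * ip f (e \<nu>) * ip (e \<nu>) g)) \<rparr>"

definition space_F ::
  "('k::real_or_complex \<Rightarrow> 'a::ab_group_add \<Rightarrow> 'a) \<Rightarrow> ('a \<Rightarrow> 'a \<Rightarrow> 'k) \<Rightarrow> (nat \<Rightarrow> 'a) \<Rightarrow>
    (nat \<Rightarrow> nat \<Rightarrow> real) \<Rightarrow> nat \<Rightarrow> ('k, 'a) ip_space" where
  "space_F smul ip e \<alpha> j =
     \<lparr> vecs = module.span smul {e 0, e 1},
       inn = (\<lambda>f g. ip f (e 0) * ip (e 0) g + of_real (\<alpha> 1 j) * ip f (e 1) * ip (e 1) g) \<rparr>"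


subsection \<open>Incomplete tensor products\<close>

text \<open>
  Following von Neumann, the incomplete tensor product of the spaces \<open>X j\<close> based on the vector \<open>u\<close>
  is realised as a space of functionals on the families \<open>g\<close> that label elementary tensors: a
  tensor \<open>\<Phi>\<close> is identified with the functional \<open>\<lambda>g. \<langle>\<Phi>, \<otimes>\<^sub>j g\<^sub>j\<rangle>\<close>, in particular \<open>\<otimes>\<^sub>j f\<^sub>j\<close> with
  \<open>\<lambda>g. \<Prod>\<^sub>j \<langle>f\<^sub>j, g\<^sub>j\<rangle>\<close>.  The vector space operations are pointwise.  Finite linear combinations of
  elementary tensors are given by finitely supported coefficient functions \<open>c\<close>.  A Cauchy sequence
  of such combinations is a null sequence iff its functionals tend to zero pointwise, since the
  elementary tensors are total; hence the pointwise limits of Cauchy sequences are the completion.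
  All functionals vanish outside \<open>fam X u\<close>.
\<close>

definition fam :: "(nat \<Rightarrow> ('k, 'a) ip_space) \<Rightarrow> 'a \<Rightarrow> (nat \<Rightarrow> 'a) set" where
  "fam X u = {f \<in> (\<Pi>\<^sub>E j\<in>{1..}. vecs (X j)). finite {j\<in>{1..}. f j \<noteq> u}}"

text \<open>The infinitely many factors left out of the product are all \<open>\<langle>u, u\<rangle> = 1\<close>.\<close>

definition elem_ip ::
  "(nat \<Rightarrow> ('k::real_or_complex, 'a) ip_space) \<Rightarrow> 'a \<Rightarrow> (nat \<Rightarrow> 'a) \<Rightarrow> (nat \<Rightarrow> 'a) \<Rightarrow> 'k" where
  "elem_ip X u f g = (\<Prod>j\<in>{j\<in>{1..}. f j \<noteq> u \<or> g j \<noteq> u}. inn (X j) (f j) (g j))"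

definition comb_ip ::
  "(nat \<Rightarrow> ('k::real_or_complex, 'a) ip_space) \<Rightarrow> 'a \<Rightarrow>
    ((nat \<Rightarrow> 'a) \<Rightarrow>\<^sub>0 'k) \<Rightarrow> ((nat \<Rightarrow> 'a) \<Rightarrow>\<^sub>0 'k) \<Rightarrow> 'k" where
  "comb_ip X u c d =
     (\<Sum>f\<in>Poly_Mapping.keys c. \<Sum>g\<in>Poly_Mapping.keys d.
        Poly_Mapping.lookup c f * kcnj (Poly_Mapping.lookup d g) * elem_ip X u f g)"

definition comb_fun ::
  "(nat \<Rightarrow> ('k::real_or_complex, 'a) ip_space) \<Rightarrow> 'a \<Rightarrow>
    ((nat \<Rightarrow> 'a) \<Rightarrow>\<^sub>0 'k) \<Rightarrow> (nat \<Rightarrow> 'a) \<Rightarrow> 'k" where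
  "comb_fun X u c g =
     (if g \<in> fam X u
      then (\<Sum>f\<in>Poly_Mapping.keys c. Poly_Mapping.lookup c f * elem_ip X u f g) else 0)"

definition represents ::
  "(nat \<Rightarrow> ('k::real_or_complex, 'a) ip_space) \<Rightarrow> 'a \<Rightarrow>
    (nat \<Rightarrow> (nat \<Rightarrow> 'a) \<Rightarrow>\<^sub>0 'k) \<Rightarrow> ((nat \<Rightarrow> 'a) \<Rightarrow> 'k) \<Rightarrow> bool" where
  "represents X u s \<Phi> \<longleftrightarrow>
     (\<forall>n. Poly_Mapping.keys (s n) \<subseteq> fam X u) \<and>
     cauchy_wrt (\<lambda>c. sqrt (norm (comb_ip X u c c))) s \<and>
     (\<forall>g. (\<lambda>n. comb_fun X u (s n) g) \<longlonglongrightarrow> \<Phi> g)"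

definition tensor ::
  "(nat \<Rightarrow> ('k::real_or_complex, 'a) ip_space) \<Rightarrow> 'a \<Rightarrow> ('k, (nat \<Rightarrow> 'a) \<Rightarrow> 'k) ip_space" where
  "tensor X u =
     \<lparr> vecs = {\<Phi>. \<exists>s. represents X u s \<Phi>},
       inn = (\<lambda>\<Phi> \<Psi>. THE z. \<exists>s t. represents X u s \<Phi> \<and> represents X u t \<Psi> \<and>
                (\<lambda>n. comb_ip X u (s n) (t n)) \<longlonglongrightarrow> z) \<rparr>"

text \<open>
  The canonical embedding of \<^term>\<open>tensor X u\<close> into \<^term>\<open>tensor Y u\<close>, where each \<open>X j\<close> is
  embedded in \<open>Y j\<close> with norm at most \<open>1\<close>: the continuous extension of \<open>\<otimes>\<^sub>j f\<^sub>j \<mapsto> \<otimes>\<^sub>j f\<^sub>j\<close>.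
\<close>

definition embed ::
  "(nat \<Rightarrow> ('k::real_or_complex, 'a) ip_space) \<Rightarrow> (nat \<Rightarrow> ('k, 'a) ip_space) \<Rightarrow> 'a \<Rightarrow>
    ((nat \<Rightarrow> 'a) \<Rightarrow> 'k) \<Rightarrow> ((nat \<Rightarrow> 'a) \<Rightarrow> 'k)" where
  "embed X Y u \<Phi> = (THE \<Psi>. \<exists>s. represents X u s \<Phi> \<and> represents Y u s \<Psi>)"


subsection \<open>Approximation errors and decay\<close>

text \<open>Vectors are functions here, with pointwise operations.\<close>

definition dual_space ::
  "('k::real_or_complex, 'b \<Rightarrow> 'k) ip_space \<Rightarrow> (('b \<Rightarrow> 'k) \<Rightarrow> 'k) set" where
  "dual_space X = {l.
     (\<forall>f\<in>vecs X. \<forall>g\<in>vecs X. l (\<lambda>x. f x + g x) = l f + l g) \<and>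
     (\<forall>c. \<forall>f\<in>vecs X. l (\<lambda>x. c * f x) = c * l f) \<and>
     (\<exists>B. \<forall>f\<in>vecs X. norm (l f) \<le> B * ip_norm X f)}"

definition alg_all ::
  "nat \<Rightarrow> ('k::real_or_complex, 'b \<Rightarrow> 'k) ip_space \<Rightarrow> ('k, 'c \<Rightarrow> 'k) ip_space \<Rightarrow>
    (('b \<Rightarrow> 'k) \<Rightarrow> ('c \<Rightarrow> 'k)) set" where
  "alg_all n X Z = {(\<lambda>f x. \<Sum>i\<in>{1..n}. l i f * z i x) | l z.
     (\<forall>i\<in>{1..n}. l i \<in> dual_space X \<and> z i \<in> vecs Z)}"

definition err ::
  "nat \<Rightarrow> ('k::real_or_complex, 'b \<Rightarrow> 'k) ip_space \<Rightarrow> ('k, 'c \<Rightarrow> 'k) ip_space \<Rightarrow>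
    (('b \<Rightarrow> 'k) \<Rightarrow> ('c \<Rightarrow> 'k)) \<Rightarrow> real" where
  "err n X Z T = (INF A\<in>alg_all n X Z.
     SUP f\<in>{f\<in>vecs X. ip_norm X f \<le> 1}. ip_norm Z (\<lambda>x. T f x - A f x))"

text \<open>In \<^typ>\<open>ennreal\<close> the supremum of the empty set is \<open>0\<close>.\<close>

definition decay :: "(nat \<Rightarrow> real) \<Rightarrow> ennreal" where
  "decay x = Sup {ennreal \<tau> | \<tau>. \<tau> > 0 \<and> (\<lambda>i. x i powr (1 / \<tau>)) summable_on {1..}}"

definition dec ::
  "('k::real_or_complex, 'b \<Rightarrow> 'k) ip_space \<Rightarrow> ('k, 'c \<Rightarrow> 'k) ip_space \<Rightarrow>
    (('b \<Rightarrow> 'k) \<Rightarrow> ('c \<Rightarrow> 'k)) \<Rightarrow> ennreal" where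
  "dec X Z T = decay (\<lambda>n. err n X Z T)"

text \<open>The \<open>dec\<close> of the canonical embedding of the tensor product of the \<open>X j\<close> into that of copies of
  the ambient space, both based on \<open>u\<close>.\<close>

definition dec_App ::
  "('a \<Rightarrow> 'a \<Rightarrow> 'k::real_or_complex) \<Rightarrow> 'a \<Rightarrow> (nat \<Rightarrow> ('k, 'a) ip_space) \<Rightarrow> ennreal" where
  "dec_App ip u X = dec (tensor X u) (tensor (space_H0 ip) u) (embed X (space_H0 ip) u)"

text \<open>The infimum over small indices, where \<open>x\<close> may involve a division by \<open>ln 1 = 0\<close>, does not affect the
  limit.\<close>

definition liminf2 :: "(nat \<Rightarrow> nat \<Rightarrow> real) \<Rightarrow> ereal" where
  "liminf2 x = lim (\<lambda>n. INF (\<nu>, j)\<in>{n..} \<times> {n..}. ereal (x \<nu> j))"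

end

theory Submission
  imports Defs
begin

text \<open>
  In the orthogonal basis of elementary tensors of basis vectors, indexed by the finitely supported
  multi-indices \<open>\<mu>\<close>, the embeddings are diagonal with squared singular values
  \<open>\<Prod>\<^sub>j w (\<mu> j) j powr (- 1)\<close>, where the weights \<open>w \<nu> j\<close> are \<open>1\<close> for \<open>\<nu> = 0\<close> and otherwise
  \<open>\<alpha> \<nu> j\<close> for \<open>H\<close> and \<open>F\<close>, and \<open>\<alpha> \<nu> 1 / \<gamma> j\<close> for \<open>G\<close>.  The \<open>n\<close>-th error is the singular
  value number \<open>n + 1\<close>.  The sum of the squared singular values to the power \<open>s\<close> is the
  product over \<open>j\<close> of \<open>1 + (\<Sum>\<nu>\<ge>1. w \<nu> j powr (- s))\<close>, so it is finite iff the double series of all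
  \<open>w \<nu> j powr (- s)\<close> converges.  The growth condition reduces convergence of the double series to
  that of its first row and its first column.
\<close>


subsection \<open>Scalars\<close>

text \<open>A tensor is given only as a functional, and inner product and embedding are definite
  descriptions over representing sequences. So nothing can be computed before each tensor is
  identified with its coefficients. Elementary tensors of basis vectors do double duty here: they
  are the orthogonal system, and evaluating a functional at one of them reads off one coefficient.
  The coefficients are the same in the domain and in the ambient product, only the weights change;
  this is what makes the embeddings diagonal. The scalars form an abstract class, so their
  completeness is derived first; infinite sums of scalars rely on it to pass from absolute
  summability to summability. The upper bounds for \<open>dec_App\<close> need only multi-indices
  with a single nonzero entry. The lower bounds need all of them, and there the inequality
  \<open>1 + x \<le> exp x\<close> turns the product over \<open>j\<close> into the double series.
  The factor \<open>1 / 2\<close> arises because the errors are singular values, whereas the weights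
  are reciprocals of their squares.\<close>

lemma kcnj_zero [simp]: "kcnj (0::'k::real_or_complex) = 0"
  using kcnj_add[of "0::'k" 0] by simp

lemma mult_kcnj_of_real: "x * kcnj x = of_real ((norm x)\<^sup>2)" for x :: "'k::real_or_complex"
  by (simp only: mult_kcnj of_real_def)

lemma kcnj_of_real [simp]: "kcnj (of_real r) = (of_real r :: 'k::real_or_complex)"
proof (cases "r = 0")
  case False
  then show ?thesis
    using mult_kcnj_of_real[of "of_real r :: 'k"] by (simp add: power2_eq_square)
qed simp

lemma kcnj_one [simp]: "kcnj (1::'k::real_or_complex) = 1"
  using kcnj_of_real[of 1] by simp

lemma kcnj_uminus [simp]: "kcnj (- x) = - kcnj (x::'k::real_or_complex)"
  using kcnj_add[of x "- x"] by (simp add: eq_neg_iff_add_eq_0 add.commute)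

lemma kcnj_diff: "kcnj (x - y) = kcnj x - kcnj (y::'k::real_or_complex)"
  using kcnj_add[of x "- y"] by simp

lemma norm_kcnj [simp]: "norm (kcnj x) = norm (x::'k::real_or_complex)"
proof (cases "x = 0")
  case False
  then show ?thesis
    using arg_cong[OF mult_kcnj_of_real[of x], of norm]
    by (simp add: norm_mult power2_eq_square)
qed simp

lemma kcnj_kcnj [simp]: "kcnj (kcnj x) = (x::'k::real_or_complex)"
proof (cases "x = 0")
  case False
  have "kcnj x * kcnj (kcnj x) = x * kcnj x"
    by (simp only: mult_kcnj_of_real norm_kcnj)
  moreover have "kcnj x \<noteq> 0"
    using False norm_kcnj[of x] by (metis norm_eq_zero)
  ultimately show ?thesis
    by simp
qed simp

lemma kcnj_sum: "kcnj (sum f A) = (\<Sum>x\<in>A. kcnj (f x :: 'k::real_or_complex))"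
  by (induction A rule: infinite_finite_induct) (simp_all add: kcnj_add)

lemma kcnj_prod: "kcnj (prod f A) = (\<Prod>x\<in>A. kcnj (f x :: 'k::real_or_complex))"
  by (induction A rule: infinite_finite_induct) (simp_all add: kcnj_mult)

text \<open>Products \<open>x * kcnj x\<close> are real by the axioms; applying this to
  \<open>1 + x\<close> and expanding isolates the mixed term \<open>x + kcnj x\<close>.\<close>

lemma add_kcnj_real: "\<exists>r. x + kcnj x = of_real r" for x :: "'k::real_or_complex"
proof -
  have "(1 + x) * kcnj (1 + x) = 1 + (x + kcnj x) + x * kcnj x"
    by (simp add: kcnj_add algebra_simps)
  then have "x + kcnj x = of_real ((norm (1 + x))\<^sup>2) - 1 - of_real ((norm x)\<^sup>2)"
    by (simp only: mult_kcnj_of_real) (simp add: algebra_simps)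
  also have "\<dots> = of_real ((norm (1 + x))\<^sup>2 - 1 - (norm x)\<^sup>2)"
    by simp
  finally show ?thesis ..
qed

text \<open>Both squares are negative reals: \<open>i * i = -1\<close>, and \<open>y * y\<close> is
  minus the squared norm of \<open>y\<close>. In a field the resulting difference of squares
  factors, and one of the two factors must vanish.\<close>

lemma skew_multiple:
  fixes i y :: "'k::real_or_complex"
  assumes "norm i = 1" "kcnj i = - i" "kcnj y = - y"
  shows "\<exists>b. y = of_real b * i"
proof -
  have "i * i = -1"
    using mult_kcnj_of_real[of i] assms(1,2) by (simp add: minus_equation_iff)
  moreover have "y * y = - of_real ((norm y)\<^sup>2)"
    using mult_kcnj_of_real[of y] assms(3) by (metis minus_equation_iff mult_minus_right)
  ultimately have "(y - of_real (norm y) * i) * (y + of_real (norm y) * i) = 0"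
    by (simp add: algebra_simps power2_eq_square)
       (metis (no_types, opaque_lifting) add.right_inverse mult.commute mult.left_commute mult_minus1_right)
  then have "y = of_real (norm y) * i \<or> y = of_real (- norm y) * i"
    by (auto simp: eq_neg_iff_add_eq_0)
  then show ?thesis by blast
qed

text \<open>
  All skew scalars are real multiples of one skew unit \<open>i\<close>, if there is any, so a Cauchy sequence
  reduces to two real ones: its real parts and its coefficients of \<open>i\<close>.
\<close>

instance real_or_complex \<subseteq> banach
proof
  fix X :: "nat \<Rightarrow> 'a"
  assume X: "Cauchy X"
  have conv: "convergent (\<lambda>n. of_real (r n) * c)"
    if "norm c = 1" "\<And>m n. norm (of_real (r m) * c - of_real (r n) * c) \<le> norm (X m - X n)"
    for r and c :: 'a
  proof -
    have "norm (r m - r n) \<le> norm (X m - X n)" for m n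
      using that(2)[of m n] that(1)
      by (simp flip: left_diff_distrib of_real_diff add: norm_mult)
    then have "Cauchy r"
      using X unfolding Cauchy_def dist_norm by (meson le_less_trans)
    then obtain l where "r \<longlonglongrightarrow> l"
      using Cauchy_convergent convergent_def by blast
    then show ?thesis
      by (intro convergentI[where L = "of_real l * c"] tendsto_intros)
  qed
  \<comment> \<open>\<open>R n\<close> is the real part and \<open>Y n\<close> the skew part of
    \<open>X n\<close>: \<open>kcnj\<close> fixes the one and negates the other.\<close>
  define R where "R n = (X n + kcnj (X n)) / 2" for n
  define Y where "Y n = (X n - kcnj (X n)) / 2" for n
  have diff_R: "norm (R m - R n) \<le> norm (X m - X n)" for m n
  proof -
    define x where "x = X m - X n"
    have "norm (R m - R n) = norm (x + kcnj x) / 2"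
      by (simp add: x_def R_def Y_def kcnj_diff norm_divide flip: diff_divide_distrib)
         (simp add: algebra_simps)
    also have "\<dots> \<le> norm x"
      using norm_triangle_ineq[of x "kcnj x"] by simp
    finally show ?thesis by (simp add: x_def)
  qed
  have diff_Y: "norm (Y m - Y n) \<le> norm (X m - X n)" for m n
  proof -
    define x where "x = X m - X n"
    have "norm (Y m - Y n) = norm (x - kcnj x) / 2"
      by (simp add: x_def R_def Y_def kcnj_diff norm_divide flip: diff_divide_distrib)
         (simp add: algebra_simps)
    also have "\<dots> \<le> norm x"
      using norm_triangle_ineq4[of x "kcnj x"] by simp
    finally show ?thesis by (simp add: x_def)
  qed
  have "\<forall>n. \<exists>r. R n = of_real r"
  proof
    fix n
    obtain r where "X n + kcnj (X n) = of_real r"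
      using add_kcnj_real by blast
    then have "R n = of_real (r / 2)"
      by (simp add: R_def)
    then show "\<exists>r. R n = of_real r" ..
  qed
  then obtain r where r: "\<And>n. R n = of_real (r n)"
    by metis
  have R: "convergent R"
    using conv[of 1 r] diff_R by (simp add: r[abs_def])
  have skew: "kcnj (Y n) = - Y n" for n
  proof -
    have "Y n = (X n - kcnj (X n)) * of_real (1 / 2)"
      by (simp add: Y_def)
    then show ?thesis
      by (simp only: kcnj_mult kcnj_of_real kcnj_diff kcnj_kcnj minus_mult_left minus_diff_eq)
  qed
  have Y: "convergent Y"
  proof (cases "\<forall>n. Y n = 0")
    case True
    then have "Y = (\<lambda>_. 0)" by auto
    then show ?thesis by (simp add: convergent_const)
  next
    case False
    then obtain k where k: "Y k \<noteq> 0" by blast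
    \<comment> \<open>One nonzero skew part, normalised, serves as the unit for all the
      others.\<close>
    define i where "i = Y k * of_real (1 / norm (Y k))"
    have i: "norm i = 1" "kcnj i = - i"
      using k skew[of k] by (simp_all add: i_def norm_mult kcnj_mult del: of_real_divide)
    have "\<forall>n. \<exists>b. Y n = of_real b * i"
      using skew_multiple[OF i skew] by blast
    then obtain b where b: "\<And>n. Y n = of_real (b n) * i"
      by metis
    show ?thesis
      using conv[OF i(1), of b] diff_Y by (simp add: b[abs_def])
  qed
  have "X = (\<lambda>n. R n + Y n)"
    by (simp add: fun_eq_iff R_def Y_def field_simps)
  then show "convergent X"
    using convergent_add[OF R Y] by simp
qed


subsection \<open>Weighted square summable families\<close>

text \<open>The family \<open>\<phi>\<close> stands for the vector with coefficients
  \<open>\<phi> \<mu>\<close> in an orthogonal system whose members have squared norms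
  \<open>W \<mu>\<close>. The same notions serve single factors, their tensor products and the
  ambient space.\<close>

definition sq_summable :: "('i \<Rightarrow> real) \<Rightarrow> 'i set \<Rightarrow> ('i \<Rightarrow> 'k::real_or_complex) \<Rightarrow> bool" where
  "sq_summable W A \<phi> \<longleftrightarrow> (\<lambda>\<mu>. W \<mu> * (norm (\<phi> \<mu>))\<^sup>2) summable_on A"

definition sq_norm :: "('i \<Rightarrow> real) \<Rightarrow> 'i set \<Rightarrow> ('i \<Rightarrow> 'k::real_or_complex) \<Rightarrow> real" where
  "sq_norm W A \<phi> = sqrt (\<Sum>\<^sub>\<infinity>\<mu>\<in>A. W \<mu> * (norm (\<phi> \<mu>))\<^sup>2)"

definition sq_ip ::
  "('i \<Rightarrow> real) \<Rightarrow> 'i set \<Rightarrow> ('i \<Rightarrow> 'k::real_or_complex) \<Rightarrow> ('i \<Rightarrow> 'k) \<Rightarrow> 'k" where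
  "sq_ip W A \<phi> \<psi> = (\<Sum>\<^sub>\<infinity>\<mu>\<in>A. of_real (W \<mu>) * \<phi> \<mu> * kcnj (\<psi> \<mu>))"

lemma summable_on_bounded_sums:
  fixes f :: "'i \<Rightarrow> real"
  assumes "\<And>x. x \<in> A \<Longrightarrow> 0 \<le> f x" "\<And>S. finite S \<Longrightarrow> S \<subseteq> A \<Longrightarrow> sum f S \<le> B"
  shows "f summable_on A" and "infsum f A \<le> B"
proof -
  show "f summable_on A"
    using assms by (intro nonneg_bdd_above_summable_on) (auto intro!: bdd_aboveI2[where M = B])
  then show "infsum f A \<le> B"
    using assms(2) by (intro infsum_le_finite_sums) auto
qed

lemma infsum_diff:
  fixes f g :: "'i \<Rightarrow> 'b::{topological_ab_group_add, t2_space}"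
  assumes "f summable_on A" "g summable_on A"
  shows "(\<Sum>\<^sub>\<infinity>x\<in>A. f x - g x) = infsum f A - infsum g A"
  using infsum_add[OF assms(1) summable_on_uminus[THEN iffD2, OF assms(2)]]
  by (simp add: infsum_uminus)

locale weights =
  fixes W :: "'i \<Rightarrow> real" and A :: "'i set"
  assumes W_nonneg: "\<mu> \<in> A \<Longrightarrow> 0 \<le> W \<mu>"
begin

lemma sq_norm_nonneg [simp]: "0 \<le> sq_norm W A \<phi>"
  by (auto simp: sq_norm_def W_nonneg intro!: infsum_nonneg)

lemma L2_set_le_sq_norm:
  assumes "sq_summable W A \<phi>" "finite S" "S \<subseteq> A"
  shows "L2_set (\<lambda>\<mu>. sqrt (W \<mu>) * norm (\<phi> \<mu>)) S \<le> sq_norm W A \<phi>"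
proof -
  have "(\<Sum>\<mu>\<in>S. (sqrt (W \<mu>) * norm (\<phi> \<mu>))\<^sup>2) = (\<Sum>\<mu>\<in>S. W \<mu> * (norm (\<phi> \<mu>))\<^sup>2)"
    using assms W_nonneg by (intro sum.cong) (auto simp: power_mult_distrib)
  also have "\<dots> \<le> (\<Sum>\<^sub>\<infinity>\<mu>\<in>A. W \<mu> * (norm (\<phi> \<mu>))\<^sup>2)"
    using assms W_nonneg by (intro finite_sum_le_infsum) (auto simp: sq_summable_def)
  finally show ?thesis
    by (simp add: sq_norm_def L2_set_def)
qed

text \<open>Bounds on all finite sections suffice for the whole family. This carries the triangle
  inequality over from \<open>L2_set\<close>, and later norm bounds over to pointwise
  limits.\<close>

lemma sq_norm_leI:
  assumes "\<And>S. finite S \<Longrightarrow> S \<subseteq> A \<Longrightarrow> L2_set (\<lambda>\<mu>. sqrt (W \<mu>) * norm (\<phi> \<mu>)) S \<le> B"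
  shows "sq_summable W A \<phi>" and "sq_norm W A \<phi> \<le> B"
proof -
  have B: "0 \<le> B"
    using assms[of "{}"] by simp
  have le: "(\<Sum>\<mu>\<in>S. W \<mu> * (norm (\<phi> \<mu>))\<^sup>2) \<le> B\<^sup>2" if "finite S" "S \<subseteq> A" for S
  proof -
    have "(\<Sum>\<mu>\<in>S. W \<mu> * (norm (\<phi> \<mu>))\<^sup>2) = (\<Sum>\<mu>\<in>S. (sqrt (W \<mu>) * norm (\<phi> \<mu>))\<^sup>2)"
      using that W_nonneg by (intro sum.cong) (auto simp: power_mult_distrib)
    also have "\<dots> = (L2_set (\<lambda>\<mu>. sqrt (W \<mu>) * norm (\<phi> \<mu>)) S)\<^sup>2"
      by (simp add: L2_set_def sum_nonneg)
    finally show ?thesis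
      using assms[OF that] by (simp add: power_mono)
  qed
  show "sq_summable W A \<phi>"
    unfolding sq_summable_def using le W_nonneg
    by (intro summable_on_bounded_sums(1)[where B = "B\<^sup>2"]) auto
  have "(\<Sum>\<^sub>\<infinity>\<mu>\<in>A. W \<mu> * (norm (\<phi> \<mu>))\<^sup>2) \<le> B\<^sup>2"
    using le W_nonneg by (intro summable_on_bounded_sums(2)) auto
  then show "sq_norm W A \<phi> \<le> B"
    unfolding sq_norm_def using B by (metis real_sqrt_le_iff real_sqrt_abs abs_of_nonneg)
qed

lemma sq_summable_add:
  assumes "sq_summable W A \<phi>" "sq_summable W A \<psi>"
  shows "sq_summable W A (\<lambda>\<mu>. \<phi> \<mu> + \<psi> \<mu>)"
    and "sq_norm W A (\<lambda>\<mu>. \<phi> \<mu> + \<psi> \<mu>) \<le> sq_norm W A \<phi> + sq_norm W A \<psi>"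
proof -
  have *: "L2_set (\<lambda>\<mu>. sqrt (W \<mu>) * norm (\<phi> \<mu> + \<psi> \<mu>)) S \<le> sq_norm W A \<phi> + sq_norm W A \<psi>"
    if S: "finite S" "S \<subseteq> A" for S
  proof -
    have "L2_set (\<lambda>\<mu>. sqrt (W \<mu>) * norm (\<phi> \<mu> + \<psi> \<mu>)) S
        \<le> L2_set (\<lambda>\<mu>. sqrt (W \<mu>) * norm (\<phi> \<mu>) + sqrt (W \<mu>) * norm (\<psi> \<mu>)) S"
      using S W_nonneg
      by (intro L2_set_mono) (auto simp flip: distrib_left intro!: mult_left_mono norm_triangle_ineq)
    also have "\<dots> \<le> L2_set (\<lambda>\<mu>. sqrt (W \<mu>) * norm (\<phi> \<mu>)) S + L2_set (\<lambda>\<mu>. sqrt (W \<mu>) * norm (\<psi> \<mu>)) S"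
      by (rule L2_set_triangle_ineq)
    also have "\<dots> \<le> sq_norm W A \<phi> + sq_norm W A \<psi>"
      using assms S by (intro add_mono L2_set_le_sq_norm)
    finally show ?thesis .
  qed
  show "sq_summable W A (\<lambda>\<mu>. \<phi> \<mu> + \<psi> \<mu>)"
    and "sq_norm W A (\<lambda>\<mu>. \<phi> \<mu> + \<psi> \<mu>) \<le> sq_norm W A \<phi> + sq_norm W A \<psi>"
    by (rule sq_norm_leI[OF *]; assumption)+
qed

lemma sq_summable_cmult:
  assumes "sq_summable W A \<phi>"
  shows "sq_summable W A (\<lambda>\<mu>. c * \<phi> \<mu>)"
    and "sq_norm W A (\<lambda>\<mu>. c * \<phi> \<mu>) = norm c * sq_norm W A \<phi>"
proof -
  have eq: "(\<lambda>\<mu>. W \<mu> * (norm (c * \<phi> \<mu>))\<^sup>2) = (\<lambda>\<mu>. (norm c)\<^sup>2 * (W \<mu> * (norm (\<phi> \<mu>))\<^sup>2))"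
    by (simp add: fun_eq_iff norm_mult power_mult_distrib)
  show "sq_summable W A (\<lambda>\<mu>. c * \<phi> \<mu>)"
    using assms unfolding sq_summable_def eq by (rule summable_on_cmult_right)
  show "sq_norm W A (\<lambda>\<mu>. c * \<phi> \<mu>) = norm c * sq_norm W A \<phi>"
    unfolding sq_norm_def eq by (simp add: infsum_cmult_right' real_sqrt_mult)
qed

lemma sq_summable_diff:
  assumes "sq_summable W A \<phi>" "sq_summable W A \<psi>"
  shows "sq_summable W A (\<lambda>\<mu>. \<phi> \<mu> - \<psi> \<mu>)"
    and "sq_norm W A (\<lambda>\<mu>. \<phi> \<mu> - \<psi> \<mu>) \<le> sq_norm W A \<phi> + sq_norm W A \<psi>"
proof -
  note m = sq_summable_cmult[OF assms(2), of "-1"]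
  have eq: "(\<lambda>\<mu>. \<phi> \<mu> - \<psi> \<mu>) = (\<lambda>\<mu>. \<phi> \<mu> + -1 * \<psi> \<mu>)"
    by simp
  show "sq_summable W A (\<lambda>\<mu>. \<phi> \<mu> - \<psi> \<mu>)"
    unfolding eq by (rule sq_summable_add(1)[OF assms(1) m(1)])
  show "sq_norm W A (\<lambda>\<mu>. \<phi> \<mu> - \<psi> \<mu>) \<le> sq_norm W A \<phi> + sq_norm W A \<psi>"
    unfolding eq using sq_summable_add(2)[OF assms(1) m(1)] m(2) by simp
qed

lemma cauchy_schwarz:
  assumes "sq_summable W A \<phi>" "sq_summable W A \<psi>"
  shows "(\<lambda>\<mu>. norm (of_real (W \<mu>) * \<phi> \<mu> * kcnj (\<psi> \<mu>))) summable_on A"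
    and "norm (sq_ip W A \<phi> \<psi>) \<le> sq_norm W A \<phi> * sq_norm W A \<psi>"
proof -
  let ?f = "\<lambda>\<mu>. norm (of_real (W \<mu>) * \<phi> \<mu> * kcnj (\<psi> \<mu>))"
  have le: "sum ?f S \<le> sq_norm W A \<phi> * sq_norm W A \<psi>" if S: "finite S" "S \<subseteq> A" for S
  proof -
    have "sum ?f S = (\<Sum>\<mu>\<in>S. \<bar>sqrt (W \<mu>) * norm (\<phi> \<mu>)\<bar> * \<bar>sqrt (W \<mu>) * norm (\<psi> \<mu>)\<bar>)"
    proof (rule sum.cong[OF refl])
      fix \<mu> assume "\<mu> \<in> S"
      then have W: "0 \<le> W \<mu>"
        using S W_nonneg by auto
      have "\<bar>sqrt (W \<mu>) * norm (\<phi> \<mu>)\<bar> * \<bar>sqrt (W \<mu>) * norm (\<psi> \<mu>)\<bar>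
          = (sqrt (W \<mu>) * norm (\<phi> \<mu>)) * (sqrt (W \<mu>) * norm (\<psi> \<mu>))"
        using W by (simp only: abs_of_nonneg mult_nonneg_nonneg real_sqrt_ge_zero norm_ge_zero)
      also have "\<dots> = (sqrt (W \<mu>))\<^sup>2 * (norm (\<phi> \<mu>) * norm (\<psi> \<mu>))"
        by (simp only: power2_eq_square mult_ac)
      also have "\<dots> = ?f \<mu>"
        using W by (simp add: norm_mult)
      finally show "?f \<mu> = \<bar>sqrt (W \<mu>) * norm (\<phi> \<mu>)\<bar> * \<bar>sqrt (W \<mu>) * norm (\<psi> \<mu>)\<bar>" ..
    qed
    also have "\<dots> \<le> L2_set (\<lambda>\<mu>. sqrt (W \<mu>) * norm (\<phi> \<mu>)) S * L2_set (\<lambda>\<mu>. sqrt (W \<mu>) * norm (\<psi> \<mu>)) S"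
      by (rule L2_set_mult_ineq)
    also have "\<dots> \<le> sq_norm W A \<phi> * sq_norm W A \<psi>"
      using assms S by (intro mult_mono L2_set_le_sq_norm) auto
    finally show ?thesis .
  qed
  show abs: "?f summable_on A"
    using le by (intro summable_on_bounded_sums(1)[where B = "sq_norm W A \<phi> * sq_norm W A \<psi>"]) auto
  have "norm (sq_ip W A \<phi> \<psi>) \<le> infsum ?f A"
    unfolding sq_ip_def using abs by (rule norm_infsum_bound)
  also have "\<dots> \<le> sq_norm W A \<phi> * sq_norm W A \<psi>"
    using le by (intro summable_on_bounded_sums(2)) auto
  finally show "norm (sq_ip W A \<phi> \<psi>) \<le> sq_norm W A \<phi> * sq_norm W A \<psi>" .
qed

lemma sq_ip_summable:
  assumes "sq_summable W A \<phi>" "sq_summable W A \<psi>"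
  shows "(\<lambda>\<mu>. of_real (W \<mu>) * \<phi> \<mu> * kcnj (\<psi> \<mu>)) summable_on A"
  using cauchy_schwarz(1)[OF assms] by (rule abs_summable_summable)

lemma sq_ip_self: "sq_summable W A \<phi> \<Longrightarrow> sq_ip W A \<phi> \<phi> = of_real ((sq_norm W A \<phi>)\<^sup>2)"
proof -
  assume a: "sq_summable W A \<phi>"
  have "sq_ip W A \<phi> \<phi> = (\<Sum>\<^sub>\<infinity>\<mu>\<in>A. of_real (W \<mu> * (norm (\<phi> \<mu>))\<^sup>2))"
    unfolding sq_ip_def by (simp add: mult.assoc mult_kcnj_of_real)
  also have "\<dots> = of_real (\<Sum>\<^sub>\<infinity>\<mu>\<in>A. W \<mu> * (norm (\<phi> \<mu>))\<^sup>2)"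
    using a by (intro infsumI has_sum_of_real has_sum_infsum) (simp add: sq_summable_def)
  also have "(\<Sum>\<^sub>\<infinity>\<mu>\<in>A. W \<mu> * (norm (\<phi> \<mu>))\<^sup>2) = (sq_norm W A \<phi>)\<^sup>2"
    unfolding sq_norm_def by (simp add: W_nonneg infsum_nonneg)
  finally show ?thesis .
qed

lemma sq_ip_diff_left:
  assumes "sq_summable W A \<phi>" "sq_summable W A \<phi>'" "sq_summable W A \<psi>"
  shows "sq_ip W A (\<lambda>\<mu>. \<phi> \<mu> - \<phi>' \<mu>) \<psi> = sq_ip W A \<phi> \<psi> - sq_ip W A \<phi>' \<psi>"
proof -
  show ?thesis
    unfolding sq_ip_def
    by (subst infsum_diff[OF sq_ip_summable[OF assms(1,3)] sq_ip_summable[OF assms(2,3)], symmetric])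
       (simp add: algebra_simps)
qed

lemma sq_ip_diff_right:
  assumes "sq_summable W A \<phi>" "sq_summable W A \<psi>" "sq_summable W A \<psi>'"
  shows "sq_ip W A \<phi> (\<lambda>\<mu>. \<psi> \<mu> - \<psi>' \<mu>) = sq_ip W A \<phi> \<psi> - sq_ip W A \<phi> \<psi>'"
proof -
  show ?thesis
    unfolding sq_ip_def
    by (subst infsum_diff[OF sq_ip_summable[OF assms(1,2)] sq_ip_summable[OF assms(1,3)], symmetric])
       (simp add: kcnj_diff algebra_simps)
qed

lemma sq_summable_finite_support:
  assumes "finite {\<mu>\<in>A. \<phi> \<mu> \<noteq> 0}"
  shows "sq_summable W A \<phi>"
  unfolding sq_summable_def
  by (rule finite_nonzero_values_imp_summable_on) (rule finite_subset[OF _ assms], auto)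

lemma tendsto_sq_ip:
  assumes "\<And>n. sq_summable W A (s n)" "sq_summable W A \<phi>"
    and "\<And>n. sq_summable W A (t n)" "sq_summable W A \<psi>"
    and "(\<lambda>n. sq_norm W A (\<lambda>\<mu>. s n \<mu> - \<phi> \<mu>)) \<longlonglongrightarrow> 0"
    and "(\<lambda>n. sq_norm W A (\<lambda>\<mu>. t n \<mu> - \<psi> \<mu>)) \<longlonglongrightarrow> 0"
  shows "(\<lambda>n. sq_ip W A (s n) (t n)) \<longlonglongrightarrow> sq_ip W A \<phi> \<psi>"
proof -
  define a where "a n = sq_norm W A (\<lambda>\<mu>. s n \<mu> - \<phi> \<mu>)" for n
  define b where "b n = sq_norm W A (\<lambda>\<mu>. t n \<mu> - \<psi> \<mu>)" for n
  have s: "sq_summable W A (\<lambda>\<mu>. s n \<mu> - \<phi> \<mu>)" and t: "sq_summable W A (\<lambda>\<mu>. t n \<mu> - \<psi> \<mu>)" for n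
    using assms by (auto intro: sq_summable_diff)
  have "norm (sq_ip W A (s n) (t n) - sq_ip W A \<phi> \<psi>) \<le>
      a n * b n + a n * sq_norm W A \<psi> + sq_norm W A \<phi> * b n" for n
  proof -
    \<comment> \<open>Expanding about the limits leaves three terms, each containing a factor that
      tends to zero.\<close>
    have "sq_ip W A (s n) (t n) - sq_ip W A \<phi> \<psi> =
        sq_ip W A (\<lambda>\<mu>. s n \<mu> - \<phi> \<mu>) (\<lambda>\<mu>. t n \<mu> - \<psi> \<mu>) + sq_ip W A (\<lambda>\<mu>. s n \<mu> - \<phi> \<mu>) \<psi>
        + sq_ip W A \<phi> (\<lambda>\<mu>. t n \<mu> - \<psi> \<mu>)"
      using assms s t by (simp add: sq_ip_diff_left sq_ip_diff_right)
    also have "norm \<dots> \<le> a n * b n + a n * sq_norm W A \<psi> + sq_norm W A \<phi> * b n"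
      unfolding a_def b_def using assms s t
      by (intro norm_triangle_mono cauchy_schwarz(2))
    finally show ?thesis .
  qed
  moreover have "(\<lambda>n. a n * b n + a n * sq_norm W A \<psi> + sq_norm W A \<phi> * b n) \<longlonglongrightarrow>
      0 * 0 + 0 * sq_norm W A \<psi> + sq_norm W A \<phi> * 0"
    unfolding a_def b_def by (intro tendsto_intros assms)
  then have "(\<lambda>n. a n * b n + a n * sq_norm W A \<psi> + sq_norm W A \<phi> * b n) \<longlonglongrightarrow> 0"
    by simp
  ultimately have "(\<lambda>n. sq_ip W A (s n) (t n) - sq_ip W A \<phi> \<psi>) \<longlonglongrightarrow> 0"
    by (rule Lim_null_comparison[OF always_eventually[OF allI]])
  then show ?thesis
    by (rule LIM_zero_cancel)
qed

text \<open>The limit is given pointwise instead of being constructed, since in the application it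
  consists of values of a functional. The Cauchy bound restricted to a finite section survives the
  limit in \<open>m\<close>, and \<open>sq_norm_leI\<close> restores the full norm.\<close>

lemma sq_norm_complete:
  assumes "\<And>n. sq_summable W A (s n)"
    and cauchy: "\<And>\<epsilon>. \<epsilon> > 0 \<Longrightarrow> \<exists>N. \<forall>m\<ge>N. \<forall>n\<ge>N. sq_norm W A (\<lambda>\<mu>. s m \<mu> - s n \<mu>) < \<epsilon>"
    and ptw: "\<And>\<mu>. \<mu> \<in> A \<Longrightarrow> (\<lambda>n. s n \<mu>) \<longlonglongrightarrow> \<phi> \<mu>"
  shows "sq_summable W A \<phi>" and "(\<lambda>n. sq_norm W A (\<lambda>\<mu>. s n \<mu> - \<phi> \<mu>)) \<longlonglongrightarrow> 0"
proof -
  have main: "\<exists>N. \<forall>n\<ge>N. sq_summable W A (\<lambda>\<mu>. s n \<mu> - \<phi> \<mu>) \<and> sq_norm W A (\<lambda>\<mu>. s n \<mu> - \<phi> \<mu>) \<le> \<epsilon>"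
    if \<epsilon>: "\<epsilon> > 0" for \<epsilon>
  proof -
    obtain N where N: "\<forall>m\<ge>N. \<forall>n\<ge>N. sq_norm W A (\<lambda>\<mu>. s m \<mu> - s n \<mu>) < \<epsilon>"
      using cauchy[OF \<epsilon>] ..
    have le: "L2_set (\<lambda>\<mu>. sqrt (W \<mu>) * norm (s n \<mu> - \<phi> \<mu>)) S \<le> \<epsilon>"
      if n: "n \<ge> N" and S: "finite S" "S \<subseteq> A" for n S
    proof (rule tendsto_upperbound)
      show "(\<lambda>m. L2_set (\<lambda>\<mu>. sqrt (W \<mu>) * norm (s n \<mu> - s m \<mu>)) S)
          \<longlonglongrightarrow> L2_set (\<lambda>\<mu>. sqrt (W \<mu>) * norm (s n \<mu> - \<phi> \<mu>)) S"
        unfolding L2_set_def using S(2)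
        by (intro tendsto_real_sqrt tendsto_sum tendsto_power tendsto_mult tendsto_const tendsto_norm
            tendsto_diff ptw) blast
      show "\<forall>\<^sub>F m in sequentially. L2_set (\<lambda>\<mu>. sqrt (W \<mu>) * norm (s n \<mu> - s m \<mu>)) S \<le> \<epsilon>"
      proof (rule eventually_sequentiallyI)
        fix m assume "m \<ge> N"
        then have "sq_norm W A (\<lambda>\<mu>. s n \<mu> - s m \<mu>) < \<epsilon>"
          using N n by simp
        then show "L2_set (\<lambda>\<mu>. sqrt (W \<mu>) * norm (s n \<mu> - s m \<mu>)) S \<le> \<epsilon>"
          using L2_set_le_sq_norm[OF sq_summable_diff(1)[OF assms(1) assms(1)] S, of n m]
          by linarith
      qed
    qed simp
    show ?thesis
      using sq_norm_leI[OF le] by blast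
  qed
  obtain N where "sq_summable W A (\<lambda>\<mu>. s N \<mu> - \<phi> \<mu>)"
    using main[OF zero_less_one] by blast
  \<comment> \<open>\<open>\<phi>\<close> is the difference of \<open>s N\<close> and
    \<open>s N - \<phi>\<close>, both square summable.\<close>
  from sq_summable_diff(1)[OF assms(1)[of N] this] show "sq_summable W A \<phi>"
    by (simp only: diff_diff_eq2 add_diff_cancel_left')
  show "(\<lambda>n. sq_norm W A (\<lambda>\<mu>. s n \<mu> - \<phi> \<mu>)) \<longlonglongrightarrow> 0"
  proof (rule LIMSEQ_I)
    fix r :: real assume "r > 0"
    then obtain N where "\<forall>n\<ge>N. sq_norm W A (\<lambda>\<mu>. s n \<mu> - \<phi> \<mu>) \<le> r / 2"
      using main[of "r / 2"] by auto
    then show "\<exists>N. \<forall>n\<ge>N. norm (sq_norm W A (\<lambda>\<mu>. s n \<mu> - \<phi> \<mu>) - 0) < r"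
      using \<open>r > 0\<close> by (intro exI[of _ N]) auto
  qed
qed

lemma sq_norm_truncate:
  assumes "sq_summable W A \<phi>" "\<epsilon> > 0"
  shows "\<exists>S. finite S \<and> S \<subseteq> A \<and> sq_norm W A (\<lambda>\<mu>. (if \<mu> \<in> S then \<phi> \<mu> else 0) - \<phi> \<mu>) < \<epsilon>"
proof -
  let ?f = "\<lambda>\<mu>. W \<mu> * (norm (\<phi> \<mu>))\<^sup>2"
  have f: "?f summable_on A"
    using assms by (simp add: sq_summable_def)
  have e2: "0 < \<epsilon>\<^sup>2"
    using assms(2) by simp
  obtain S where S: "finite S" "S \<subseteq> A" "dist (sum ?f S) (infsum ?f A) \<le> \<epsilon>\<^sup>2 / 2"
    using infsum_finite_approximation[OF f, of "\<epsilon>\<^sup>2 / 2"] assms(2) by auto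
  have "(\<Sum>\<^sub>\<infinity>\<mu>\<in>A. W \<mu> * (norm ((if \<mu> \<in> S then \<phi> \<mu> else 0) - \<phi> \<mu>))\<^sup>2) = infsum ?f (A - S)"
    by (rule infsum_cong_neutral) auto
  also have "\<dots> = infsum ?f A - sum ?f S"
  proof -
    have "infsum ?f (S \<union> (A - S)) = infsum ?f S + infsum ?f (A - S)"
      using S by (intro infsum_Un_disjoint summable_on_subset_banach[OF f]) auto
    then show ?thesis
      using S by (simp add: Un_absorb1)
  qed
  also have "\<dots> < \<epsilon>\<^sup>2"
    using S(3) e2 unfolding dist_real_def by linarith
  finally have "sqrt (\<Sum>\<^sub>\<infinity>\<mu>\<in>A. W \<mu> * (norm ((if \<mu> \<in> S then \<phi> \<mu> else 0) - \<phi> \<mu>))\<^sup>2) < \<epsilon>"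
    using assms(2) by (intro real_less_lsqrt) auto
  then show ?thesis
    using S by (auto simp: sq_norm_def)
qed

end


subsection \<open>Parseval's identity\<close>

context hilbert_space
begin

lemma ip_add_right: "ip x (y + z) = ip x y + ip x z"
  by (metis ip_add_left ip_commute kcnj_add)

lemma ip_scale_right: "ip x (smul c z) = kcnj c * ip x z"
  by (metis ip_scale_left ip_commute kcnj_mult)

lemma ip_zero_left [simp]: "ip 0 x = 0"
  using ip_add_left[of 0 0 x] by simp

lemma ip_zero_right [simp]: "ip x 0 = 0"
  using ip_add_right[of x 0 0] by simp

lemma ip_diff_left: "ip (x - y) z = ip x z - ip y z"
  using ip_add_left[of "x - y" y z] by simp

lemma ip_diff_right: "ip x (y - z) = ip x y - ip x z"
  using ip_add_right[of x "y - z" z] by simp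

lemma ip_sum_left: "ip (sum f A) z = (\<Sum>x\<in>A. ip (f x) z)"
  by (induction A rule: infinite_finite_induct) (simp_all add: ip_add_left)

lemma ip_sum_right: "ip z (sum f A) = (\<Sum>x\<in>A. ip z (f x))"
  by (induction A rule: infinite_finite_induct) (simp_all add: ip_add_right)

definition nrm2 :: "'a \<Rightarrow> real" where
  "nrm2 x = norm (ip x x)"

lemma nrm2_nonneg [simp]: "0 \<le> nrm2 x"
  by (simp add: nrm2_def)

lemma ip_self: "ip x x = of_real (nrm2 x)"
proof (cases "x = 0")
  case False
  then obtain r where "r > 0" "ip x x = of_real r"
    using ip_pos by blast
  then show ?thesis by (simp add: nrm2_def)
qed (simp add: nrm2_def)

lemma norm_ip_le: "norm (ip x y) \<le> sqrt (nrm2 x) * sqrt (nrm2 y)"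
proof (cases "y = 0")
  case False
  then have y: "nrm2 y > 0"
    using ip_pos[OF False] by (auto simp: nrm2_def)
  \<comment> \<open>The coefficient of the orthogonal projection of \<open>x\<close> onto
    \<open>y\<close>; the remainder has nonnegative squared norm, which is the inequality.\<close>
  define c where "c = ip x y * of_real (inverse (nrm2 y))"
  have kc: "kcnj c = ip y x * of_real (inverse (nrm2 y))"
    unfolding c_def kcnj_mult ip_commute[of y x] kcnj_of_real ..
  have "ip (x - smul c y) (x - smul c y) =
      ip x x - kcnj c * ip x y - c * ip y x + c * (kcnj c * ip y y)"
    by (simp add: ip_diff_left ip_diff_right ip_scale_left ip_scale_right algebra_simps)
  also have "c * (kcnj c * ip y y) = c * ip y x"
    using y by (simp add: kc ip_self)
  finally have "of_real (nrm2 (x - smul c y)) = of_real (nrm2 x) - kcnj c * ip x y"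
    by (simp add: ip_self)
  also have "kcnj c * ip x y = (ip x y * kcnj (ip x y)) * of_real (inverse (nrm2 y))"
    by (simp add: kc ip_commute[of x y])
  also have "\<dots> = of_real ((norm (ip x y))\<^sup>2 * inverse (nrm2 y))"
    by (simp only: mult_kcnj_of_real of_real_mult)
  finally have "of_real (nrm2 (x - smul c y)) =
      (of_real (nrm2 x - (norm (ip x y))\<^sup>2 * inverse (nrm2 y)) :: 'k)"
    by (simp only: of_real_diff)
  then have "nrm2 (x - smul c y) = nrm2 x - (norm (ip x y))\<^sup>2 * inverse (nrm2 y)"
    by (simp only: of_real_eq_iff)
  then have "(norm (ip x y))\<^sup>2 * inverse (nrm2 y) \<le> nrm2 x"
    using nrm2_nonneg[of "x - smul c y"] by linarith
  then have "(norm (ip x y))\<^sup>2 \<le> nrm2 x * nrm2 y"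
    using y by (simp add: field_simps)
  then show ?thesis
    by (simp add: real_le_rsqrt flip: real_sqrt_mult)
qed simp

end

locale hilbert_basis = hilbert_space smul ip
  for smul :: "'k::real_or_complex \<Rightarrow> 'a::ab_group_add \<Rightarrow> 'a" and ip +
  fixes e :: "nat \<Rightarrow> 'a"
  assumes basis: "orthonormal_basis smul ip e"
begin

lemma ip_basis: "ip (e \<mu>) (e \<nu>) = (if \<mu> = \<nu> then 1 else 0)"
  using basis by (auto simp: orthonormal_basis_def)

definition proj :: "nat set \<Rightarrow> 'a \<Rightarrow> 'a" where
  "proj S f = (\<Sum>\<nu>\<in>S. smul (ip f (e \<nu>)) (e \<nu>))"

lemma ip_proj:
  assumes "finite S"
  shows "ip (proj S f) (e \<nu>) = (if \<nu> \<in> S then ip f (e \<nu>) else 0)"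
proof -
  have "ip (proj S f) (e \<nu>) = (\<Sum>x\<in>S. if x = \<nu> then ip f (e x) else 0)"
    unfolding proj_def ip_sum_left ip_scale_left ip_basis by (intro sum.cong) auto
  then show ?thesis
    using assms by simp
qed

text \<open>The remainders are orthogonal to every \<open>e \<nu>\<close> with
  \<open>\<nu> \<in> S\<close>, so the mixed terms vanish.\<close>

lemma ip_split:
  assumes "finite S"
  shows "ip f g = (\<Sum>\<nu>\<in>S. ip f (e \<nu>) * ip (e \<nu>) g) + ip (f - proj S f) (g - proj S g)"
proof -
  have "ip (f - proj S f) (proj S g) = (\<Sum>\<nu>\<in>S. kcnj (ip g (e \<nu>)) * ip (f - proj S f) (e \<nu>))"
    by (simp add: proj_def[of S g] ip_sum_right ip_scale_right)
  also have "\<dots> = 0"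
    using assms by (intro sum.neutral) (simp add: ip_diff_left ip_proj)
  finally have "ip (f - proj S f) (g - proj S g) = ip f g - ip (proj S f) g"
    unfolding ip_diff_right[of "f - proj S f"] by (simp add: ip_diff_left)
  also have "ip (proj S f) g = (\<Sum>\<nu>\<in>S. ip f (e \<nu>) * ip (e \<nu>) g)"
    by (simp add: proj_def ip_sum_left ip_scale_left)
  finally show ?thesis by simp
qed

lemma ip_basis_self: "ip f (e \<nu>) * ip (e \<nu>) f = of_real ((norm (ip f (e \<nu>)))\<^sup>2)"
  unfolding ip_commute[of "e \<nu>" f] by (rule mult_kcnj_of_real)

lemma nrm2_split:
  assumes "finite S"
  shows "nrm2 f = (\<Sum>\<nu>\<in>S. (norm (ip f (e \<nu>)))\<^sup>2) + nrm2 (f - proj S f)"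
proof -
  have "of_real (nrm2 f) = (of_real ((\<Sum>\<nu>\<in>S. (norm (ip f (e \<nu>)))\<^sup>2) + nrm2 (f - proj S f)) :: 'k)"
    using ip_split[OF assms, of f f] unfolding ip_basis_self ip_self by simp
  then show ?thesis
    by (simp only: of_real_eq_iff)
qed

text \<open>The claim is made for all large finite \<open>T\<close>, not just one, because the
  expansion in the basis is an unordered sum along the filter of finite sets.\<close>

lemma span_range_proj:
  assumes "g \<in> span (range e)"
  shows "\<exists>S. finite S \<and> (\<forall>T. finite T \<longrightarrow> S \<subseteq> T \<longrightarrow> proj T g = g)"
  using assms
proof (induction rule: span_induct_alt)
  case base
  show ?case
    by (intro exI[of _ "{}"]) (simp add: proj_def)
next
  case (step c x y)
  then obtain \<nu> S where \<nu>: "x = e \<nu>" and S: "finite S" "\<forall>T. finite T \<longrightarrow> S \<subseteq> T \<longrightarrow> proj T y = y"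
    by blast
  have "proj T (smul c x + y) = smul c x + y" if T: "finite T" "insert \<nu> S \<subseteq> T" for T
  proof -
    have "proj T (smul c x + y) = (\<Sum>\<nu>'\<in>T. smul (if \<nu> = \<nu>' then c else 0) (e \<nu>')) + proj T y"
      by (simp add: proj_def \<nu> ip_add_left ip_scale_left ip_basis scale_left_distrib sum.distrib
          if_distrib[of "\<lambda>x. c * x"] cong: if_cong)
    also have "(\<Sum>\<nu>'\<in>T. smul (if \<nu> = \<nu>' then c else 0) (e \<nu>')) =
        (\<Sum>\<nu>'\<in>T. if \<nu> = \<nu>' then smul c (e \<nu>') else 0)"
      by (intro sum.cong) auto
    also have "\<dots> = smul c x"
      using T by (simp add: \<nu>)
    finally show ?thesis
      using S(2) T by simp
  qed
  then show ?case
    using S(1) by (intro exI[of _ "insert \<nu> S"]) auto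
qed

text \<open>Density of the span gives a finite combination \<open>g\<close> close to
  \<open>f\<close>. Once \<open>proj T\<close> fixes \<open>g\<close>, the remainders of
  \<open>f\<close> and of \<open>f - g\<close> coincide, and a remainder is never longer than the
  vector itself.\<close>

lemma nrm2_proj_small:
  assumes "\<epsilon> > 0"
  shows "\<exists>S. finite S \<and> (\<forall>T. finite T \<longrightarrow> S \<subseteq> T \<longrightarrow> sqrt (nrm2 (f - proj T f)) < \<epsilon>)"
proof -
  obtain g where g: "g \<in> span (range e)" "sqrt (nrm2 (f - g)) < \<epsilon>"
    using basis assms unfolding orthonormal_basis_def nrm2_def by blast
  obtain S where S: "finite S" "\<And>T. finite T \<Longrightarrow> S \<subseteq> T \<Longrightarrow> proj T g = g"
    using span_range_proj[OF g(1)] by blast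
  have "sqrt (nrm2 (f - proj T f)) < \<epsilon>" if T: "finite T" "S \<subseteq> T" for T
  proof -
    have "proj T (f - g) = proj T f - proj T g"
      by (simp add: proj_def ip_diff_left scale_left_diff_distrib sum_subtractf)
    then have "f - proj T f = (f - g) - proj T (f - g)"
      using S(2)[OF T] by simp
    moreover have "nrm2 ((f - g) - proj T (f - g)) \<le> nrm2 (f - g)"
      using nrm2_split[OF T(1), of "f - g"] sum_nonneg[of T "\<lambda>\<nu>. (norm (ip (f - g) (e \<nu>)))\<^sup>2"]
      by simp
    ultimately have "nrm2 (f - proj T f) \<le> nrm2 (f - g)"
      by (simp only:)
    then show ?thesis
      using g(2) by (meson le_less_trans real_sqrt_le_iff)
  qed
  then show ?thesis
    using S(1) by blast
qed

theorem parseval: "((\<lambda>\<nu>. ip f (e \<nu>) * ip (e \<nu>) g) has_sum ip f g) UNIV"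
  unfolding has_sum_def tendsto_iff eventually_finite_subsets_at_top
proof (intro allI impI)
  fix \<epsilon> :: real assume \<epsilon>: "\<epsilon> > 0"
  \<comment> \<open>The summand \<open>1\<close> keeps the denominator positive when
    \<open>nrm2 g = 0\<close>.\<close>
  obtain S where S: "finite S"
    "\<And>T. finite T \<Longrightarrow> S \<subseteq> T \<Longrightarrow> sqrt (nrm2 (f - proj T f)) < \<epsilon> / (sqrt (nrm2 g) + 1)"
    using nrm2_proj_small[of "\<epsilon> / (sqrt (nrm2 g) + 1)" f] \<epsilon>
    by (metis add_nonneg_pos divide_pos_pos nrm2_nonneg real_sqrt_ge_zero zero_less_one)
  have "dist (\<Sum>\<nu>\<in>T. ip f (e \<nu>) * ip (e \<nu>) g) (ip f g) < \<epsilon>" if T: "finite T" "S \<subseteq> T" for T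
  proof -
    have "dist (\<Sum>\<nu>\<in>T. ip f (e \<nu>) * ip (e \<nu>) g) (ip f g) = norm (ip (f - proj T f) (g - proj T g))"
      unfolding dist_norm norm_minus_commute[of _ "ip f g"] by (subst ip_split[OF T(1)]) simp
    also have "\<dots> \<le> sqrt (nrm2 (f - proj T f)) * sqrt (nrm2 (g - proj T g))"
      by (rule norm_ip_le)
    also have "\<dots> \<le> sqrt (nrm2 (f - proj T f)) * (sqrt (nrm2 g) + 1)"
    proof (rule mult_left_mono)
      have "nrm2 (g - proj T g) \<le> nrm2 g"
        using nrm2_split[OF T(1), of g] by (simp add: sum_nonneg)
      then have "sqrt (nrm2 (g - proj T g)) \<le> sqrt (nrm2 g)"
        by simp
      then show "sqrt (nrm2 (g - proj T g)) \<le> sqrt (nrm2 g) + 1"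
        by linarith
    qed simp
    also have "\<dots> < \<epsilon> / (sqrt (nrm2 g) + 1) * (sqrt (nrm2 g) + 1)"
      using S(2)[OF T] by (intro mult_strict_right_mono) (auto intro: add_nonneg_pos)
    also have "\<dots> = \<epsilon>"
    proof -
      have "sqrt (nrm2 g) + 1 \<noteq> 0"
        using real_sqrt_ge_zero[OF nrm2_nonneg[of g]] by linarith
      then show ?thesis by simp
    qed
    finally show ?thesis .
  qed
  then show "\<exists>X. finite X \<and> X \<subseteq> UNIV \<and> (\<forall>Y. finite Y \<and> X \<subseteq> Y \<and> Y \<subseteq> UNIV \<longrightarrow>
      dist (\<Sum>\<nu>\<in>Y. ip f (e \<nu>) * ip (e \<nu>) g) (ip f g) < \<epsilon>)"
    using S(1) by blast
qed

lemma bessel: "(\<lambda>\<nu>. (norm (ip f (e \<nu>)))\<^sup>2) summable_on A"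
proof (rule summable_on_bounded_sums(1))
  fix S :: "nat set" assume "finite S"
  then show "(\<Sum>\<nu>\<in>S. (norm (ip f (e \<nu>)))\<^sup>2) \<le> nrm2 f"
    using nrm2_split[of S f] by simp
qed simp

end


section \<open>Finite linear combinations of families, and series of products\<close>

lemma has_sum_sum:
  fixes F :: "'j \<Rightarrow> 'i \<Rightarrow> 'b::topological_comm_monoid_add"
  assumes "finite K" "\<And>k. k \<in> K \<Longrightarrow> (F k has_sum s k) A"
  shows "((\<lambda>x. \<Sum>k\<in>K. F k x) has_sum (\<Sum>k\<in>K. s k)) A"
  using assms by (induction K rule: finite_induct) (auto intro!: has_sum_add)

context weights
begin

lemma sq_summable_sum:
  assumes "finite K" "\<And>k. k \<in> K \<Longrightarrow> sq_summable W A (\<phi> k)"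
  shows "sq_summable W A (\<lambda>\<mu>. \<Sum>k\<in>K. a k * \<phi> k \<mu>)"
  using assms
proof (induction K rule: finite_induct)
  case empty
  then show ?case by (simp add: sq_summable_def)
next
  case (insert k K)
  then have "sq_summable W A (\<lambda>\<mu>. a k * \<phi> k \<mu> + (\<Sum>k\<in>K. a k * \<phi> k \<mu>))"
    by (intro sq_summable_add sq_summable_cmult) auto
  then show ?case
    using insert by simp
qed

lemma sq_ip_sum:
  assumes "finite K" "\<And>k. k \<in> K \<Longrightarrow> sq_summable W A (\<phi> k)"
    and "finite L" "\<And>l. l \<in> L \<Longrightarrow> sq_summable W A (\<psi> l)"
  shows "sq_ip W A (\<lambda>\<mu>. \<Sum>k\<in>K. a k * \<phi> k \<mu>) (\<lambda>\<mu>. \<Sum>l\<in>L. b l * \<psi> l \<mu>) =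
    (\<Sum>k\<in>K. \<Sum>l\<in>L. a k * kcnj (b l) * sq_ip W A (\<phi> k) (\<psi> l))"
proof -
  have "((\<lambda>\<mu>. \<Sum>k\<in>K. \<Sum>l\<in>L. a k * kcnj (b l) * (of_real (W \<mu>) * \<phi> k \<mu> * kcnj (\<psi> l \<mu>))) has_sum
      (\<Sum>k\<in>K. \<Sum>l\<in>L. a k * kcnj (b l) * sq_ip W A (\<phi> k) (\<psi> l))) A"
    unfolding sq_ip_def using assms
    by (intro has_sum_sum has_sum_cmult_right has_sum_infsum sq_ip_summable)
  moreover have "(\<Sum>k\<in>K. \<Sum>l\<in>L. a k * kcnj (b l) * (of_real (W \<mu>) * \<phi> k \<mu> * kcnj (\<psi> l \<mu>))) =
      of_real (W \<mu>) * (\<Sum>k\<in>K. a k * \<phi> k \<mu>) * kcnj (\<Sum>l\<in>L. b l * \<psi> l \<mu>)" for \<mu>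
    by (simp add: kcnj_sum kcnj_mult sum_distrib_left sum_distrib_right mult_ac)
  ultimately show ?thesis
    unfolding sq_ip_def by (simp add: infsumI)
qed

end

text \<open>A finite set of functions lies in the finite box spanned by its values, and over a box
  the sum of products is a product of sums.\<close>

lemma summable_on_prod_PiE:
  fixes f :: "'j \<Rightarrow> 'i \<Rightarrow> real"
  assumes "finite J" "\<And>j. j \<in> J \<Longrightarrow> f j summable_on B j"
    and "\<And>j x. j \<in> J \<Longrightarrow> x \<in> B j \<Longrightarrow> 0 \<le> f j x"
  shows "(\<lambda>h. \<Prod>j\<in>J. f j (h j)) summable_on (PiE J B)"
proof (rule summable_on_bounded_sums(1))
  fix S assume S: "finite S" "S \<subseteq> PiE J B"
  define C where "C j = (\<lambda>h. h j) ` S" for j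
  have C: "finite (C j)" "j \<in> J \<Longrightarrow> C j \<subseteq> B j" for j
    using S by (auto simp: C_def)
  have "(\<Sum>h\<in>S. \<Prod>j\<in>J. f j (h j)) \<le> (\<Sum>h\<in>PiE J C. \<Prod>j\<in>J. f j (h j))"
  proof (rule sum_mono2)
    show "finite (PiE J C)"
      using assms(1) C by (intro finite_PiE) auto
    show "S \<subseteq> PiE J C"
      using S by (auto simp: C_def PiE_def)
    show "0 \<le> (\<Prod>j\<in>J. f j (h j))" if "h \<in> PiE J C - S" for h
      using that C assms(3) by (intro prod_nonneg) (meson DiffD1 PiE_mem subsetD)
  qed
  also have "\<dots> = (\<Prod>j\<in>J. \<Sum>x\<in>C j. f j x)"
    using assms(1) C by (intro prod_sum_PiE[symmetric]) auto
  also have "\<dots> \<le> (\<Prod>j\<in>J. \<Sum>\<^sub>\<infinity>x\<in>B j. f j x)"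
    using C assms by (intro prod_mono conjI finite_sum_le_infsum sum_nonneg) (auto simp: subset_iff)
  finally show "(\<Sum>h\<in>S. \<Prod>j\<in>J. f j (h j)) \<le> (\<Prod>j\<in>J. \<Sum>\<^sub>\<infinity>x\<in>B j. f j x)" .
qed (use assms(3) in \<open>auto intro!: prod_nonneg\<close>)


subsection \<open>Multi-indices\<close>

definition supp :: "(nat \<Rightarrow> nat) \<Rightarrow> nat set" where
  "supp \<mu> = {j. \<mu> j \<noteq> 0}"

text \<open>Position \<open>0\<close> is no tensor factor; its entry is fixed to \<open>0\<close> so
  that a multi-index is determined by its entries at positive positions.\<close>

definition idx :: "nat set \<Rightarrow> (nat \<Rightarrow> nat) set" where
  "idx N = {\<mu>. \<mu> 0 = 0 \<and> finite (supp \<mu>) \<and> (\<forall>j. \<mu> j \<in> N)}"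

definition wt :: "(nat \<Rightarrow> nat \<Rightarrow> real) \<Rightarrow> (nat \<Rightarrow> nat) \<Rightarrow> real" where
  "wt w \<mu> = (\<Prod>j\<in>supp \<mu>. w (\<mu> j) j)"

lemma idx_supp: "\<mu> \<in> idx N \<Longrightarrow> finite (supp \<mu>) \<and> supp \<mu> \<subseteq> {1..}"
  by (auto simp: idx_def supp_def Suc_le_eq intro: ccontr)

lemma wt_superset:
  assumes "finite J" "supp \<mu> \<subseteq> J" "\<And>j. j \<in> J \<Longrightarrow> w 0 j = 1"
  shows "wt w \<mu> = (\<Prod>j\<in>J. w (\<mu> j) j)"
  unfolding wt_def using assms by (intro prod.mono_neutral_left) (auto simp: supp_def)

text \<open>Functions in a \<open>PiE\<close> are \<open>undefined\<close> outside \<open>J\<close>,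
  multi-indices are \<open>0\<close> there. The translation turns sums over multi-indices supported
  in \<open>J\<close> into sums over a product set.\<close>

definition extend :: "nat set \<Rightarrow> (nat \<Rightarrow> nat) \<Rightarrow> nat \<Rightarrow> nat" where
  "extend J h j = (if j \<in> J then h j else 0)"

lemma extend_bij:
  assumes "finite J" "J \<subseteq> {1..}" "0 \<in> N"
  shows "bij_betw (extend J) (PiE J (\<lambda>_. N)) {\<mu>\<in>idx N. supp \<mu> \<subseteq> J}"
proof (rule bij_betwI[where g = "\<lambda>\<mu>. restrict \<mu> J"])
  have "finite (supp (extend J h))" for h
    by (rule finite_subset[OF _ assms(1)]) (auto simp: supp_def extend_def)
  then show "extend J \<in> (PiE J (\<lambda>_. N)) \<rightarrow> {\<mu>\<in>idx N. supp \<mu> \<subseteq> J}"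
    using assms by (auto simp: idx_def extend_def supp_def)
  show "extend J (restrict \<mu> J) = \<mu>" if "\<mu> \<in> {\<mu>\<in>idx N. supp \<mu> \<subseteq> J}" for \<mu>
    using that by (auto simp: extend_def supp_def fun_eq_iff)
  show "restrict (extend J h) J = h" if "h \<in> PiE J (\<lambda>_. N)" for h
    using that by (auto simp: extend_def fun_eq_iff restrict_def PiE_def extensional_def)
qed (auto simp: idx_def)


section \<open>Coordinates of elementary tensors\<close>

context hilbert_basis
begin

definition ev :: "(nat \<Rightarrow> nat) \<Rightarrow> nat \<Rightarrow> 'a" where
  "ev \<mu> = (\<lambda>j\<in>{1..}. e (\<mu> j))"

text \<open>The inner product of the elementary tensors of \<open>f\<close> and
  \<open>ev \<mu>\<close> in the ambient space; the omitted factors are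
  \<open>ip (e 0) (e 0) = 1\<close>. It refers to no family \<open>X\<close> of factors, so domain
  and ambient space share these coefficients.\<close>

definition coord :: "(nat \<Rightarrow> 'a) \<Rightarrow> (nat \<Rightarrow> nat) \<Rightarrow> 'k" where
  "coord f \<mu> = (\<Prod>j\<in>{j\<in>{1..}. f j \<noteq> e 0 \<or> \<mu> j \<noteq> 0}. ip (f j) (e (\<mu> j)))"

lemma coord_superset:
  assumes "finite J" "{j\<in>{1..}. f j \<noteq> e 0 \<or> \<mu> j \<noteq> 0} \<subseteq> J" "J \<subseteq> {1..}"
  shows "coord f \<mu> = (\<Prod>j\<in>J. ip (f j) (e (\<mu> j)))"
  unfolding coord_def using assms
  by (intro prod.mono_neutral_left) (auto simp: ip_basis split: if_splits)

lemma coord_ev: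
  assumes "\<mu> \<in> idx N" "\<kappa> \<in> idx N"
  shows "coord (ev \<mu>) \<kappa> = (if \<mu> = \<kappa> then 1 else 0)"
proof -
  define J where "J = supp \<mu> \<union> supp \<kappa>"
  have J: "finite J" "J \<subseteq> {1..}"
    using idx_supp assms by (auto simp: J_def)
  have "coord (ev \<mu>) \<kappa> = (\<Prod>j\<in>J. ip (ev \<mu> j) (e (\<kappa> j)))"
    using J by (intro coord_superset) (auto simp: J_def supp_def ev_def intro: ccontr)
  also have "\<dots> = (\<Prod>j\<in>J. if \<mu> j = \<kappa> j then 1 else 0)"
    using J by (intro prod.cong) (auto simp: ev_def ip_basis)
  also have "\<dots> = (if \<mu> = \<kappa> then 1 else 0)"
  proof (cases "\<mu> = \<kappa>")
    case False
    then obtain j where "\<mu> j \<noteq> \<kappa> j"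
      by blast
    moreover from this have "j \<in> J"
      by (auto simp: J_def supp_def intro: ccontr)
    ultimately show ?thesis
      using False J by (auto intro!: prod_zero)
  qed simp
  finally show ?thesis .
qed

definition comb_coord :: "((nat \<Rightarrow> 'a) \<Rightarrow>\<^sub>0 'k) \<Rightarrow> (nat \<Rightarrow> nat) \<Rightarrow> 'k" where
  "comb_coord c \<mu> = (\<Sum>f\<in>Poly_Mapping.keys c. Poly_Mapping.lookup c f * coord f \<mu>)"

lemma comb_coord_superset:
  assumes "finite K" "Poly_Mapping.keys c \<subseteq> K"
  shows "comb_coord c \<mu> = (\<Sum>f\<in>K. Poly_Mapping.lookup c f * coord f \<mu>)"
  unfolding comb_coord_def using assms
  by (intro sum.mono_neutral_left) (auto simp: in_keys_iff)

lemma keys_diff_subset: "Poly_Mapping.keys (c - d) \<subseteq> Poly_Mapping.keys c \<union> Poly_Mapping.keys d"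
  by (auto simp: in_keys_iff lookup_minus)

lemma comb_coord_diff: "comb_coord (c - d) \<mu> = comb_coord c \<mu> - comb_coord d \<mu>"
proof -
  let ?K = "Poly_Mapping.keys c \<union> Poly_Mapping.keys d"
  have K: "finite ?K" by simp
  have "comb_coord (c - d) \<mu> = (\<Sum>f\<in>?K. Poly_Mapping.lookup (c - d) f * coord f \<mu>)"
    by (rule comb_coord_superset[OF K keys_diff_subset])
  moreover have "comb_coord c \<mu> = (\<Sum>f\<in>?K. Poly_Mapping.lookup c f * coord f \<mu>)"
    "comb_coord d \<mu> = (\<Sum>f\<in>?K. Poly_Mapping.lookup d f * coord f \<mu>)"
    by (intro comb_coord_superset[OF K]; auto)+
  ultimately show ?thesis
    by (simp add: lookup_minus left_diff_distrib sum_subtractf)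
qed

end


subsection \<open>Tensor products as weighted sequence spaces\<close>

text \<open>
  Each factor \<open>X j\<close> is seen through the coordinates \<open>ip f (e \<nu>)\<close>, \<open>\<nu> \<in> N\<close>, with squared
  norm \<open>w \<nu> j\<close> of \<open>e \<nu>\<close>; the index set is \<open>{0, 1}\<close> for \<open>F\<^sub>j\<close> and everything otherwise.
\<close>

locale weighted_factors = hilbert_basis smul ip e
  for smul :: "'k::real_or_complex \<Rightarrow> 'a::ab_group_add \<Rightarrow> 'a" and ip e +
  fixes X :: "nat \<Rightarrow> ('k, 'a) ip_space" and N :: "nat set" and w :: "nat \<Rightarrow> nat \<Rightarrow> real"
  assumes zero_in: "0 \<in> N"
    and one_in: "1 \<in> N"
    and w_zero: "j \<ge> 1 \<Longrightarrow> w 0 j = 1"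
    and w_ge: "j \<ge> 1 \<Longrightarrow> \<nu> \<in> N \<Longrightarrow> 1 \<le> w \<nu> j"
    and vecs_zero: "j \<ge> 1 \<Longrightarrow> f \<in> vecs (X j) \<Longrightarrow> \<nu> \<notin> N \<Longrightarrow> ip f (e \<nu>) = 0"
    and vecs_summable: "j \<ge> 1 \<Longrightarrow> f \<in> vecs (X j) \<Longrightarrow> sq_summable (\<lambda>\<nu>. w \<nu> j) N (\<lambda>\<nu>. ip f (e \<nu>))"
    and e_vecs: "j \<ge> 1 \<Longrightarrow> \<nu> \<in> N \<Longrightarrow> e \<nu> \<in> vecs (X j)"
    and inn_eq: "j \<ge> 1 \<Longrightarrow> f \<in> vecs (X j) \<Longrightarrow> g \<in> vecs (X j) \<Longrightarrow>
      inn (X j) f g = sq_ip (\<lambda>\<nu>. w \<nu> j) N (\<lambda>\<nu>. ip f (e \<nu>)) (\<lambda>\<nu>. ip g (e \<nu>))"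
begin

lemma w_nonneg: "j \<ge> 1 \<Longrightarrow> \<nu> \<in> N \<Longrightarrow> 0 \<le> w \<nu> j"
  using w_ge[of j \<nu>] by linarith

lemma wt_ge: "\<mu> \<in> idx N \<Longrightarrow> 1 \<le> wt w \<mu>"
  unfolding wt_def
proof (rule prod_ge_1)
  fix j assume "\<mu> \<in> idx N" "j \<in> supp \<mu>"
  then show "1 \<le> w (\<mu> j) j"
    using idx_supp[of \<mu> N] by (intro w_ge) (auto simp: idx_def)
qed

sublocale weights "wt w" "idx N"
  by unfold_locales (use wt_ge in fastforce)

lemma ev_fam: "\<mu> \<in> idx N \<Longrightarrow> ev \<mu> \<in> fam X (e 0)"
proof -
  assume \<mu>: "\<mu> \<in> idx N"
  have "finite {j \<in> {1..}. ev \<mu> j \<noteq> e 0}"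
    by (rule finite_subset[of _ "supp \<mu>"]) (use idx_supp[OF \<mu>] in \<open>auto simp: ev_def supp_def intro: ccontr\<close>)
  then show ?thesis
    using \<mu> e_vecs by (auto simp: fam_def ev_def idx_def)
qed

lemma fam_vecs: "f \<in> fam X (e 0) \<Longrightarrow> j \<ge> 1 \<Longrightarrow> f j \<in> vecs (X j)"
  by (auto simp: fam_def)

text \<open>Some factor pairs a vector of \<open>X j\<close> with a basis vector orthogonal to it.
  Hence enlarging \<open>idx N\<close> to the ambient index set \<open>idx UNIV\<close> only adds
  zero coefficients.\<close>

lemma coord_zero:
  assumes "f \<in> fam X (e 0)" "finite (supp \<mu>)" "\<mu> 0 = 0" "\<mu> \<notin> idx N"
  shows "coord f \<mu> = 0"
proof -
  obtain j where "\<mu> j \<notin> N"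
    using assms by (auto simp: idx_def)
  moreover from this have "j \<ge> 1" "\<mu> j \<noteq> 0"
    using zero_in assms(3) by (auto simp: Suc_le_eq intro!: gr0I)
  moreover have "finite {j \<in> {1..}. f j \<noteq> e 0 \<or> \<mu> j \<noteq> 0}"
    using assms(1,2) finite_subset[of "{j \<in> {1..}. f j \<noteq> e 0 \<or> \<mu> j \<noteq> 0}" "{j \<in> {1..}. f j \<noteq> e 0} \<union> supp \<mu>"]
    by (auto simp: fam_def supp_def)
  ultimately show ?thesis
    unfolding coord_def using vecs_zero[of j "f j" "\<mu> j"] fam_vecs[OF assms(1), of j]
    by (intro prod_zero) auto
qed

text \<open>The factor at \<open>j\<close> pairs two different basis vectors. So only multi-indices
  supported where \<open>f\<close> differs from \<open>e 0\<close> contribute, and finitely many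
  factors remain.\<close>

lemma coord_outside:
  assumes "j \<ge> 1" "f j = e 0" "\<mu> j \<noteq> 0" "f \<in> fam X (e 0)" "\<mu> \<in> idx N"
  shows "coord f \<mu> = 0"
proof -
  have "finite {j \<in> {1..}. f j \<noteq> e 0 \<or> \<mu> j \<noteq> 0}"
    using assms(4) idx_supp[OF assms(5)]
      finite_subset[of "{j \<in> {1..}. f j \<noteq> e 0 \<or> \<mu> j \<noteq> 0}" "{j \<in> {1..}. f j \<noteq> e 0} \<union> supp \<mu>"]
    by (auto simp: fam_def supp_def)
  then show ?thesis
    unfolding coord_def using assms ip_basis[of 0 "\<mu> j"]
    by (intro prod_zero) (auto intro!: bexI[of _ j])
qed

lemma prod_extend:
  assumes J: "finite J" "J \<subseteq> {1..}" and f: "{j\<in>{1..}. f j \<noteq> e 0} \<subseteq> J"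
  shows "wt w (extend J h) = (\<Prod>j\<in>J. w (h j) j)"
    and "coord f (extend J h) = (\<Prod>j\<in>J. ip (f j) (e (h j)))"
proof -
  have "wt w (extend J h) = (\<Prod>j\<in>J. w (extend J h j) j)"
    using J w_zero by (intro wt_superset) (auto simp: supp_def extend_def split: if_splits)
  then show "wt w (extend J h) = (\<Prod>j\<in>J. w (h j) j)"
    by (simp add: extend_def cong: prod.cong)
  have "coord f (extend J h) = (\<Prod>j\<in>J. ip (f j) (e (extend J h j)))"
    using J f by (intro coord_superset) (auto simp: extend_def split: if_splits)
  then show "coord f (extend J h) = (\<Prod>j\<in>J. ip (f j) (e (h j)))"
    by (simp add: extend_def cong: prod.cong)
qed

lemma coord_summable:
  assumes f: "f \<in> fam X (e 0)"
  shows "sq_summable (wt w) (idx N) (coord f)"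
proof -
  define J where "J = {j\<in>{1..}. f j \<noteq> e 0}"
  have J: "finite J" "J \<subseteq> {1..}" "{j\<in>{1..}. f j \<noteq> e 0} \<subseteq> J"
    using f by (auto simp: J_def fam_def)
  have "(\<lambda>h. \<Prod>j\<in>J. w (h j) j * (norm (ip (f j) (e (h j))))\<^sup>2) summable_on (PiE J (\<lambda>_. N))"
  proof (rule summable_on_prod_PiE[OF J(1)])
    fix j assume "j \<in> J"
    then have "j \<ge> 1" using J(2) by auto
    then show "(\<lambda>x. w x j * (norm (ip (f j) (e x)))\<^sup>2) summable_on N"
      using vecs_summable[OF _ fam_vecs[OF f]] by (simp add: sq_summable_def)
    show "0 \<le> w x j * (norm (ip (f j) (e x)))\<^sup>2" if "x \<in> N" for x
      using w_ge[OF \<open>j \<ge> 1\<close> that] by simp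
  qed
  also have "(\<lambda>h. \<Prod>j\<in>J. w (h j) j * (norm (ip (f j) (e (h j))))\<^sup>2) =
      (\<lambda>h. wt w (extend J h) * (norm (coord f (extend J h)))\<^sup>2)"
    by (simp add: fun_eq_iff prod_extend[OF J] prod.distrib prod_power_distrib
        flip: prod_norm)
  finally have "(\<lambda>\<mu>. wt w \<mu> * (norm (coord f \<mu>))\<^sup>2) summable_on {\<mu>\<in>idx N. supp \<mu> \<subseteq> J}"
    by (simp only: summable_on_reindex_bij_betw[OF extend_bij[OF J(1,2) zero_in],
        of "\<lambda>\<mu>. wt w \<mu> * (norm (coord f \<mu>))\<^sup>2"])
  also have "?this \<longleftrightarrow> sq_summable (wt w) (idx N) (coord f)"
    unfolding sq_summable_def
  proof (rule summable_on_cong_neutral)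
    fix \<mu> assume "\<mu> \<in> idx N - {\<mu>\<in>idx N. supp \<mu> \<subseteq> J}"
    then obtain j where "\<mu> \<in> idx N" "j \<in> supp \<mu>" "j \<notin> J"
      by blast
    then show "wt w \<mu> * (norm (coord f \<mu>))\<^sup>2 = 0"
      using coord_outside[of j f \<mu>] idx_supp[of \<mu> N] f by (auto simp: J_def supp_def)
  qed auto
  finally show ?thesis .
qed

text \<open>Each factor's inner product is expanded in its basis and the product is multiplied out.
  Absolute summability in every factor, from Cauchy-Schwarz, permits exchanging the finite product
  with the infinite sums.\<close>

lemma elem_ip_eq:
  assumes f: "f \<in> fam X (e 0)" and g: "g \<in> fam X (e 0)"
  shows "elem_ip X (e 0) f g = sq_ip (wt w) (idx N) (coord f) (coord g)"
proof -
  define J where "J = {j\<in>{1..}. f j \<noteq> e 0 \<or> g j \<noteq> e 0}"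
  have "J = {j\<in>{1..}. f j \<noteq> e 0} \<union> {j\<in>{1..}. g j \<noteq> e 0}"
    by (auto simp: J_def)
  then have J: "finite J" "J \<subseteq> {1..}" and Jf: "{j\<in>{1..}. f j \<noteq> e 0} \<subseteq> J" and Jg: "{j\<in>{1..}. g j \<noteq> e 0} \<subseteq> J"
    using f g by (auto simp: fam_def)
  let ?t = "\<lambda>\<mu>. of_real (wt w \<mu>) * coord f \<mu> * kcnj (coord g \<mu>)"
  let ?F = "\<lambda>j \<nu>. of_real (w \<nu> j) * ip (f j) (e \<nu>) * kcnj (ip (g j) (e \<nu>))"
  have "sq_ip (wt w) (idx N) (coord f) (coord g) = infsum ?t {\<mu>\<in>idx N. supp \<mu> \<subseteq> J}"
    unfolding sq_ip_def
  proof (rule infsum_cong_neutral)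
    fix \<mu> assume "\<mu> \<in> idx N - {\<mu>\<in>idx N. supp \<mu> \<subseteq> J}"
    then obtain j where "\<mu> \<in> idx N" "j \<in> supp \<mu>" "j \<notin> J"
      by blast
    then show "?t \<mu> = 0"
      using coord_outside[of j f \<mu>] idx_supp[of \<mu> N] f by (auto simp: J_def supp_def)
  qed auto
  also have "\<dots> = infsum (\<lambda>h. ?t (extend J h)) (PiE J (\<lambda>_. N))"
    by (rule infsum_reindex_bij_betw[OF extend_bij[OF J zero_in], symmetric])
  also have "(\<lambda>h. ?t (extend J h)) = (\<lambda>h. \<Prod>j\<in>J. ?F j (h j))"
    by (simp add: fun_eq_iff prod_extend(1)[OF J Jf] prod_extend(2)[OF J Jf] prod_extend(2)[OF J Jg]
        kcnj_prod prod.distrib of_real_prod)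
  also have "infsum (\<lambda>h. \<Prod>j\<in>J. ?F j (h j)) (PiE J (\<lambda>_. N)) = (\<Prod>j\<in>J. infsum (?F j) N)"
  proof (rule infsum_prod_PiE_abs[OF J(1)])
    fix j assume "j \<in> J"
    then have "j \<ge> 1" using J by auto
    then interpret wj: weights "\<lambda>\<nu>. w \<nu> j" N
      by unfold_locales (rule w_nonneg)
    show "(\<lambda>\<nu>. norm (?F j \<nu>)) summable_on N"
      using \<open>j \<ge> 1\<close> f g by (intro wj.cauchy_schwarz vecs_summable fam_vecs)
  qed
  also have "\<dots> = elem_ip X (e 0) f g"
    unfolding elem_ip_def
  proof (rule prod.cong)
    fix j assume "j \<in> {j \<in> {1..}. f j \<noteq> e 0 \<or> g j \<noteq> e 0}"
    then show "infsum (?F j) N = inn (X j) (f j) (g j)"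
      using f g by (simp add: inn_eq fam_vecs sq_ip_def)
  qed (simp add: J_def)
  finally show ?thesis ..
qed

lemma comb_coord_summable:
  "Poly_Mapping.keys c \<subseteq> fam X (e 0) \<Longrightarrow> sq_summable (wt w) (idx N) (comb_coord c)"
  unfolding comb_coord_def by (intro sq_summable_sum coord_summable) auto

lemma comb_ip_eq:
  assumes "Poly_Mapping.keys c \<subseteq> fam X (e 0)" "Poly_Mapping.keys d \<subseteq> fam X (e 0)"
  shows "comb_ip X (e 0) c d = sq_ip (wt w) (idx N) (comb_coord c) (comb_coord d)"
proof -
  have "sq_ip (wt w) (idx N) (comb_coord c) (comb_coord d) =
    (\<Sum>f\<in>Poly_Mapping.keys c. \<Sum>g\<in>Poly_Mapping.keys d. Poly_Mapping.lookup c f *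
      kcnj (Poly_Mapping.lookup d g) * sq_ip (wt w) (idx N) (coord f) (coord g))"
    unfolding comb_coord_def using assms by (intro sq_ip_sum coord_summable) auto
  also have "\<dots> = comb_ip X (e 0) c d"
    unfolding comb_ip_def using assms by (intro sum.cong refl) (auto simp: elem_ip_eq subset_iff)
  finally show ?thesis ..
qed

lemma comb_norm_eq:
  assumes "Poly_Mapping.keys c \<subseteq> fam X (e 0)"
  shows "sqrt (norm (comb_ip X (e 0) c c)) = sq_norm (wt w) (idx N) (comb_coord c)"
  using assms by (simp add: comb_ip_eq sq_ip_self comb_coord_summable norm_power)

lemma comb_fun_eq:
  assumes "Poly_Mapping.keys c \<subseteq> fam X (e 0)" "g \<in> fam X (e 0)"
  shows "comb_fun X (e 0) c g = sq_ip (wt w) (idx N) (comb_coord c) (coord g)"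
proof -
  \<comment> \<open>Writing \<open>coord g\<close> as a combination with one term makes the
    expansion \<open>sq_ip_sum\<close> applicable.\<close>
  have "sq_ip (wt w) (idx N) (comb_coord c) (\<lambda>\<mu>. \<Sum>g\<in>{g}. 1 * coord g \<mu>) =
    (\<Sum>f\<in>Poly_Mapping.keys c. \<Sum>g\<in>{g}. Poly_Mapping.lookup c f *
      kcnj 1 * sq_ip (wt w) (idx N) (coord f) (coord g))"
    unfolding comb_coord_def using assms by (intro sq_ip_sum coord_summable) auto
  also have "\<dots> = comb_fun X (e 0) c g"
    unfolding comb_fun_def using assms by (auto simp: elem_ip_eq subset_iff intro!: sum.cong)
  finally show ?thesis by simp
qed

text \<open>Sums and norms do not see values outside \<open>idx N\<close>; fixing them to zero makes
  the coefficients of a tensor unique.\<close>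

definition ell2 :: "((nat \<Rightarrow> nat) \<Rightarrow> 'k) set" where
  "ell2 = {\<phi>. sq_summable (wt w) (idx N) \<phi> \<and> (\<forall>\<mu>. \<mu> \<notin> idx N \<longrightarrow> \<phi> \<mu> = 0)}"

text \<open>
  The tensor with coefficient \<open>\<phi> \<mu>\<close> at the elementary tensor of \<open>ev \<mu>\<close>, which has squared norm
  \<open>wt w \<mu>\<close>.
\<close>

definition realize :: "((nat \<Rightarrow> nat) \<Rightarrow> 'k) \<Rightarrow> (nat \<Rightarrow> 'a) \<Rightarrow> 'k" where
  "realize \<phi> g = (if g \<in> fam X (e 0) then sq_ip (wt w) (idx N) \<phi> (coord g) else 0)"

text \<open>Pairing with a basis tensor isolates one coefficient, scaled by the squared norm of that
  tensor; this is how \<open>realize\<close> is inverted.\<close>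

lemma sq_ip_coord_ev:
  assumes "\<mu> \<in> idx N"
  shows "sq_ip (wt w) (idx N) \<phi> (coord (ev \<mu>)) = of_real (wt w \<mu>) * \<phi> \<mu>"
proof -
  have "sq_ip (wt w) (idx N) \<phi> (coord (ev \<mu>)) = infsum (\<lambda>\<kappa>. of_real (wt w \<kappa>) * \<phi> \<kappa>) {\<mu>}"
    unfolding sq_ip_def using assms by (intro infsum_cong_neutral) (auto simp: coord_ev)
  then show ?thesis by simp
qed

lemma realize_ev: "\<mu> \<in> idx N \<Longrightarrow> realize \<phi> (ev \<mu>) = of_real (wt w \<mu>) * \<phi> \<mu>"
  by (simp add: realize_def ev_fam sq_ip_coord_ev)

lemma wt_pos: "\<mu> \<in> idx N \<Longrightarrow> 0 < wt w \<mu>"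
  using wt_ge[of \<mu>] by linarith

lemma realize_inject:
  assumes "\<phi> \<in> ell2" "\<psi> \<in> ell2" "realize \<phi> = realize \<psi>"
  shows "\<phi> = \<psi>"
proof
  fix \<mu> show "\<phi> \<mu> = \<psi> \<mu>"
    using assms realize_ev[of \<mu> \<phi>] realize_ev[of \<mu> \<psi>] wt_pos[of \<mu>]
    by (cases "\<mu> \<in> idx N") (auto simp: ell2_def)
qed

text \<open>The coordinate form of \<open>represents\<close>: norm convergence of the coefficients
  replaces the Cauchy condition together with pointwise convergence of the functionals.\<close>

definition approximates :: "(nat \<Rightarrow> (nat \<Rightarrow> 'a) \<Rightarrow>\<^sub>0 'k) \<Rightarrow> ((nat \<Rightarrow> nat) \<Rightarrow> 'k) \<Rightarrow> bool" where
  "approximates s \<phi> \<longleftrightarrow> (\<forall>n. Poly_Mapping.keys (s n) \<subseteq> fam X (e 0)) \<and>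
    (\<lambda>n. sq_norm (wt w) (idx N) (\<lambda>\<mu>. comb_coord (s n) \<mu> - \<phi> \<mu>)) \<longlonglongrightarrow> 0"

lemma approximates_representsI:
  assumes "\<phi> \<in> ell2" "approximates s \<phi>"
  shows "represents X (e 0) s (realize \<phi>)"
  unfolding represents_def
proof (intro conjI allI)
  have keys: "Poly_Mapping.keys (s n) \<subseteq> fam X (e 0)" for n
    using assms(2) by (simp add: approximates_def)
  then show "Poly_Mapping.keys (s n) \<subseteq> fam X (e 0)" for n .
  have \<phi>: "sq_summable (wt w) (idx N) \<phi>"
    using assms(1) by (simp add: ell2_def)
  have lim: "(\<lambda>n. sq_norm (wt w) (idx N) (\<lambda>\<mu>. comb_coord (s n) \<mu> - \<phi> \<mu>)) \<longlonglongrightarrow> 0"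
    using assms(2) by (simp add: approximates_def)
  note s = comb_coord_summable[OF keys]
  have keys_diff: "Poly_Mapping.keys (s m - s n) \<subseteq> fam X (e 0)" for m n
    using keys_diff_subset[of "s m" "s n"] keys by blast
  show "cauchy_wrt (\<lambda>c. sqrt (norm (comb_ip X (e 0) c c))) s"
    unfolding cauchy_wrt_def comb_norm_eq[OF keys_diff]
  proof (intro allI impI)
    fix \<epsilon> :: real assume "\<epsilon> > 0"
    then obtain n0 where
      "\<forall>n\<ge>n0. norm (sq_norm (wt w) (idx N) (\<lambda>\<mu>. comb_coord (s n) \<mu> - \<phi> \<mu>) - 0) < \<epsilon> / 2"
      using LIMSEQ_D[OF lim, of "\<epsilon> / 2"] by auto
    then have n0: "sq_norm (wt w) (idx N) (\<lambda>\<mu>. comb_coord (s n) \<mu> - \<phi> \<mu>) < \<epsilon> / 2" if "n \<ge> n0" for n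
      using that by simp
    have "sq_norm (wt w) (idx N) (comb_coord (s m - s n)) < \<epsilon>" if mn: "m \<ge> n0" "n \<ge> n0" for m n
    proof -
      have eq: "comb_coord (s m - s n) = (\<lambda>\<mu>. (comb_coord (s m) \<mu> - \<phi> \<mu>) - (comb_coord (s n) \<mu> - \<phi> \<mu>))"
        by (simp add: fun_eq_iff comb_coord_diff)
      have "sq_norm (wt w) (idx N) (comb_coord (s m - s n)) \<le>
          sq_norm (wt w) (idx N) (\<lambda>\<mu>. comb_coord (s m) \<mu> - \<phi> \<mu>)
          + sq_norm (wt w) (idx N) (\<lambda>\<mu>. comb_coord (s n) \<mu> - \<phi> \<mu>)"
        unfolding eq by (rule sq_summable_diff(2)[OF sq_summable_diff(1)[OF s \<phi>] sq_summable_diff(1)[OF s \<phi>]])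
      also have "\<dots> < \<epsilon>"
        using n0[OF mn(1)] n0[OF mn(2)] by linarith
      finally show ?thesis .
    qed
    then show "\<exists>N'. \<forall>m\<ge>N'. \<forall>n\<ge>N'. sq_norm (wt w) (idx N) (comb_coord (s m - s n)) < \<epsilon>"
      by blast
  qed
  show "(\<lambda>n. comb_fun X (e 0) (s n) g) \<longlonglongrightarrow> realize \<phi> g" for g
  proof (cases "g \<in> fam X (e 0)")
    case True
    have "(\<lambda>n. sq_ip (wt w) (idx N) (comb_coord (s n)) (coord g)) \<longlonglongrightarrow> sq_ip (wt w) (idx N) \<phi> (coord g)"
      by (rule tendsto_sq_ip[OF s \<phi> coord_summable[OF True] coord_summable[OF True] lim])
         (simp add: sq_norm_def)
    then show ?thesis
      using True keys by (simp add: comb_fun_eq realize_def)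
  qed (simp add: comb_fun_def realize_def)
qed

text \<open>Convergence of the functionals at basis tensors is pointwise convergence of the
  coefficients; completeness then turns the Cauchy condition into convergence in norm.\<close>

lemma representsD:
  assumes "represents X (e 0) s \<Phi>"
  obtains \<phi> where "\<phi> \<in> ell2" "approximates s \<phi>" "\<Phi> = realize \<phi>"
proof -
  have keys: "\<And>n. Poly_Mapping.keys (s n) \<subseteq> fam X (e 0)"
    and cauchy: "cauchy_wrt (\<lambda>c. sqrt (norm (comb_ip X (e 0) c c))) s"
    and lim: "\<And>g. (\<lambda>n. comb_fun X (e 0) (s n) g) \<longlonglongrightarrow> \<Phi> g"
    using assms by (auto simp: represents_def)
  have keys_diff: "Poly_Mapping.keys (s m - s n) \<subseteq> fam X (e 0)" for m n
    using keys_diff_subset[of "s m" "s n"] keys by blast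
  \<comment> \<open>By \<open>realize_ev\<close> these are the only possible coefficients of
    \<open>\<Phi>\<close>.\<close>
  define \<phi> where "\<phi> \<mu> = (if \<mu> \<in> idx N then \<Phi> (ev \<mu>) / of_real (wt w \<mu>) else 0)" for \<mu>
  have ptw: "(\<lambda>n. comb_coord (s n) \<mu>) \<longlonglongrightarrow> \<phi> \<mu>" if \<mu>: "\<mu> \<in> idx N" for \<mu>
  proof -
    have "(\<lambda>n. comb_fun X (e 0) (s n) (ev \<mu>) / of_real (wt w \<mu>)) \<longlonglongrightarrow> \<phi> \<mu>"
      using \<mu> wt_pos[OF \<mu>] unfolding \<phi>_def by (auto intro!: tendsto_divide lim)
    moreover have "comb_fun X (e 0) (s n) (ev \<mu>) / of_real (wt w \<mu>) = comb_coord (s n) \<mu>" for n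
      using keys \<mu> wt_pos[OF \<mu>] by (simp add: comb_fun_eq ev_fam sq_ip_coord_ev)
    ultimately show ?thesis by simp
  qed
  have c: "\<exists>n0. \<forall>m\<ge>n0. \<forall>n\<ge>n0.
      sq_norm (wt w) (idx N) (\<lambda>\<mu>. comb_coord (s m) \<mu> - comb_coord (s n) \<mu>) < \<epsilon>" if "\<epsilon> > 0" for \<epsilon>
    using cauchy that unfolding cauchy_wrt_def comb_norm_eq[OF keys_diff]
    by (simp add: comb_coord_diff[abs_def])
  note compl = sq_norm_complete[OF comb_coord_summable[OF keys] c ptw]
  have \<phi>: "\<phi> \<in> ell2"
  proof -
    have "\<phi> \<mu> = 0" if "\<mu> \<notin> idx N" for \<mu>
      using that by (simp add: \<phi>_def)
    then show ?thesis
      using compl(1) by (simp add: ell2_def)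
  qed
  moreover have ap: "approximates s \<phi>"
    using compl(2) keys by (auto simp: approximates_def)
  moreover have "\<Phi> = realize \<phi>"
  proof
    fix g
    have "(\<lambda>n. comb_fun X (e 0) (s n) g) \<longlonglongrightarrow> realize \<phi> g"
      using approximates_representsI[OF \<phi> ap] by (simp add: represents_def)
    then show "\<Phi> g = realize \<phi> g"
      using LIMSEQ_unique[OF lim] by blast
  qed
  ultimately show ?thesis
    using that by blast
qed

lemma approximates_exists:
  assumes "\<phi> \<in> ell2"
  shows "\<exists>s. approximates s \<phi>"
proof -
  have "sq_summable (wt w) (idx N) \<phi>"
    using assms by (simp add: ell2_def)
  then have "\<forall>n. \<exists>S. finite S \<and> S \<subseteq> idx N \<and>
      sq_norm (wt w) (idx N) (\<lambda>\<mu>. (if \<mu> \<in> S then \<phi> \<mu> else 0) - \<phi> \<mu>) < inverse (real (Suc n))"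
    by (intro allI sq_norm_truncate) auto
  then obtain S where S: "\<And>n. finite (S n)" "\<And>n. S n \<subseteq> idx N"
    "\<And>n. sq_norm (wt w) (idx N) (\<lambda>\<mu>. (if \<mu> \<in> S n then \<phi> \<mu> else 0) - \<phi> \<mu>) < inverse (real (Suc n))"
    by metis
  define s where "s n = (\<Sum>\<mu>\<in>S n. Poly_Mapping.single (ev \<mu>) (\<phi> \<mu>))" for n
  \<comment> \<open>Distinct multi-indices give distinct keys, so no two coefficients merge in
    \<open>s n\<close>.\<close>
  have inj: "inj_on ev (idx N)"
  proof (rule inj_onI)
    fix \<mu> \<kappa> assume "\<mu> \<in> idx N" "\<kappa> \<in> idx N" "ev \<mu> = ev \<kappa>"
    then show "\<mu> = \<kappa>"
      using coord_ev[of \<mu> N \<kappa>] coord_ev[of \<kappa> N \<kappa>] by (auto split: if_splits)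
  qed
  have lk: "Poly_Mapping.lookup (s n) f = (\<Sum>\<mu>\<in>S n. if ev \<mu> = f then \<phi> \<mu> else 0)" for n f
    by (simp add: s_def lookup_sum lookup_single when_def)
  have keys: "Poly_Mapping.keys (s n) \<subseteq> ev ` S n" for n
  proof
    fix f assume f: "f \<in> Poly_Mapping.keys (s n)"
    show "f \<in> ev ` S n"
    proof (rule ccontr)
      assume "f \<notin> ev ` S n"
      then have "(\<Sum>\<mu>\<in>S n. if ev \<mu> = f then \<phi> \<mu> else 0) = 0"
        by (intro sum.neutral) auto
      then show False
        using f by (simp add: in_keys_iff lk)
    qed
  qed
  have coord: "comb_coord (s n) \<kappa> = (if \<kappa> \<in> S n then \<phi> \<kappa> else 0)" if \<kappa>: "\<kappa> \<in> idx N" for n \<kappa>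
  proof -
    have inj': "inj_on ev (S n)"
      by (rule inj_on_subset[OF inj S(2)])
    have "comb_coord (s n) \<kappa> = (\<Sum>f\<in>ev ` S n. Poly_Mapping.lookup (s n) f * coord f \<kappa>)"
      using S(1) keys by (intro comb_coord_superset) auto
    also have "\<dots> = (\<Sum>\<mu>\<in>S n. Poly_Mapping.lookup (s n) (ev \<mu>) * coord (ev \<mu>) \<kappa>)"
      using sum.reindex[OF inj'] by simp
    also have "\<dots> = (\<Sum>\<mu>\<in>S n. if \<mu> = \<kappa> then \<phi> \<mu> else 0)"
    proof (rule sum.cong[OF refl])
      fix \<mu> assume \<mu>: "\<mu> \<in> S n"
      have "Poly_Mapping.lookup (s n) (ev \<mu>) = (\<Sum>\<mu>'\<in>S n. if \<mu>' = \<mu> then \<phi> \<mu>' else 0)"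
        unfolding lk using inj' \<mu> by (intro sum.cong) (auto dest: inj_onD)
      then have "Poly_Mapping.lookup (s n) (ev \<mu>) = \<phi> \<mu>"
        using S(1) \<mu> by simp
      then show "Poly_Mapping.lookup (s n) (ev \<mu>) * coord (ev \<mu>) \<kappa> = (if \<mu> = \<kappa> then \<phi> \<mu> else 0)"
        using coord_ev[OF subsetD[OF S(2) \<mu>] \<kappa>] by simp
    qed
    finally show ?thesis
      using S(1) by simp
  qed
  have eq: "sq_norm (wt w) (idx N) (\<lambda>\<mu>. comb_coord (s n) \<mu> - \<phi> \<mu>) =
      sq_norm (wt w) (idx N) (\<lambda>\<mu>. (if \<mu> \<in> S n then \<phi> \<mu> else 0) - \<phi> \<mu>)" for n
    unfolding sq_norm_def by (intro arg_cong[of _ _ sqrt] infsum_cong) (simp add: coord)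
  have "(\<lambda>n. sq_norm (wt w) (idx N) (\<lambda>\<mu>. comb_coord (s n) \<mu> - \<phi> \<mu>)) \<longlonglongrightarrow> 0"
    unfolding eq
  proof (rule tendsto_sandwich[OF _ _ tendsto_const LIMSEQ_inverse_real_of_nat])
    show "\<forall>\<^sub>F n in sequentially. sq_norm (wt w) (idx N)
        (\<lambda>\<mu>. (if \<mu> \<in> S n then \<phi> \<mu> else 0) - \<phi> \<mu>) \<le> inverse (real (Suc n))"
      using S(3) by (intro always_eventually allI less_imp_le)
  qed simp
  then have "approximates s \<phi>"
    unfolding approximates_def using keys S(2) ev_fam by blast
  then show ?thesis by blast
qed

lemma vecs_tensor: "vecs (tensor X (e 0)) = realize ` ell2"
proof (intro equalityI subsetI)
  fix \<Phi> assume "\<Phi> \<in> vecs (tensor X (e 0))"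
  then obtain s where "represents X (e 0) s \<Phi>"
    by (auto simp: tensor_def)
  then show "\<Phi> \<in> realize ` ell2"
    by (rule representsD) auto
next
  fix \<Phi> assume "\<Phi> \<in> realize ` ell2"
  then obtain \<phi> s where "\<phi> \<in> ell2" "\<Phi> = realize \<phi>" "approximates s \<phi>"
    using approximates_exists by blast
  then show "\<Phi> \<in> vecs (tensor X (e 0))"
    using approximates_representsI[of \<phi> s] by (auto simp: tensor_def)
qed

lemma inn_tensor:
  assumes "\<phi> \<in> ell2" "\<psi> \<in> ell2"
  shows "inn (tensor X (e 0)) (realize \<phi>) (realize \<psi>) = sq_ip (wt w) (idx N) \<phi> \<psi>"
proof -
  have lim: "(\<lambda>n. comb_ip X (e 0) (s n) (t n)) \<longlonglongrightarrow> sq_ip (wt w) (idx N) \<phi> \<psi>"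
    if "approximates s \<phi>" "approximates t \<psi>" for s t
  proof -
    have "(\<lambda>n. sq_ip (wt w) (idx N) (comb_coord (s n)) (comb_coord (t n))) \<longlonglongrightarrow> sq_ip (wt w) (idx N) \<phi> \<psi>"
      using that assms comb_coord_summable
      by (intro tendsto_sq_ip) (auto simp: approximates_def ell2_def)
    then show ?thesis
      using that by (simp add: approximates_def comb_ip_eq)
  qed
  \<comment> \<open>Injectivity of \<open>realize\<close> forces every representing sequence to
    converge to the same coefficients, so the value described by \<open>THE\<close> is independent
    of the sequences.\<close>
  have ap: "approximates s \<theta>" if "represents X (e 0) s (realize \<theta>)" "\<theta> \<in> ell2" for s \<theta>
    using that(1)
  proof (rule representsD)
    fix \<theta>' assume "\<theta>' \<in> ell2" "approximates s \<theta>'" "realize \<theta> = realize \<theta>'"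
    then show ?thesis
      using realize_inject[OF that(2)] by simp
  qed
  obtain s t where st: "approximates s \<phi>" "approximates t \<psi>"
    using approximates_exists assms by blast
  show ?thesis
    unfolding tensor_def ip_space.simps
  proof (rule the_equality)
    show "\<exists>s t. represents X (e 0) s (realize \<phi>) \<and> represents X (e 0) t (realize \<psi>) \<and>
        (\<lambda>n. comb_ip X (e 0) (s n) (t n)) \<longlonglongrightarrow> sq_ip (wt w) (idx N) \<phi> \<psi>"
      using st assms lim approximates_representsI by blast
    fix z
    assume "\<exists>s t. represents X (e 0) s (realize \<phi>) \<and> represents X (e 0) t (realize \<psi>) \<and>
        (\<lambda>n. comb_ip X (e 0) (s n) (t n)) \<longlonglongrightarrow> z"
    then obtain s t where "approximates s \<phi>" "approximates t \<psi>"
      "(\<lambda>n. comb_ip X (e 0) (s n) (t n)) \<longlonglongrightarrow> z"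
      using ap assms by blast
    then show "z = sq_ip (wt w) (idx N) \<phi> \<psi>"
      using lim LIMSEQ_unique by blast
  qed
qed

lemma norm_tensor:
  assumes "\<phi> \<in> ell2"
  shows "ip_norm (tensor X (e 0)) (realize \<phi>) = sq_norm (wt w) (idx N) \<phi>"
  using assms by (simp add: ip_norm_def inn_tensor sq_ip_self ell2_def norm_power)

end


subsection \<open>Approximation errors\<close>

text \<open>Gaussian elimination with fewer equations than unknowns, one equation per induction
  step.\<close>

lemma exists_nontrivial_kernel:
  fixes L :: "nat \<Rightarrow> 'i \<Rightarrow> 'k::field"
  assumes "finite S" "n < card S"
  shows "\<exists>c. (\<exists>\<mu>\<in>S. c \<mu> \<noteq> 0) \<and> (\<forall>i\<in>{1..n}. (\<Sum>\<mu>\<in>S. c \<mu> * L i \<mu>) = 0)"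
  using assms
proof (induction n arbitrary: S L)
  case 0
  then obtain \<mu> where "\<mu> \<in> S" by fastforce
  then show ?case
    by (intro exI[of _ "\<lambda>_. 1"]) auto
next
  case (Suc n)
  show ?case
  proof (cases "\<forall>\<mu>\<in>S. L (Suc n) \<mu> = 0")
    case True
    obtain c where c: "\<exists>\<mu>\<in>S. c \<mu> \<noteq> 0" "\<forall>i\<in>{1..n}. (\<Sum>\<mu>\<in>S. c \<mu> * L i \<mu>) = 0"
      using Suc.IH[of S L] Suc.prems by auto
    moreover have "(\<Sum>\<mu>\<in>S. c \<mu> * L (Suc n) \<mu>) = 0"
      using True by (intro sum.neutral) auto
    ultimately show ?thesis
      by (intro exI[of _ c]) (auto simp: le_Suc_eq)
  next
    case False
    then obtain p where p: "p \<in> S" "L (Suc n) p \<noteq> 0" by blast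
    define S' where "S' = S - {p}"
    have S': "finite S'" "n < card S'" "S = insert p S'" "p \<notin> S'"
      using Suc.prems p by (auto simp: S'_def)
    \<comment> \<open>The remaining equations after the unknown at the pivot \<open>p\<close> has
      been eliminated by equation \<open>Suc n\<close>; \<open>d\<close> below is the back
      substitution.\<close>
    define L' where "L' i \<mu> = L i \<mu> - L i p * L (Suc n) \<mu> / L (Suc n) p" for i \<mu>
    obtain c where c: "\<exists>\<mu>\<in>S'. c \<mu> \<noteq> 0" "\<forall>i\<in>{1..n}. (\<Sum>\<mu>\<in>S'. c \<mu> * L' i \<mu>) = 0"
      using Suc.IH[OF S'(1,2)] by blast
    define d where "d \<mu> = (if \<mu> = p then - (\<Sum>\<mu>\<in>S'. c \<mu> * L (Suc n) \<mu>) / L (Suc n) p else c \<mu>)" for \<mu>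
    have sum_d: "(\<Sum>\<mu>\<in>S. d \<mu> * L i \<mu>) = (\<Sum>\<mu>\<in>S'. c \<mu> * L' i \<mu>)" for i
    proof -
      have "(\<Sum>\<mu>\<in>S'. d \<mu> * L i \<mu>) = (\<Sum>\<mu>\<in>S'. c \<mu> * L i \<mu>)"
        using S'(4) by (intro sum.cong) (auto simp: d_def)
      then show ?thesis
        using S' by (simp add: d_def L'_def right_diff_distrib sum_subtractf sum_distrib_left
            sum_divide_distrib mult_ac)
    qed
    have "(\<Sum>\<mu>\<in>S. d \<mu> * L (Suc n) \<mu>) = 0"
      unfolding sum_d using p by (intro sum.neutral) (simp add: L'_def)
    moreover have "\<exists>\<mu>\<in>S. d \<mu> \<noteq> 0"
      using c(1) S' by (auto simp: d_def)
    ultimately show ?thesis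
      using c(2) by (intro exI[of _ d]) (auto simp: le_Suc_eq sum_d)
  qed
qed

lemma (in weights) sq_norm_sum_le:
  assumes "finite K" "\<And>k. k \<in> K \<Longrightarrow> sq_summable W A (\<phi> k)"
  shows "sq_norm W A (\<lambda>\<mu>. \<Sum>k\<in>K. a k * \<phi> k \<mu>) \<le> (\<Sum>k\<in>K. norm (a k) * sq_norm W A (\<phi> k))"
  using assms
proof (induction K rule: finite_induct)
  case empty
  then show ?case by (simp add: sq_norm_def)
next
  case (insert k K)
  have "sq_norm W A (\<lambda>\<mu>. a k * \<phi> k \<mu> + (\<Sum>k\<in>K. a k * \<phi> k \<mu>)) \<le>
      sq_norm W A (\<lambda>\<mu>. a k * \<phi> k \<mu>) + sq_norm W A (\<lambda>\<mu>. \<Sum>k\<in>K. a k * \<phi> k \<mu>)"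
    using insert by (intro sq_summable_add(2) sq_summable_cmult(1) sq_summable_sum) auto
  also have "\<dots> \<le> norm (a k) * sq_norm W A (\<phi> k) + (\<Sum>k\<in>K. norm (a k) * sq_norm W A (\<phi> k))"
    using insert by (intro add_mono) (auto simp: sq_summable_cmult(2))
  finally show ?case
    using insert by simp
qed

lemma (in weights) sq_norm_finite_support:
  assumes "finite S" "S \<subseteq> A" "\<And>\<mu>. \<mu> \<in> A - S \<Longrightarrow> \<phi> \<mu> = 0"
  shows "sq_norm W A \<phi> = sqrt (\<Sum>\<mu>\<in>S. W \<mu> * (norm (\<phi> \<mu>))\<^sup>2)"
proof -
  have "(\<Sum>\<^sub>\<infinity>\<mu>\<in>A. W \<mu> * (norm (\<phi> \<mu>))\<^sup>2) = (\<Sum>\<^sub>\<infinity>\<mu>\<in>S. W \<mu> * (norm (\<phi> \<mu>))\<^sup>2)"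
    using assms by (intro infsum_cong_neutral) auto
  then show ?thesis
    using assms(1) by (simp add: sq_norm_def)
qed

context weighted_factors
begin

lemma realize_diff_sum:
  assumes \<phi>: "\<phi> \<in> ell2" and "finite K" and \<zeta>: "\<And>k. k \<in> K \<Longrightarrow> \<zeta> k \<in> ell2"
  shows "(\<lambda>\<mu>. \<phi> \<mu> - (\<Sum>k\<in>K. a k * \<zeta> k \<mu>)) \<in> ell2"
    and "realize (\<lambda>\<mu>. \<phi> \<mu> - (\<Sum>k\<in>K. a k * \<zeta> k \<mu>)) =
      (\<lambda>g. realize \<phi> g - (\<Sum>k\<in>K. a k * realize (\<zeta> k) g))"
proof -
  have s: "sq_summable (wt w) (idx N) (\<lambda>\<mu>. \<Sum>k\<in>K. a k * \<zeta> k \<mu>)"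
    using \<zeta> by (intro sq_summable_sum[OF \<open>finite K\<close>]) (simp add: ell2_def)
  have s\<phi>: "sq_summable (wt w) (idx N) \<phi>"
    using \<phi> by (simp add: ell2_def)
  have "(\<Sum>k\<in>K. a k * \<zeta> k \<mu>) = 0" if "\<mu> \<notin> idx N" for \<mu>
    using that \<zeta> by (intro sum.neutral) (simp add: ell2_def)
  then show "(\<lambda>\<mu>. \<phi> \<mu> - (\<Sum>k\<in>K. a k * \<zeta> k \<mu>)) \<in> ell2"
    using \<phi> sq_summable_diff(1)[OF s\<phi> s] by (simp add: ell2_def)
  show "realize (\<lambda>\<mu>. \<phi> \<mu> - (\<Sum>k\<in>K. a k * \<zeta> k \<mu>)) =
      (\<lambda>g. realize \<phi> g - (\<Sum>k\<in>K. a k * realize (\<zeta> k) g))"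
  proof
    fix g show "realize (\<lambda>\<mu>. \<phi> \<mu> - (\<Sum>k\<in>K. a k * \<zeta> k \<mu>)) g = realize \<phi> g - (\<Sum>k\<in>K. a k * realize (\<zeta> k) g)"
    proof (cases "g \<in> fam X (e 0)")
      case True
      have sg: "sq_summable (wt w) (idx N) (coord g)"
        using True by (rule coord_summable)
      have "sq_ip (wt w) (idx N) (\<lambda>\<mu>. \<Sum>k\<in>K. a k * \<zeta> k \<mu>) (\<lambda>\<mu>. \<Sum>l\<in>{g}. 1 * coord l \<mu>) =
          (\<Sum>k\<in>K. \<Sum>l\<in>{g}. a k * kcnj 1 * sq_ip (wt w) (idx N) (\<zeta> k) (coord l))"
        using \<zeta> sg by (intro sq_ip_sum[OF \<open>finite K\<close>]) (auto simp: ell2_def)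
      then show ?thesis
        using True by (simp add: realize_def sq_ip_diff_left[OF s\<phi> s sg])
    qed (simp add: realize_def)
  qed
qed

lemma finite_support_ell2:
  assumes "finite S" "S \<subseteq> idx N" "\<And>\<mu>. \<mu> \<notin> S \<Longrightarrow> \<phi> \<mu> = 0"
  shows "\<phi> \<in> ell2"
  unfolding ell2_def using assms
  by (auto intro!: sq_summable_finite_support intro: finite_subset[OF _ assms(1)])

lemma norm_le_sq_norm:
  assumes "sq_summable (wt w) (idx N) \<phi>" "\<mu> \<in> idx N"
  shows "norm (\<phi> \<mu>) \<le> sq_norm (wt w) (idx N) \<phi>"
proof -
  have "1 * norm (\<phi> \<mu>) \<le> sqrt (wt w \<mu>) * norm (\<phi> \<mu>)"
    using wt_ge[OF assms(2)] by (intro mult_right_mono) auto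
  also have "\<dots> = L2_set (\<lambda>\<mu>. sqrt (wt w \<mu>) * norm (\<phi> \<mu>)) {\<mu>}"
    using wt_ge[OF assms(2)] by (simp add: L2_set_def)
  also have "\<dots> \<le> sq_norm (wt w) (idx N) \<phi>"
    using assms by (intro L2_set_le_sq_norm) auto
  finally show ?thesis by simp
qed

end

lemma idx_mono: "M \<subseteq> N \<Longrightarrow> idx M \<subseteq> idx N"
  by (auto simp: idx_def)

lemma (in hilbert_basis) weighted_factors_H0:
  "weighted_factors smul ip e (space_H0 ip) UNIV (\<lambda>_ _. 1)"
proof
  fix j :: nat and f g :: 'a
  show "inn (space_H0 ip j) f g = sq_ip (\<lambda>\<nu>. 1) UNIV (\<lambda>\<nu>. ip f (e \<nu>)) (\<lambda>\<nu>. ip g (e \<nu>))"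
    using infsumI[OF parseval[of f g]] by (simp add: space_H0_def sq_ip_def flip: ip_commute)
qed (auto simp: space_H0_def sq_summable_def bessel)

section \<open>The embedding and the approximation error in coordinates\<close>

context weighted_factors
begin

interpretation Z: weighted_factors smul ip e "space_H0 ip" UNIV "\<lambda>_ _. 1"
  by (rule weighted_factors_H0)

lemma wt_one: "wt (\<lambda>_ _. 1) = (\<lambda>_. 1)"
  by (simp add: wt_def fun_eq_iff)

text \<open>With \<open>t = 1\<close> this is the boundedness of the embedding, with general
  \<open>t\<close> the error bound for a truncation.\<close>

lemma ambient_norm_le:
  assumes \<phi>: "sq_summable (wt w) (idx N) \<phi>" and t: "0 \<le> t"
    and zero: "\<And>\<mu>. \<mu> \<in> idx UNIV - idx N \<Longrightarrow> \<theta> \<mu> = 0"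
    and le: "\<And>\<mu>. \<mu> \<in> idx N \<Longrightarrow> (norm (\<theta> \<mu>))\<^sup>2 \<le> t\<^sup>2 * (wt w \<mu> * (norm (\<phi> \<mu>))\<^sup>2)"
  shows "sq_summable (wt (\<lambda>_ _. 1)) (idx UNIV) \<theta>"
    and "sq_norm (wt (\<lambda>_ _. 1)) (idx UNIV) \<theta> \<le> t * sq_norm (wt w) (idx N) \<phi>"
proof -
  have r: "(\<lambda>\<mu>. t\<^sup>2 * (wt w \<mu> * (norm (\<phi> \<mu>))\<^sup>2)) summable_on idx N"
    using \<phi> unfolding sq_summable_def by (rule summable_on_cmult_right)
  have l: "(\<lambda>\<mu>. (norm (\<theta> \<mu>))\<^sup>2) summable_on idx N"
    by (rule summable_on_comparison_test[OF r]) (use le in auto)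
  have "(\<lambda>\<mu>. (norm (\<theta> \<mu>))\<^sup>2) summable_on idx N \<longleftrightarrow> (\<lambda>\<mu>. (norm (\<theta> \<mu>))\<^sup>2) summable_on idx UNIV"
    by (rule summable_on_cong_neutral) (use zero idx_mono[of N UNIV] in auto)
  then show "sq_summable (wt (\<lambda>_ _. 1)) (idx UNIV) \<theta>"
    using l by (simp add: sq_summable_def wt_one)
  have "(\<Sum>\<^sub>\<infinity>\<mu>\<in>idx UNIV. (norm (\<theta> \<mu>))\<^sup>2) = (\<Sum>\<^sub>\<infinity>\<mu>\<in>idx N. (norm (\<theta> \<mu>))\<^sup>2)"
    by (rule infsum_cong_neutral) (use zero idx_mono[of N UNIV] in auto)
  also have "\<dots> \<le> (\<Sum>\<^sub>\<infinity>\<mu>\<in>idx N. t\<^sup>2 * (wt w \<mu> * (norm (\<phi> \<mu>))\<^sup>2))"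
    using l r le by (rule infsum_mono)
  also have "\<dots> = t\<^sup>2 * (\<Sum>\<^sub>\<infinity>\<mu>\<in>idx N. wt w \<mu> * (norm (\<phi> \<mu>))\<^sup>2)"
    by (rule infsum_cmult_right')
  finally have "sqrt (\<Sum>\<^sub>\<infinity>\<mu>\<in>idx UNIV. (norm (\<theta> \<mu>))\<^sup>2) \<le>
      sqrt (t\<^sup>2 * (\<Sum>\<^sub>\<infinity>\<mu>\<in>idx N. wt w \<mu> * (norm (\<phi> \<mu>))\<^sup>2))"
    by (rule real_sqrt_le_mono)
  also have "\<dots> = t * sqrt (\<Sum>\<^sub>\<infinity>\<mu>\<in>idx N. wt w \<mu> * (norm (\<phi> \<mu>))\<^sup>2)"
    using t by (simp add: real_sqrt_mult)
  finally show "sq_norm (wt (\<lambda>_ _. 1)) (idx UNIV) \<theta> \<le> t * sq_norm (wt w) (idx N) \<phi>"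
    by (simp add: sq_norm_def wt_one)
qed

lemma ell2_ambient:
  assumes "\<phi> \<in> ell2"
  shows "\<phi> \<in> Z.ell2"
    and "sq_norm (wt (\<lambda>_ _. 1)) (idx UNIV) \<phi> \<le> sq_norm (wt w) (idx N) \<phi>"
proof -
  have \<phi>: "sq_summable (wt w) (idx N) \<phi>" "\<And>\<mu>. \<mu> \<notin> idx N \<Longrightarrow> \<phi> \<mu> = 0"
    using assms by (auto simp: ell2_def)
  have le: "(norm (\<phi> \<mu>))\<^sup>2 \<le> 1\<^sup>2 * (wt w \<mu> * (norm (\<phi> \<mu>))\<^sup>2)" if "\<mu> \<in> idx N" for \<mu>
    using mult_right_mono[OF wt_ge[OF that], of "(norm (\<phi> \<mu>))\<^sup>2"] by simp
  note * = ambient_norm_le[OF \<phi>(1) zero_le_one _ le]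
  show "\<phi> \<in> Z.ell2"
    using *(1) \<phi>(2) idx_mono[of N UNIV] by (auto simp: Z.ell2_def)
  show "sq_norm (wt (\<lambda>_ _. 1)) (idx UNIV) \<phi> \<le> sq_norm (wt w) (idx N) \<phi>"
    using *(2) \<phi>(2) by simp
qed

lemma embed_realize:
  assumes \<phi>: "\<phi> \<in> ell2"
  shows "embed X (space_H0 ip) (e 0) (realize \<phi>) = Z.realize \<phi>"
proof -
  have s\<phi>: "sq_summable (wt w) (idx N) \<phi>"
    using \<phi> by (simp add: ell2_def)
  have fam: "fam X (e 0) \<subseteq> fam (space_H0 ip) (e 0)"
    by (auto simp: fam_def space_H0_def PiE_def)
  \<comment> \<open>\<open>comb_coord\<close> does not depend on the factor spaces, so the same
    combinations converge to the same coefficients in the weaker ambient norm.\<close>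
  have Z: "represents (space_H0 ip) (e 0) s (Z.realize \<phi>)" if s: "approximates s \<phi>" for s
  proof (rule Z.approximates_representsI)
    show "\<phi> \<in> Z.ell2"
      using \<phi> by (rule ell2_ambient)
    have keys: "Poly_Mapping.keys (s n) \<subseteq> fam X (e 0)" for n
      using s by (simp add: approximates_def)
    have "sq_norm (wt (\<lambda>_ _. 1)) (idx UNIV) (\<lambda>\<mu>. comb_coord (s n) \<mu> - \<phi> \<mu>) \<le>
        1 * sq_norm (wt w) (idx N) (\<lambda>\<mu>. comb_coord (s n) \<mu> - \<phi> \<mu>)" for n
    proof (rule ambient_norm_le(2))
      show "sq_summable (wt w) (idx N) (\<lambda>\<mu>. comb_coord (s n) \<mu> - \<phi> \<mu>)"
        by (intro sq_summable_diff(1) comb_coord_summable keys s\<phi>)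
      show "comb_coord (s n) \<mu> - \<phi> \<mu> = 0" if "\<mu> \<in> idx UNIV - idx N" for \<mu>
      proof -
        have "comb_coord (s n) \<mu> = 0"
          unfolding comb_coord_def using that keys[of n]
          by (intro sum.neutral) (auto simp: idx_def intro!: coord_zero)
        then show ?thesis
          using that \<phi> by (simp add: ell2_def)
      qed
      show "(norm (comb_coord (s n) \<mu> - \<phi> \<mu>))\<^sup>2 \<le> 1\<^sup>2 * (wt w \<mu> * (norm (comb_coord (s n) \<mu> - \<phi> \<mu>))\<^sup>2)"
        if "\<mu> \<in> idx N" for \<mu>
        using mult_right_mono[OF wt_ge[OF that], of "(norm (comb_coord (s n) \<mu> - \<phi> \<mu>))\<^sup>2"] by simp
    qed simp
    moreover have lim: "(\<lambda>n. sq_norm (wt w) (idx N) (\<lambda>\<mu>. comb_coord (s n) \<mu> - \<phi> \<mu>)) \<longlonglongrightarrow> 0"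
      using s by (simp add: approximates_def)
    ultimately have "(\<lambda>n. sq_norm (wt (\<lambda>_ _. 1)) (idx UNIV) (\<lambda>\<mu>. comb_coord (s n) \<mu> - \<phi> \<mu>)) \<longlonglongrightarrow> 0"
      by (intro Lim_null_comparison[OF always_eventually[OF allI] lim]) simp
    then show "Z.approximates s \<phi>"
      using keys fam by (auto simp: Z.approximates_def)
  qed
  show ?thesis
    unfolding embed_def
  proof (rule the_equality)
    obtain s where "approximates s \<phi>"
      using approximates_exists[OF \<phi>] by blast
    then show "\<exists>s. represents X (e 0) s (realize \<phi>) \<and> represents (space_H0 ip) (e 0) s (Z.realize \<phi>)"
      using Z approximates_representsI[OF \<phi>] by blast
    fix \<Psi> assume "\<exists>s. represents X (e 0) s (realize \<phi>) \<and> represents (space_H0 ip) (e 0) s \<Psi>"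
    then obtain s where s: "represents X (e 0) s (realize \<phi>)" "represents (space_H0 ip) (e 0) s \<Psi>"
      by blast
    have "approximates s \<phi>"
      using s(1)
    proof (rule representsD)
      fix \<psi> assume "\<psi> \<in> ell2" "approximates s \<psi>" "realize \<phi> = realize \<psi>"
      then show ?thesis
        using realize_inject[OF \<phi>] by simp
    qed
    then have lim: "(\<lambda>n. comb_fun (space_H0 ip) (e 0) (s n) g) \<longlonglongrightarrow> Z.realize \<phi> g" for g
      using Z by (simp add: represents_def)
    show "\<Psi> = Z.realize \<phi>"
    proof
      fix g
      have "(\<lambda>n. comb_fun (space_H0 ip) (e 0) (s n) g) \<longlonglongrightarrow> \<Psi> g"
        using s(2) by (simp add: represents_def)
      then show "\<Psi> g = Z.realize \<phi> g"
        using lim LIMSEQ_unique by blast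
    qed
  qed
qed

abbreviation App_err :: "nat \<Rightarrow> real" where
  "App_err n \<equiv> err n (tensor X (e 0)) (tensor (space_H0 ip) (e 0)) (embed X (space_H0 ip) (e 0))"

text \<open>The coefficients of \<open>App f - A f\<close> for \<open>f = realize \<phi>\<close>.
  The functionals stay on the side of the tensors, since \<open>dual_space\<close> consists of
  functions of tensors.\<close>

definition residual :: "nat \<Rightarrow> (nat \<Rightarrow> ((nat \<Rightarrow> 'a) \<Rightarrow> 'k) \<Rightarrow> 'k) \<Rightarrow> (nat \<Rightarrow> (nat \<Rightarrow> nat) \<Rightarrow> 'k) \<Rightarrow>
    ((nat \<Rightarrow> nat) \<Rightarrow> 'k) \<Rightarrow> (nat \<Rightarrow> nat) \<Rightarrow> 'k" where
  "residual n l \<zeta> \<phi> \<mu> = \<phi> \<mu> - (\<Sum>i\<in>{1..n}. l i (realize \<phi>) * \<zeta> i \<mu>)"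

lemma App_residual:
  assumes "\<phi> \<in> ell2" "\<And>i. i \<in> {1..n} \<Longrightarrow> \<zeta> i \<in> Z.ell2"
  shows "ip_norm (tensor (space_H0 ip) (e 0))
      (\<lambda>g. embed X (space_H0 ip) (e 0) (realize \<phi>) g - (\<Sum>i\<in>{1..n}. l i (realize \<phi>) * Z.realize (\<zeta> i) g)) =
    sq_norm (wt (\<lambda>_ _. 1)) (idx UNIV) (residual n l \<zeta> \<phi>)"
proof -
  note ell2 = ell2_ambient(1)[OF assms(1)]
  have "residual n l \<zeta> \<phi> \<in> Z.ell2"
    unfolding residual_def[abs_def] by (rule Z.realize_diff_sum(1)[OF ell2 _ assms(2)]) auto
  moreover have "(\<lambda>g. embed X (space_H0 ip) (e 0) (realize \<phi>) g - (\<Sum>i\<in>{1..n}. l i (realize \<phi>) * Z.realize (\<zeta> i) g))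
      = Z.realize (residual n l \<zeta> \<phi>)"
    unfolding residual_def[abs_def] embed_realize[OF assms(1)]
    by (rule Z.realize_diff_sum(2)[OF ell2 _ assms(2), symmetric]) auto
  ultimately show ?thesis
    by (simp only: Z.norm_tensor)
qed

lemma unit_ball:
  "{f \<in> vecs (tensor X (e 0)). ip_norm (tensor X (e 0)) f \<le> 1} =
    realize ` {\<phi> \<in> ell2. sq_norm (wt w) (idx N) \<phi> \<le> 1}"
  unfolding vecs_tensor by (auto simp: norm_tensor)

lemma zero_ell2: "(\<lambda>_. 0) \<in> ell2"
  by (rule finite_support_ell2[of "{}"]) auto

lemma App_err_eq:
  "App_err n = (INF (l, \<zeta>)\<in>{(l, \<zeta>). \<forall>i\<in>{1..n}. l i \<in> dual_space (tensor X (e 0)) \<and> \<zeta> i \<in> Z.ell2}.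
    SUP \<phi>\<in>{\<phi> \<in> ell2. sq_norm (wt w) (idx N) \<phi> \<le> 1}. sq_norm (wt (\<lambda>_ _. 1)) (idx UNIV) (residual n l \<zeta> \<phi>))"
  (is "_ = (INF (l, \<zeta>)\<in>?P. ?sup l \<zeta>)")
proof -
  let ?A = "\<lambda>(l, \<zeta>) f g. \<Sum>i\<in>{1..n}. l i f * Z.realize (\<zeta> i) g"
  have "alg_all n (tensor X (e 0)) (tensor (space_H0 ip) (e 0)) = ?A ` ?P"
  proof (intro equalityI subsetI)
    fix A assume "A \<in> alg_all n (tensor X (e 0)) (tensor (space_H0 ip) (e 0))"
    then obtain l z where lz: "A = (\<lambda>f x. \<Sum>i\<in>{1..n}. l i f * z i x)"
      "\<forall>i\<in>{1..n}. l i \<in> dual_space (tensor X (e 0)) \<and> z i \<in> Z.realize ` Z.ell2"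
      unfolding alg_all_def Z.vecs_tensor by blast
    then have "\<forall>i\<in>{1..n}. \<exists>\<zeta>. \<zeta> \<in> Z.ell2 \<and> z i = Z.realize \<zeta>"
      by blast
    then obtain \<zeta> where \<zeta>: "\<forall>i\<in>{1..n}. \<zeta> i \<in> Z.ell2 \<and> z i = Z.realize (\<zeta> i)"
      by metis
    have "A = ?A (l, \<zeta>)"
      unfolding lz(1) prod.case using \<zeta> by (intro ext sum.cong) auto
    then show "A \<in> ?A ` ?P"
      using lz(2) \<zeta> by blast
  next
    fix A assume "A \<in> ?A ` ?P"
    then show "A \<in> alg_all n (tensor X (e 0)) (tensor (space_H0 ip) (e 0))"
      unfolding alg_all_def Z.vecs_tensor by fastforce
  qed
  then have "App_err n = (INF p\<in>?P. SUP f\<in>realize ` {\<phi> \<in> ell2. sq_norm (wt w) (idx N) \<phi> \<le> 1}.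
      ip_norm (tensor (space_H0 ip) (e 0)) (\<lambda>g. embed X (space_H0 ip) (e 0) f g - ?A p f g))"
    unfolding err_def unit_ball by (simp add: image_image)
  also have "\<dots> = (INF (l, \<zeta>)\<in>?P. ?sup l \<zeta>)"
    unfolding image_image by (intro INF_cong refl) (auto intro!: SUP_cong App_residual simp del: One_nat_def)
  finally show ?thesis .
qed

text \<open>A real-valued \<open>SUP\<close> is informative only when bounded above. The bound
  combines boundedness of the functionals with that of the embedding.\<close>

lemma residual_bounded:
  assumes "\<forall>i\<in>{1..n}. l i \<in> dual_space (tensor X (e 0)) \<and> \<zeta> i \<in> Z.ell2"
  shows "bdd_above ((\<lambda>\<phi>. sq_norm (wt (\<lambda>_ _. 1)) (idx UNIV) (residual n l \<zeta> \<phi>)) `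
    {\<phi> \<in> ell2. sq_norm (wt w) (idx N) \<phi> \<le> 1})"
proof -
  have "\<forall>i\<in>{1..n}. \<exists>B. \<forall>f\<in>vecs (tensor X (e 0)). norm (l i f) \<le> B * ip_norm (tensor X (e 0)) f"
    using assms by (auto simp: dual_space_def)
  then obtain B where B: "\<And>i f. i \<in> {1..n} \<Longrightarrow> f \<in> vecs (tensor X (e 0)) \<Longrightarrow>
      norm (l i f) \<le> B i * ip_norm (tensor X (e 0)) f"
    by metis
  show ?thesis
  proof (rule bdd_aboveI2)
    fix \<phi> assume "\<phi> \<in> {\<phi> \<in> ell2. sq_norm (wt w) (idx N) \<phi> \<le> 1}"
    then have \<phi>: "\<phi> \<in> ell2" "sq_norm (wt w) (idx N) \<phi> \<le> 1" by auto
    let ?Z = "sq_norm (wt (\<lambda>_ _. 1)) (idx UNIV)"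
    have \<zeta>: "sq_summable (wt (\<lambda>_ _. 1)) (idx UNIV) (\<zeta> i)" if "i \<in> {1..n}" for i
      using assms that by (simp add: Z.ell2_def)
    have l: "norm (l i (realize \<phi>)) \<le> \<bar>B i\<bar>" if "i \<in> {1..n}" for i
    proof -
      have "norm (l i (realize \<phi>)) \<le> B i * sq_norm (wt w) (idx N) \<phi>"
        using B[OF that, of "realize \<phi>"] \<phi> by (simp add: vecs_tensor norm_tensor)
      also have "\<dots> \<le> \<bar>B i\<bar> * 1"
        using \<phi>(2) by (intro mult_mono) auto
      finally show ?thesis by simp
    qed
    have "?Z (residual n l \<zeta> \<phi>) \<le> ?Z \<phi> + ?Z (\<lambda>\<mu>. \<Sum>i\<in>{1..n}. l i (realize \<phi>) * \<zeta> i \<mu>)"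
      unfolding residual_def[abs_def] using ell2_ambient(1)[OF \<phi>(1)] \<zeta>
      by (intro Z.sq_summable_diff(2) Z.sq_summable_sum) (auto simp: Z.ell2_def)
    also have "\<dots> \<le> 1 + (\<Sum>i\<in>{1..n}. \<bar>B i\<bar> * ?Z (\<zeta> i))"
    proof (rule add_mono)
      show "?Z \<phi> \<le> 1"
        using ell2_ambient(2)[OF \<phi>(1)] \<phi>(2) by linarith
      have "?Z (\<lambda>\<mu>. \<Sum>i\<in>{1..n}. l i (realize \<phi>) * \<zeta> i \<mu>) \<le> (\<Sum>i\<in>{1..n}. norm (l i (realize \<phi>)) * ?Z (\<zeta> i))"
        using \<zeta> by (intro Z.sq_norm_sum_le) auto
      also have "\<dots> \<le> (\<Sum>i\<in>{1..n}. \<bar>B i\<bar> * ?Z (\<zeta> i))"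
        using l by (intro sum_mono mult_right_mono) auto
      finally show "?Z (\<lambda>\<mu>. \<Sum>i\<in>{1..n}. l i (realize \<phi>) * \<zeta> i \<mu>) \<le> (\<Sum>i\<in>{1..n}. \<bar>B i\<bar> * ?Z (\<zeta> i))" .
    qed
    finally show "?Z (residual n l \<zeta> \<phi>) \<le> 1 + (\<Sum>i\<in>{1..n}. \<bar>B i\<bar> * ?Z (\<zeta> i))" .
  qed
qed

end


section \<open>Lower and upper bounds for the error by singular values\<close>

context weighted_factors
begin

interpretation Z: weighted_factors smul ip e "space_H0 ip" UNIV "\<lambda>_ _. 1"
  by (rule weighted_factors_H0)

lemma realize_add_cmult:
  assumes "\<phi> \<in> ell2" "\<zeta> \<in> ell2"
  shows "(\<lambda>\<mu>. \<phi> \<mu> + c * \<zeta> \<mu>) \<in> ell2"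
    and "realize (\<lambda>\<mu>. \<phi> \<mu> + c * \<zeta> \<mu>) = (\<lambda>g. realize \<phi> g + c * realize \<zeta> g)"
  using realize_diff_sum[OF assms(1), of "{()}" "\<lambda>_. \<zeta>" "\<lambda>_. - c"] assms(2) by simp_all

lemma realize_zero: "realize (\<lambda>_. 0) = (\<lambda>_. 0)"
  by (simp add: realize_def sq_ip_def fun_eq_iff)

lemma dual_add_cmult:
  assumes l: "l \<in> dual_space (tensor X (e 0))" and "\<phi> \<in> ell2" "\<zeta> \<in> ell2"
  shows "l (realize (\<lambda>\<mu>. \<phi> \<mu> + c * \<zeta> \<mu>)) = l (realize \<phi>) + c * l (realize \<zeta>)"
proof -
  \<comment> \<open>Additivity in \<open>dual_space\<close> is granted on \<open>vecs\<close> only,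
    so the multiple has to be placed there first.\<close>
  have "(\<lambda>g. c * realize \<zeta> g) \<in> realize ` ell2"
    using realize_add_cmult[OF zero_ell2 assms(3), of c] by (force simp: realize_zero)
  then have "l (\<lambda>g. realize \<phi> g + c * realize \<zeta> g) = l (realize \<phi>) + l (\<lambda>g. c * realize \<zeta> g)"
    using l \<open>\<phi> \<in> ell2\<close> unfolding dual_space_def vecs_tensor mem_Collect_eq by fast
  also have "l (\<lambda>g. c * realize \<zeta> g) = c * l (realize \<zeta>)"
    using l \<open>\<zeta> \<in> ell2\<close> unfolding dual_space_def vecs_tensor mem_Collect_eq by fast
  finally show ?thesis
    unfolding realize_add_cmult(2)[OF assms(2,3)] .
qed

lemma dual_zero:
  assumes "l \<in> dual_space (tensor X (e 0))"
  shows "l (realize (\<lambda>_. 0)) = 0"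
  using dual_add_cmult[OF assms zero_ell2 zero_ell2, of 1] by simp

lemma dual_sum:
  assumes l: "l \<in> dual_space (tensor X (e 0))" and S: "finite S" "S \<subseteq> idx N"
  shows "l (realize (\<lambda>\<kappa>. if \<kappa> \<in> S then c \<kappa> else 0)) =
    (\<Sum>\<mu>\<in>S. c \<mu> * l (realize (\<lambda>\<kappa>. if \<kappa> = \<mu> then 1 else 0)))"
  using S
proof (induction S rule: finite_induct)
  case empty
  then show ?case using dual_zero[OF l] by simp
next
  case (insert \<mu> S)
  let ?\<phi> = "\<lambda>\<kappa>. if \<kappa> \<in> S then c \<kappa> else 0" and ?\<delta> = "\<lambda>\<kappa>. if \<kappa> = \<mu> then 1 else 0"
  have "?\<phi> \<in> ell2" "?\<delta> \<in> ell2"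
    using insert finite_support_ell2[of S ?\<phi>] finite_support_ell2[of "{\<mu>}" ?\<delta>] by auto
  note * = dual_add_cmult[OF l this, of "c \<mu>"]
  have "(\<lambda>\<kappa>. if \<kappa> \<in> insert \<mu> S then c \<kappa> else 0) = (\<lambda>\<kappa>. ?\<phi> \<kappa> + c \<mu> * ?\<delta> \<kappa>)"
    using insert.hyps by (intro ext) auto
  then show ?case
    using * insert by simp
qed

lemma zero_dual: "(\<lambda>_. 0) \<in> dual_space (tensor X (e 0))"
  unfolding dual_space_def by (auto intro: exI[of _ 0])

text \<open>Any \<open>n\<close> functionals have a common nontrivial zero in the span of more than
  \<open>n\<close> basis tensors. There the algorithm returns zero, so its error is the ambient norm
  of the input, which is at least \<open>t\<close> times its norm in the domain.\<close>

lemma App_err_lower: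
  assumes S: "finite S" "S \<subseteq> idx N" "n < card S"
    and t: "0 \<le> t" "\<And>\<mu>. \<mu> \<in> S \<Longrightarrow> t\<^sup>2 * wt w \<mu> \<le> 1"
  shows "t \<le> App_err n"
  unfolding App_err_eq
proof (rule cINF_greatest)
  let ?P = "{(l, \<zeta>). \<forall>i\<in>{1..n}. l i \<in> dual_space (tensor X (e 0)) \<and> \<zeta> i \<in> Z.ell2}"
  have "(\<lambda>_ _. 0, \<lambda>_ _. 0) \<in> ?P"
    using zero_dual Z.zero_ell2 by simp
  then show "?P \<noteq> {}"
    by (metis empty_iff)
  fix p assume "p \<in> ?P"
  then obtain l \<zeta> where p: "p = (l, \<zeta>)"
    and l\<zeta>: "\<forall>i\<in>{1..n}. l i \<in> dual_space (tensor X (e 0)) \<and> \<zeta> i \<in> Z.ell2"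
    by blast
  let ?\<delta> = "\<lambda>\<mu> \<kappa>. if \<kappa> = \<mu> then 1 else 0 :: 'k"
  from exists_nontrivial_kernel[OF S(1,3), of "\<lambda>i \<mu>. l i (realize (?\<delta> \<mu>))"]
  obtain c where c: "\<exists>\<mu>\<in>S. c \<mu> \<noteq> 0" "\<forall>i\<in>{1..n}. (\<Sum>\<mu>\<in>S. c \<mu> * l i (realize (?\<delta> \<mu>))) = 0"
    by (elim exE conjE)
  define \<phi>0 where "\<phi>0 \<kappa> = (if \<kappa> \<in> S then c \<kappa> else 0)" for \<kappa>
  have \<phi>0: "\<phi>0 \<in> ell2"
    by (rule finite_support_ell2[OF S(1,2)]) (simp add: \<phi>0_def)
  define r where "r = sq_norm (wt w) (idx N) \<phi>0"
  have "(\<Sum>\<mu>\<in>S. wt w \<mu> * (norm (\<phi>0 \<mu>))\<^sup>2) > 0"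
  proof -
    obtain \<mu> where \<mu>: "\<mu> \<in> S" "c \<mu> \<noteq> 0"
      using c(1) by blast
    show ?thesis
    proof (rule sum_pos2[OF S(1) \<mu>(1)])
      show "0 < wt w \<mu> * (norm (\<phi>0 \<mu>))\<^sup>2"
        using \<mu> S wt_pos by (auto simp: \<phi>0_def)
      show "0 \<le> wt w \<kappa> * (norm (\<phi>0 \<kappa>))\<^sup>2" if "\<kappa> \<in> S" for \<kappa>
        using that S W_nonneg by auto
    qed
  qed
  then have r: "r > 0"
    unfolding r_def by (subst sq_norm_finite_support[OF S(1,2)]) (auto simp: \<phi>0_def)
  define \<phi> where "\<phi> \<kappa> = of_real (1 / r) * \<phi>0 \<kappa>" for \<kappa>
  have \<phi>: "\<phi> \<in> ell2"
    using realize_add_cmult(1)[OF zero_ell2 \<phi>0, of "of_real (1 / r)"] by (simp add: \<phi>_def[abs_def])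
  have norm_\<phi>: "sq_norm (wt w) (idx N) \<phi> = 1"
    using \<phi>0 r sq_summable_cmult(2)[of \<phi>0 "of_real (1 / r)"]
    by (simp add: \<phi>_def[abs_def] ell2_def r_def norm_divide)
  have "l i (realize \<phi>) = 0" if i: "i \<in> {1..n}" for i
  proof -
    have "l i (realize \<phi>) = of_real (1 / r) * l i (realize \<phi>0)"
      using dual_add_cmult[OF _ zero_ell2 \<phi>0, of "l i" "of_real (1 / r)"] dual_zero[of "l i"] l\<zeta> i
      by (simp add: \<phi>_def[abs_def])
    also have "l i (realize \<phi>0) = 0"
      using dual_sum[OF _ S(1,2), of "l i" c] c(2) l\<zeta> i by (simp add: \<phi>0_def[abs_def])
    finally show ?thesis by simp
  qed
  then have res: "residual n l \<zeta> \<phi> = \<phi>"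
    by (simp add: residual_def fun_eq_iff)
  have "t = sqrt (t\<^sup>2 * (\<Sum>\<mu>\<in>S. wt w \<mu> * (norm (\<phi> \<mu>))\<^sup>2))"
    using norm_\<phi> t(1) sq_norm_finite_support[OF S(1,2), of \<phi>]
    by (simp add: real_sqrt_mult \<phi>_def \<phi>0_def)
  also have "\<dots> \<le> sqrt (\<Sum>\<mu>\<in>S. (norm (\<phi> \<mu>))\<^sup>2)"
  proof (rule real_sqrt_le_mono)
    have "t\<^sup>2 * wt w \<mu> * (norm (\<phi> \<mu>))\<^sup>2 \<le> 1 * (norm (\<phi> \<mu>))\<^sup>2" if "\<mu> \<in> S" for \<mu>
      using t(2)[OF that] by (rule mult_right_mono) simp
    then show "t\<^sup>2 * (\<Sum>\<mu>\<in>S. wt w \<mu> * (norm (\<phi> \<mu>))\<^sup>2) \<le> (\<Sum>\<mu>\<in>S. (norm (\<phi> \<mu>))\<^sup>2)"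
      unfolding sum_distrib_left by (intro sum_mono) (simp add: mult.assoc)
  qed
  also have "\<dots> = sq_norm (wt (\<lambda>_ _. 1)) (idx UNIV) \<phi>"
    using S idx_mono[of N UNIV]
    by (subst Z.sq_norm_finite_support[of S]) (auto simp: wt_one \<phi>_def \<phi>0_def)
  finally have "t \<le> sq_norm (wt (\<lambda>_ _. 1)) (idx UNIV) (residual n l \<zeta> \<phi>)"
    by (simp add: res)
  then show "t \<le> (case p of (l, \<zeta>) \<Rightarrow> SUP \<phi>\<in>{\<phi> \<in> ell2. sq_norm (wt w) (idx N) \<phi> \<le> 1}.
      sq_norm (wt (\<lambda>_ _. 1)) (idx UNIV) (residual n l \<zeta> \<phi>))"
    unfolding p prod.case using \<phi> norm_\<phi> residual_bounded[OF l\<zeta>]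
    by (intro cSUP_upper2[where x = \<phi>]) auto
qed

text \<open>By \<open>realize_ev\<close> this functional is the coefficient at \<open>\<mu>\<close>;
  it is bounded by the norm because all weights are at least \<open>1\<close>.\<close>

lemma coefficient_dual:
  assumes \<mu>: "\<mu> \<in> idx N"
  shows "(\<lambda>f. f (ev \<mu>) / of_real (wt w \<mu>)) \<in> dual_space (tensor X (e 0))"
proof -
  have "norm (f (ev \<mu>) / of_real (wt w \<mu>)) \<le> 1 * ip_norm (tensor X (e 0)) f"
    if f: "f \<in> vecs (tensor X (e 0))" for f
  proof -
    obtain \<phi> where \<phi>: "\<phi> \<in> ell2" "f = realize \<phi>"
      using f by (auto simp: vecs_tensor)
    then show ?thesis
      using norm_le_sq_norm[OF _ \<mu>, of \<phi>] wt_pos[OF \<mu>]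
      by (simp add: realize_ev[OF \<mu>] norm_tensor ell2_def)
  qed
  then show ?thesis
    unfolding dual_space_def by (auto simp: add_divide_distrib intro!: exI[of _ 1])
qed

text \<open>The algorithm that keeps exactly the coefficients in \<open>S\<close> leaves an error
  seen only outside \<open>S\<close>, where the ambient norm is at most \<open>t\<close> times the
  norm in the domain.\<close>

lemma App_err_upper:
  assumes S: "finite S" "S \<subseteq> idx N" "card S \<le> n"
    and t: "0 \<le> t" "\<And>\<mu>. \<mu> \<in> idx N - S \<Longrightarrow> 1 \<le> t\<^sup>2 * wt w \<mu>"
  shows "App_err n \<le> t"
proof -
  obtain h where h: "bij_betw h {1..card S} S"
    using ex_bij_betw_nat_finite_1[OF S(1)] by blast
  let ?\<delta> = "\<lambda>\<mu> \<kappa>. if \<kappa> = \<mu> then 1 else 0 :: 'k"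
  \<comment> \<open>Slots beyond \<open>card S\<close> are padded with zero, because
    \<open>alg_all n\<close> consists of sums with \<open>n\<close> terms.\<close>
  define l where "l i f = (if i \<le> card S then f (ev (h i)) / of_real (wt w (h i)) else 0 :: 'k)" for i f
  define \<zeta> where "\<zeta> i = (if i \<le> card S then ?\<delta> (h i) else (\<lambda>_. 0))" for i
  have hS: "h i \<in> S" if "i \<in> {1..card S}" for i
    using h that by (auto simp: bij_betw_def)
  let ?P = "{(l, \<zeta>). \<forall>i\<in>{1..n}. l i \<in> dual_space (tensor X (e 0)) \<and> \<zeta> i \<in> Z.ell2}"
  have P: "(l, \<zeta>) \<in> ?P"
  proof -
    have "l i \<in> dual_space (tensor X (e 0)) \<and> \<zeta> i \<in> Z.ell2" if "i \<in> {1..n}" for i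
    proof (cases "i \<le> card S")
      case True
      then have hi: "h i \<in> idx N" "h i \<in> idx UNIV"
        using hS[of i] that S(2) idx_mono[of N UNIV] by auto
      show ?thesis
        using True coefficient_dual[OF hi(1)] Z.finite_support_ell2[of "{h i}" "?\<delta> (h i)"] hi(2)
        by (simp add: l_def[abs_def] \<zeta>_def)
    next
      case False
      then show ?thesis
        using zero_dual Z.zero_ell2 by (simp add: l_def[abs_def] \<zeta>_def)
    qed
    then show ?thesis by simp
  qed
  have res: "residual n l \<zeta> \<phi> \<mu> = (if \<mu> \<in> S then 0 else \<phi> \<mu>)" if "\<phi> \<in> ell2" for \<phi> \<mu>
  proof -
    have "(\<Sum>i\<in>{1..n}. l i (realize \<phi>) * \<zeta> i \<mu>) = (\<Sum>i\<in>{1..card S}. l i (realize \<phi>) * \<zeta> i \<mu>)"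
      using S(3) by (intro sum.mono_neutral_right) (auto simp: l_def)
    also have "\<dots> = (\<Sum>i\<in>{1..card S}. if \<mu> = h i then \<phi> (h i) else 0)"
    proof (rule sum.cong[OF refl])
      fix i assume i: "i \<in> {1..card S}"
      then show "l i (realize \<phi>) * \<zeta> i \<mu> = (if \<mu> = h i then \<phi> (h i) else 0)"
        using realize_ev[of "h i" \<phi>] hS[OF i] S(2) wt_pos[of "h i"] by (auto simp: l_def \<zeta>_def)
    qed
    also have "\<dots> = (\<Sum>\<kappa>\<in>S. if \<mu> = \<kappa> then \<phi> \<kappa> else 0)"
      by (rule sum.reindex_bij_betw[OF h])
    also have "\<dots> = (if \<mu> \<in> S then \<phi> \<mu> else 0)"
      using S(1) by simp
    finally show ?thesis
      by (simp add: residual_def)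
  qed
  have "App_err n \<le> (case (l, \<zeta>) of (l, \<zeta>) \<Rightarrow> SUP \<phi>\<in>{\<phi> \<in> ell2. sq_norm (wt w) (idx N) \<phi> \<le> 1}.
      sq_norm (wt (\<lambda>_ _. 1)) (idx UNIV) (residual n l \<zeta> \<phi>))"
    unfolding App_err_eq
  proof (rule cINF_lower[OF _ P])
    \<comment> \<open>A real-valued \<open>INF\<close> is controlled only when bounded below;
      testing with the zero tensor shows that every supremum is nonnegative.\<close>
    show "bdd_below ((\<lambda>(l, \<zeta>). SUP \<phi>\<in>{\<phi> \<in> ell2. sq_norm (wt w) (idx N) \<phi> \<le> 1}.
        sq_norm (wt (\<lambda>_ _. 1)) (idx UNIV) (residual n l \<zeta> \<phi>)) ` ?P)"
    proof (rule bdd_belowI2[where m = 0])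
      fix p assume "p \<in> ?P"
      then obtain l \<zeta> where p: "p = (l, \<zeta>)"
        and l\<zeta>: "\<forall>i\<in>{1..n}. l i \<in> dual_space (tensor X (e 0)) \<and> \<zeta> i \<in> Z.ell2"
        by blast
      have "sq_norm (wt w) (idx N) (\<lambda>_. 0 :: 'k) \<le> 1"
        by (simp add: sq_norm_def)
      then show "0 \<le> (case p of (l, \<zeta>) \<Rightarrow> SUP \<phi>\<in>{\<phi> \<in> ell2. sq_norm (wt w) (idx N) \<phi> \<le> 1}.
          sq_norm (wt (\<lambda>_ _. 1)) (idx UNIV) (residual n l \<zeta> \<phi>))"
        unfolding p prod.case using zero_ell2 residual_bounded[OF l\<zeta>]
        by (intro cSUP_upper2[where x = "\<lambda>_. 0"]) auto
    qed
  qed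
  also have "\<dots> \<le> t"
    unfolding prod.case
  proof (rule cSUP_least)
    show "{\<phi> \<in> ell2. sq_norm (wt w) (idx N) \<phi> \<le> 1} \<noteq> {}"
      using zero_ell2 by (auto simp: sq_norm_def intro!: exI[of _ "\<lambda>_. 0"])
    fix \<phi> assume "\<phi> \<in> {\<phi> \<in> ell2. sq_norm (wt w) (idx N) \<phi> \<le> 1}"
    then have \<phi>: "\<phi> \<in> ell2" "sq_norm (wt w) (idx N) \<phi> \<le> 1"
      by auto
    have "sq_norm (wt (\<lambda>_ _. 1)) (idx UNIV) (residual n l \<zeta> \<phi>) \<le> t * sq_norm (wt w) (idx N) \<phi>"
    proof (rule ambient_norm_le(2))
      show "sq_summable (wt w) (idx N) \<phi>"
        using \<phi> by (simp add: ell2_def)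
      show "residual n l \<zeta> \<phi> \<mu> = 0" if "\<mu> \<in> idx UNIV - idx N" for \<mu>
        using that \<phi> by (simp add: res ell2_def)
      show "(norm (residual n l \<zeta> \<phi> \<mu>))\<^sup>2 \<le> t\<^sup>2 * (wt w \<mu> * (norm (\<phi> \<mu>))\<^sup>2)" if "\<mu> \<in> idx N" for \<mu>
      proof (cases "\<mu> \<in> S")
        case True
        then show ?thesis
          using W_nonneg[OF that] \<phi>(1) by (simp add: res)
      next
        case False
        then have "1 * (norm (\<phi> \<mu>))\<^sup>2 \<le> t\<^sup>2 * wt w \<mu> * (norm (\<phi> \<mu>))\<^sup>2"
          using t(2)[of \<mu>] that by (intro mult_right_mono) auto
        then show ?thesis
          using False \<phi>(1) by (simp add: res mult.assoc)
      qed
    qed (rule t(1))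
    also have "\<dots> \<le> t * 1"
      using t(1) \<phi>(2) by (intro mult_left_mono) auto
    finally show "sq_norm (wt (\<lambda>_ _. 1)) (idx UNIV) (residual n l \<zeta> \<phi>) \<le> t"
      by simp
  qed
  finally show ?thesis .
qed

end


subsection \<open>Decay\<close>

lemma summable_real_powr:
  assumes "s > 1"
  shows "(\<lambda>n. real n powr (- s)) summable_on A"
proof -
  have "summable (\<lambda>n. real n powr (- s))"
    using assms by (simp add: summable_real_powr_iff)
  then have "(\<lambda>n. real n powr (- s)) summable_on UNIV"
    by (simp add: summable_on_UNIV_nonneg_real_iff)
  then show ?thesis
    by (rule summable_on_subset_banach) auto
qed

lemma decay_geI:
  assumes "\<tau> > 0" "(\<lambda>i. x i powr (1 / \<tau>)) summable_on {1..}"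
  shows "ennreal \<tau> \<le> decay x"
  unfolding decay_def using assms by (intro Sup_upper) auto

text \<open>At the exponent \<open>1 / \<tau>\<close> the majorant is harmonic, so
  \<open>\<tau>\<close> is approached from below: for \<open>\<sigma> < \<tau>\<close> the majorant
  has exponent \<open>\<tau> / \<sigma> > 1\<close>.\<close>

lemma decay_polynomial:
  assumes "\<tau> > 0" "0 \<le> C" and x: "\<And>n. n \<ge> 1 \<Longrightarrow> 0 \<le> x n \<and> x n \<le> (C / real n) powr \<tau>"
  shows "ennreal \<tau> \<le> decay x"
proof (rule dense_le)
  fix y assume y: "y < ennreal \<tau>"
  then obtain \<sigma> where \<sigma>: "y = ennreal \<sigma>" "0 \<le> \<sigma>" "\<sigma> < \<tau>"
    by (cases y) (auto simp: ennreal_less_iff)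
  show "y \<le> decay x"
  proof (cases "\<sigma> = 0")
    case False
    with \<sigma> have pos: "\<sigma> > 0" by simp
    have "(\<lambda>n. C powr (\<tau> / \<sigma>) * real n powr (- (\<tau> / \<sigma>))) summable_on {1..}"
      using pos \<sigma> by (intro summable_on_cmult_right summable_real_powr) (simp add: field_simps)
    then have "(\<lambda>n. x n powr (1 / \<sigma>)) summable_on {1..}"
    proof (rule summable_on_comparison_test)
      fix n :: nat assume "n \<in> {1..}"
      then have n: "n \<ge> 1" by simp
      have "x n powr (1 / \<sigma>) \<le> ((C / real n) powr \<tau>) powr (1 / \<sigma>)"
        using x[OF n] pos by (intro powr_mono2) auto
      also have "\<dots> = (C / real n) powr (\<tau> / \<sigma>)"
        by (simp add: powr_powr)
      also have "\<dots> = C powr (\<tau> / \<sigma>) * real n powr (- (\<tau> / \<sigma>))"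
        using assms(2) by (simp add: powr_divide powr_minus_divide)
      finally show "x n powr (1 / \<sigma>) \<le> C powr (\<tau> / \<sigma>) * real n powr (- (\<tau> / \<sigma>))" .
    qed auto
    then show ?thesis
      using decay_geI pos \<sigma>(1) by blast
  qed (simp add: \<sigma>)
qed

lemma half_ennreal: "0 \<le> \<tau> \<Longrightarrow> 1 / 2 * ennreal (2 * \<tau>) = ennreal \<tau>"
proof -
  assume "0 \<le> \<tau>"
  have "ennreal \<tau> = ennreal (1 / 2 * (2 * \<tau>))"
    by simp
  also have "\<dots> = ennreal (1 / 2) * ennreal (2 * \<tau>)"
    using \<open>0 \<le> \<tau>\<close> by (intro ennreal_mult) auto
  also have "ennreal (1 / 2) = 1 / 2"
    by (metis divide_ennreal ennreal_1 ennreal_numeral zero_le_one zero_less_numeral)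
  finally show ?thesis ..
qed

lemma decay_le_half:
  assumes "\<And>\<tau>. \<tau> > 0 \<Longrightarrow> (\<lambda>n. y n powr (1 / \<tau>)) summable_on {1..} \<Longrightarrow>
    (\<lambda>n. x n powr (1 / (2 * \<tau>))) summable_on {1..}"
  shows "decay y \<le> 1 / 2 * decay x"
  unfolding decay_def[of y]
proof (rule Sup_least)
  fix z assume "z \<in> {ennreal \<tau> | \<tau>. \<tau> > 0 \<and> (\<lambda>i. y i powr (1 / \<tau>)) summable_on {1..}}"
  then obtain \<tau> where \<tau>: "z = ennreal \<tau>" "\<tau> > 0" "(\<lambda>i. y i powr (1 / \<tau>)) summable_on {1..}"
    by blast
  then have "ennreal (2 * \<tau>) \<le> decay x"
    using assms[of \<tau>] by (intro decay_geI) auto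
  then have "1 / 2 * ennreal (2 * \<tau>) \<le> 1 / 2 * decay x"
    by (rule mult_left_mono) simp
  then show "z \<le> 1 / 2 * decay x"
    using \<tau> by (simp only: half_ennreal less_imp_le)
qed

text \<open>Terms in the unit interval shrink as the exponent grows. Admissible values of
  \<open>\<tau>\<close> therefore stay admissible when decreased, which allows a common
  \<open>\<tau>\<close> for two sequences.\<close>

lemma summable_powr_antimono:
  fixes x :: "nat \<Rightarrow> real"
  assumes "\<And>i. i \<ge> 1 \<Longrightarrow> 0 \<le> x i \<and> x i \<le> 1" "s \<le> t" "(\<lambda>i. x i powr s) summable_on {1..}"
  shows "(\<lambda>i. x i powr t) summable_on {1..}"
  using assms(3)
proof (rule summable_on_comparison_test)
  fix i :: nat assume "i \<in> {1..}"
  then show "x i powr t \<le> x i powr s"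
    using assms(1)[of i] assms(2) by (cases "x i = 0") (auto intro!: powr_mono')
qed auto

text \<open>A value \<open>z\<close> below the minimum lies below an admissible
  \<open>\<tau>1\<close> and an admissible \<open>\<tau>2\<close>; the smaller of these is
  admissible for both sequences and still exceeds \<open>z\<close>.\<close>

lemma half_min_decay_le:
  assumes x: "\<And>i. i \<ge> 1 \<Longrightarrow> 0 \<le> x i \<and> x i \<le> 1" and y: "\<And>i. i \<ge> 1 \<Longrightarrow> 0 \<le> y i \<and> y i \<le> 1"
    and D: "\<And>\<tau>. \<tau> > 0 \<Longrightarrow> (\<lambda>n. x n powr (1 / \<tau>)) summable_on {1..} \<Longrightarrow>
      (\<lambda>n. y n powr (1 / \<tau>)) summable_on {1..} \<Longrightarrow> ennreal (\<tau> / 2) \<le> D"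
  shows "1 / 2 * min (decay x) (decay y) \<le> D"
proof -
  have "min (decay x) (decay y) \<le> 2 * D"
  proof (rule dense_le)
    fix z assume "z < min (decay x) (decay y)"
    then have "z < decay x" "z < decay y" by auto
    then obtain \<tau>1 \<tau>2 where \<tau>1: "\<tau>1 > 0" "(\<lambda>n. x n powr (1 / \<tau>1)) summable_on {1..}" "z < ennreal \<tau>1"
      and \<tau>2: "\<tau>2 > 0" "(\<lambda>n. y n powr (1 / \<tau>2)) summable_on {1..}" "z < ennreal \<tau>2"
      unfolding decay_def less_Sup_iff by blast
    define \<tau> where "\<tau> = min \<tau>1 \<tau>2"
    have \<tau>: "\<tau> > 0" "1 / \<tau>1 \<le> 1 / \<tau>" "1 / \<tau>2 \<le> 1 / \<tau>"
      using \<tau>1(1) \<tau>2(1) by (auto simp: \<tau>_def intro!: divide_left_mono)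
    have "ennreal (\<tau> / 2) \<le> D"
      using summable_powr_antimono[OF x \<tau>(2) \<tau>1(2)] summable_powr_antimono[OF y \<tau>(3) \<tau>2(2)] \<tau>(1)
      by (intro D)
    then have "2 * ennreal (\<tau> / 2) \<le> 2 * D"
      by (rule mult_left_mono) simp
    also have "2 * ennreal (\<tau> / 2) = ennreal \<tau>"
      using \<tau>(1) ennreal_mult[of 2 "\<tau> / 2"] by simp
    finally show "z \<le> 2 * D"
      using \<tau>1(3) \<tau>2(3) unfolding \<tau>_def by (auto simp: min_def split: if_splits)
  qed
  then have "1 / 2 * min (decay x) (decay y) \<le> 1 / 2 * (2 * D)"
    by (rule mult_left_mono) simp
  also have "\<dots> = D"
  proof -
    have "(1 / 2 * 2 :: ennreal) = 1"
      using half_ennreal[of 1] by simp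
    then show ?thesis
      by (simp only: mult.assoc[symmetric] mult_1)
  qed
  finally show ?thesis .
qed

text \<open>Multi-indices with at most one nonzero entry place every single weight
  \<open>w \<nu> j\<close>, \<open>\<nu> \<noteq> 0\<close>, among the values of
  \<open>wt w\<close>, and so embed the double series in the sum over all multi-indices.\<close>

definition site :: "nat \<Rightarrow> nat \<Rightarrow> nat \<Rightarrow> nat" where
  "site j \<nu> i = (if i = j then \<nu> else 0)"

lemma supp_site: "supp (site j \<nu>) = (if \<nu> = 0 then {} else {j})"
  by (auto simp: supp_def site_def)

section \<open>Passing between summability of errors and of weights\<close>

context weighted_factors
begin

lemma site_idx: "j \<ge> 1 \<Longrightarrow> \<nu> \<in> N \<Longrightarrow> site j \<nu> \<in> idx N"
  using zero_in by (simp add: idx_def supp_site) (simp add: site_def)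

lemma wt_site: "\<nu> \<noteq> 0 \<Longrightarrow> wt w (site j \<nu>) = w \<nu> j"
  by (simp add: wt_def supp_site) (simp add: site_def)

lemma App_err_nonneg: "0 \<le> App_err n"
proof (rule App_err_lower)
  \<comment> \<open>With \<open>t = 0\<close> it only remains to supply more than \<open>n\<close>
    multi-indices, one for each of the first \<open>n + 1\<close> factors.\<close>
  have "inj_on (\<lambda>j. site j 1) {1..Suc n}"
    by (rule inj_onI) (metis site_def zero_neq_one)
  then show "n < card ((\<lambda>j. site j 1) ` {1..Suc n})"
    by (simp add: card_image)
  show "(\<lambda>j. site j 1) ` {1..Suc n} \<subseteq> idx N"
    using one_in by (auto intro!: site_idx)
qed auto

lemma zero_idx: "(\<lambda>_. 0) \<in> idx N"
  using zero_in by (simp add: idx_def supp_def)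

text \<open>
  The zero multi-index carries the largest singular value \<open>1\<close>, which \<open>App_err n\<close> for \<open>n \<ge> 1\<close> skips;
  adding it to a set \<open>S\<close> of size \<open>k\<close> bounds \<open>App_err k\<close> below by the least singular value in \<open>S\<close>.
\<close>

lemma sum_wt_le_sum_err:
  assumes "p > 0" "finite S" "S \<subseteq> idx N - {\<lambda>_. 0}"
  shows "(\<Sum>\<mu>\<in>S. wt w \<mu> powr (- p / 2)) \<le> (\<Sum>n\<in>{1..card S}. App_err n powr p)"
  using assms(2,3)
proof (induction "card S" arbitrary: S)
  case 0
  then show ?case by simp
next
  case (Suc k)
  \<comment> \<open>The largest weight in \<open>S\<close>, hence its least singular value, is
    charged to \<open>App_err (Suc k)\<close>; induction charges the others to smaller
    indices.\<close>
  have "Max (wt w ` S) \<in> wt w ` S"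
    using Suc by (intro Max_in) auto
  then obtain \<mu> where \<mu>: "\<mu> \<in> S" "wt w \<mu> = Max (wt w ` S)"
    by auto
  have max: "wt w \<nu> \<le> wt w \<mu>" if "\<nu> \<in> S" for \<nu>
    using that Suc.prems \<mu>(2) by simp
  have \<mu>1: "1 \<le> wt w \<mu>"
    using \<mu>(1) Suc.prems by (intro wt_ge) auto
  define t where "t = wt w \<mu> powr (- 1 / 2)"
  have t2: "t\<^sup>2 = 1 / wt w \<mu>"
    using \<mu>1 by (simp add: t_def power2_eq_square powr_minus_divide flip: powr_add)
  have "t \<le> App_err (Suc k)"
  proof (rule App_err_lower)
    show "finite (insert (\<lambda>_. 0) S)" "insert (\<lambda>_. 0) S \<subseteq> idx N"
      using Suc.prems zero_idx by auto
    have "(\<lambda>_. 0) \<notin> S"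
      using Suc.prems by auto
    then show "Suc k < card (insert (\<lambda>_. 0) S)"
      using Suc.prems Suc.hyps(2) by simp
    show "t\<^sup>2 * wt w \<nu> \<le> 1" if "\<nu> \<in> insert (\<lambda>_. 0) S" for \<nu>
      using that max[of \<nu>] \<mu>1 by (auto simp: t2 wt_def supp_def)
  qed (simp add: t_def)
  then have "t powr p \<le> App_err (Suc k) powr p"
    using assms(1) by (intro powr_mono2) (auto simp: t_def)
  then have 1: "wt w \<mu> powr (- p / 2) \<le> App_err (Suc k) powr p"
    by (simp add: t_def powr_powr)
  have k: "card (S - {\<mu>}) = k"
    using Suc.hyps(2) \<mu>(1) Suc.prems by simp
  have 2: "(\<Sum>\<nu>\<in>S - {\<mu>}. wt w \<nu> powr (- p / 2)) \<le> (\<Sum>n\<in>{1..k}. App_err n powr p)"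
    using Suc.hyps(1)[of "S - {\<mu>}"] k Suc.prems by auto
  have "(\<Sum>\<nu>\<in>S. wt w \<nu> powr (- p / 2)) = wt w \<mu> powr (- p / 2) + (\<Sum>\<nu>\<in>S - {\<mu>}. wt w \<nu> powr (- p / 2))"
    using \<mu>(1) Suc.prems by (simp add: sum.remove)
  also have "\<dots> \<le> (\<Sum>n\<in>{1..Suc k}. App_err n powr p)"
    using 1 2 by simp
  finally show ?case
    by (simp only: Suc.hyps(2)[symmetric])
qed

lemma summable_wt_of_err:
  assumes "p > 0" "(\<lambda>n. App_err n powr p) summable_on {1..}"
  shows "(\<lambda>\<mu>. wt w \<mu> powr (- p / 2)) summable_on idx N - {\<lambda>_. 0}"
proof (rule summable_on_bounded_sums(1))
  fix S assume S: "finite S" "S \<subseteq> idx N - {\<lambda>_. 0}"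
  note sum_wt_le_sum_err[OF assms(1) S]
  also have "(\<Sum>n\<in>{1..card S}. App_err n powr p) \<le> (\<Sum>\<^sub>\<infinity>n\<in>{1..}. App_err n powr p)"
    using assms(2) by (intro finite_sum_le_infsum) auto
  finally show "(\<Sum>\<mu>\<in>S. wt w \<mu> powr (- p / 2)) \<le> (\<Sum>\<^sub>\<infinity>n\<in>{1..}. App_err n powr p)" .
qed simp

text \<open>Only multi-indices with exactly one nonzero entry are kept. \<open>site j 0\<close> is
  the zero multi-index for every \<open>j\<close>, so \<open>\<nu> \<noteq> 0\<close> is what makes
  the indexing injective.\<close>

lemma summable_site_of_err:
  assumes p: "p > 0" "(\<lambda>n. App_err n powr p) summable_on {1..}"
    and K: "\<And>j \<nu>. (j, \<nu>) \<in> K \<Longrightarrow> j \<ge> 1 \<and> \<nu> \<in> N \<and> \<nu> \<noteq> 0"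
  shows "(\<lambda>(j, \<nu>). w \<nu> j powr (- p / 2)) summable_on K"
proof -
  have inj: "inj_on (\<lambda>(j, \<nu>). site j \<nu>) K"
  proof (rule inj_onI, clarify)
    fix j \<nu> j' \<nu>' assume *: "(j, \<nu>) \<in> K" "(j', \<nu>') \<in> K" "site j \<nu> = site j' \<nu>'"
    have "supp (site j \<nu>) = supp (site j' \<nu>')" "site j \<nu> j = site j' \<nu>' j"
      using *(3) by simp_all
    then show "j = j' \<and> \<nu> = \<nu>'"
      using K[OF *(1)] K[OF *(2)] by (auto simp: supp_site site_def)
  qed
  have "(\<lambda>(j, \<nu>). site j \<nu>) ` K \<subseteq> idx N - {\<lambda>_. 0}"
  proof clarify
    fix j \<nu> assume "(j, \<nu>) \<in> K"
    then have j\<nu>: "j \<ge> 1" "\<nu> \<in> N" "\<nu> \<noteq> 0"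
      using K by auto
    moreover have "site j \<nu> \<noteq> (\<lambda>_. 0)"
    proof
      assume "site j \<nu> = (\<lambda>_. 0)"
      then have "site j \<nu> j = 0" by simp
      then show False using j\<nu> by (simp add: site_def)
    qed
    ultimately show "site j \<nu> \<in> idx N - {\<lambda>_. 0}"
      using site_idx by simp
  qed
  then have "(\<lambda>\<mu>. wt w \<mu> powr (- p / 2)) summable_on (\<lambda>(j, \<nu>). site j \<nu>) ` K"
    by (rule summable_on_subset_banach[OF summable_wt_of_err[OF p]])
  then have "((\<lambda>\<mu>. wt w \<mu> powr (- p / 2)) \<circ> (\<lambda>(j, \<nu>). site j \<nu>)) summable_on K"
    by (simp only: summable_on_reindex[OF inj])
  then show ?thesis
    by (rule summable_on_cong[THEN iffD1, rotated]) (use K in \<open>auto simp: wt_site\<close>)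
qed

text \<open>
  By Markov's inequality, at most \<open>n\<close> singular values exceed \<open>(C / n) powr \<tau>\<close>, where \<open>C\<close> is the sum
  of their powers with exponent \<open>1 / \<tau>\<close>.
\<close>

lemma decay_err_ge:
  assumes "\<tau> > 0" and summ: "(\<lambda>\<mu>. wt w \<mu> powr (- (1 / \<tau>) / 2)) summable_on idx N"
  shows "ennreal \<tau> \<le> decay App_err"
proof (rule decay_polynomial[OF assms(1)])
  let ?C = "\<Sum>\<^sub>\<infinity>\<mu>\<in>idx N. wt w \<mu> powr (- (1 / \<tau>) / 2)"
  \<comment> \<open>The zero multi-index alone contributes \<open>1\<close>, which makes
    \<open>?C\<close> and the threshold \<open>t\<close> positive.\<close>
  have "(\<Sum>\<mu>\<in>{\<lambda>_. 0}. wt w \<mu> powr (- (1 / \<tau>) / 2)) \<le> ?C"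
    using zero_idx by (intro finite_sum_le_infsum[OF summ]) auto
  then have C: "?C \<ge> 1"
    by (simp add: wt_def supp_def)
  then show "0 \<le> ?C" by simp
  fix n :: nat assume n: "n \<ge> 1"
  define t where "t = (?C / real n) powr \<tau>"
  have t: "t > 0"
    using C n by (simp add: t_def)
  define S where "S = {\<mu>\<in>idx N. t\<^sup>2 * wt w \<mu> < 1}"
  have "finite S \<and> card S \<le> n"
  \<comment> \<open>Finiteness of \<open>S\<close> is not known in advance; bounding the size of its
    finite subsets yields it together with the bound on \<open>card S\<close>.\<close>
  proof (rule finite_if_finite_subsets_card_bdd)
    fix G assume G: "G \<subseteq> S" "finite G"
    have "real (card G) * (?C / real n) = (\<Sum>\<mu>\<in>G. ?C / real n)"
      by simp
    also have "\<dots> \<le> (\<Sum>\<mu>\<in>G. wt w \<mu> powr (- (1 / \<tau>) / 2))"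
    proof (rule sum_mono)
      fix \<mu> assume "\<mu> \<in> G"
      then have \<mu>: "\<mu> \<in> idx N" "t\<^sup>2 * wt w \<mu> < 1"
        using G by (auto simp: S_def)
      have "t\<^sup>2 \<le> wt w \<mu> powr (- 1)"
        using \<mu> wt_pos[OF \<mu>(1)] by (simp add: powr_minus_divide field_simps)
      then have "(t\<^sup>2) powr (1 / \<tau> / 2) \<le> (wt w \<mu> powr (- 1)) powr (1 / \<tau> / 2)"
        using assms(1) by (intro powr_mono2) auto
      moreover have "(t\<^sup>2) powr (1 / \<tau> / 2) = ?C / real n"
      proof -
        have "(t\<^sup>2) powr (1 / \<tau> / 2) = (t powr 2) powr (1 / \<tau> / 2)"
          using t by (simp add: powr_numeral)
        also have "\<dots> = (?C / real n) powr 1"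
          unfolding t_def powr_powr using assms(1) by simp
        finally show ?thesis
          using C n by simp
      qed
      moreover have "(wt w \<mu> powr (- 1)) powr (1 / \<tau> / 2) = wt w \<mu> powr (- (1 / \<tau>) / 2)"
        unfolding powr_powr by simp
      ultimately show "?C / real n \<le> wt w \<mu> powr (- (1 / \<tau>) / 2)"
        by (simp only:)
    qed
    also have "\<dots> \<le> ?C"
      using G by (intro finite_sum_le_infsum[OF summ]) (auto simp: S_def)
    finally have "real (card G) * ?C \<le> real n * ?C"
      using n by (simp add: field_simps)
    then show "card G \<le> n"
      using C by simp
  qed
  then have "App_err n \<le> t"
    using t by (intro App_err_upper[of S]) (auto simp: S_def not_less)
  then show "0 \<le> App_err n \<and> App_err n \<le> (?C / real n) powr \<tau>"
    using App_err_nonneg by (simp add: t_def)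
qed

text \<open>A finite set of multi-indices sits in a finite box, where the sum factors over
  \<open>J\<close>. Each factor is \<open>1 + x\<close> with \<open>x\<close> a partial sum in
  \<open>\<nu>\<close>, hence at most \<open>exp x\<close>, and the exponentials combine into one
  bound by the double series.\<close>

lemma summable_wt:
  assumes summ: "(\<lambda>(j, \<nu>). w \<nu> j powr (- s)) summable_on {1..} \<times> (N - {0})"
  shows "(\<lambda>\<mu>. wt w \<mu> powr (- s)) summable_on idx N"
proof (rule summable_on_bounded_sums(1))
  let ?C = "\<Sum>\<^sub>\<infinity>(j, \<nu>)\<in>{1..} \<times> (N - {0}). w \<nu> j powr (- s)"
  fix S assume S: "finite S" "S \<subseteq> idx N"
  define J where "J = (\<Union>\<mu>\<in>S. supp \<mu>)"
  define V where "V = insert 0 (\<Union>\<mu>\<in>S. \<mu> ` J)"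
  have J: "finite J" "J \<subseteq> {1..}"
    using S idx_supp unfolding J_def by blast+
  have V: "finite V" "V \<subseteq> N" "0 \<in> V"
    using S J zero_in by (auto simp: V_def idx_def)
  have inj: "inj_on (\<lambda>\<mu>. restrict \<mu> J) S"
  proof (rule inj_onI)
    fix \<mu> \<kappa> assume *: "\<mu> \<in> S" "\<kappa> \<in> S" "restrict \<mu> J = restrict \<kappa> J"
    show "\<mu> = \<kappa>"
    proof
      fix j show "\<mu> j = \<kappa> j"
      proof (cases "j \<in> J")
        case True
        then show ?thesis
          using fun_cong[OF *(3), of j] by simp
      next
        case False
        then have "\<mu> j = 0" "\<kappa> j = 0"
          using *(1,2) by (auto simp: J_def supp_def)
        then show ?thesis by simp
      qed
    qed
  qed
  have "(\<Sum>\<mu>\<in>S. wt w \<mu> powr (- s)) = (\<Sum>\<mu>\<in>S. \<Prod>j\<in>J. w (restrict \<mu> J j) j powr (- s))"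
  proof (rule sum.cong[OF refl])
    fix \<mu> assume \<mu>: "\<mu> \<in> S"
    have "wt w \<mu> = (\<Prod>j\<in>J. w (\<mu> j) j)"
      using J w_zero \<mu> by (intro wt_superset) (auto simp: J_def)
    also have "\<dots> powr (- s) = (\<Prod>j\<in>J. w (\<mu> j) j powr (- s))"
      by (rule prod_powr_distrib)
    finally show "wt w \<mu> powr (- s) = (\<Prod>j\<in>J. w (restrict \<mu> J j) j powr (- s))"
      by simp
  qed
  also have "\<dots> = (\<Sum>h\<in>(\<lambda>\<mu>. restrict \<mu> J) ` S. \<Prod>j\<in>J. w (h j) j powr (- s))"
    by (simp add: sum.reindex[OF inj])
  also have "\<dots> \<le> (\<Sum>h\<in>PiE J (\<lambda>_. V). \<Prod>j\<in>J. w (h j) j powr (- s))"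
    using J V by (intro sum_mono2 finite_PiE) (auto simp: V_def intro!: prod_nonneg)
  also have "\<dots> = (\<Prod>j\<in>J. \<Sum>\<nu>\<in>V. w \<nu> j powr (- s))"
    using J V by (intro prod_sum_PiE[symmetric]) auto
  also have "\<dots> \<le> (\<Prod>j\<in>J. exp (\<Sum>\<nu>\<in>V - {0}. w \<nu> j powr (- s)))"
  proof (rule prod_mono, intro conjI sum_nonneg)
    fix j assume "j \<in> J"
    then have "j \<ge> 1" using J by auto
    then have "(\<Sum>\<nu>\<in>V. w \<nu> j powr (- s)) = 1 + (\<Sum>\<nu>\<in>V - {0}. w \<nu> j powr (- s))"
      using V w_zero by (simp add: sum.remove)
    then show "(\<Sum>\<nu>\<in>V. w \<nu> j powr (- s)) \<le> exp (\<Sum>\<nu>\<in>V - {0}. w \<nu> j powr (- s))"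
      by (simp add: exp_ge_add_one_self)
  qed auto
  also have "\<dots> = exp (\<Sum>(j, \<nu>)\<in>J \<times> (V - {0}). w \<nu> j powr (- s))"
    by (simp only: exp_sum[OF J(1), symmetric] sum.cartesian_product)
  also have "\<dots> \<le> exp ?C"
    using J V by (subst exp_le_cancel_iff, intro finite_sum_le_infsum[OF summ]) auto
  finally show "(\<Sum>\<mu>\<in>S. wt w \<mu> powr (- s)) \<le> exp ?C" .
qed simp

lemma dec_App_eq: "dec_App ip (e 0) X = decay App_err"
  by (simp add: dec_App_def dec_def)

lemma dec_App_ge:
  assumes "\<tau> > 0" "(\<lambda>(j, \<nu>). w \<nu> j powr (- (1 / \<tau>))) summable_on {1..} \<times> (N - {0})"
  shows "ennreal (\<tau> / 2) \<le> dec_App ip (e 0) X"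
  unfolding dec_App_eq using summable_wt[OF assms(2)] assms(1) by (intro decay_err_ge) auto

text \<open>The map \<open>k\<close> selects one factor and one basis index for each
  \<open>n\<close>, so that \<open>x\<close> is compared with a subfamily of the single weights. The
  constant \<open>C\<close> does not affect summability; it allows weights that are only
  proportional to \<open>1 / x n\<close>.\<close>

lemma dec_App_le:
  assumes K: "\<And>n. n \<ge> 1 \<Longrightarrow> fst (k n) \<ge> 1 \<and> snd (k n) \<in> N \<and> snd (k n) \<noteq> 0" "inj_on k {1..}"
    and x: "\<And>n. n \<ge> 1 \<Longrightarrow> 0 \<le> x n" "\<And>n. n \<ge> 1 \<Longrightarrow> x n \<le> C * inverse (w (snd (k n)) (fst (k n)))"
    and C: "0 \<le> C"
  shows "dec_App ip (e 0) X \<le> 1 / 2 * decay x"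
  unfolding dec_App_eq
proof (rule decay_le_half)
  fix \<tau> :: real assume \<tau>: "\<tau> > 0" "(\<lambda>n. App_err n powr (1 / \<tau>)) summable_on {1..}"
  have "(\<lambda>(j, \<nu>). w \<nu> j powr (- (1 / \<tau>) / 2)) summable_on k ` {1..}"
  proof (rule summable_site_of_err)
    fix j \<nu> assume "(j, \<nu>) \<in> k ` {1..}"
    then obtain n where "n \<ge> 1" "k n = (j, \<nu>)"
      by auto
    then show "j \<ge> 1 \<and> \<nu> \<in> N \<and> \<nu> \<noteq> 0"
      using K(1)[of n] by simp
  qed (use \<tau> in auto)
  then have "((\<lambda>(j, \<nu>). w \<nu> j powr (- (1 / \<tau>) / 2)) \<circ> k) summable_on {1..}"
    by (simp only: summable_on_reindex[OF K(2)])
  then have "(\<lambda>n. C powr (1 / (2 * \<tau>)) * ((\<lambda>(j, \<nu>). w \<nu> j powr (- (1 / \<tau>) / 2)) \<circ> k) n) summable_on {1..}"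
    by (rule summable_on_cmult_right)
  then show "(\<lambda>n. x n powr (1 / (2 * \<tau>))) summable_on {1..}"
  proof (rule summable_on_comparison_test)
    fix n :: nat assume "n \<in> {1..}"
    then have n: "n \<ge> 1" by simp
    let ?w = "w (snd (k n)) (fst (k n))"
    have w: "?w > 0"
      using w_ge[of "fst (k n)" "snd (k n)"] K(1)[OF n] by linarith
    have "x n powr (1 / (2 * \<tau>)) \<le> (C * inverse ?w) powr (1 / (2 * \<tau>))"
      using x[OF n] \<tau>(1) by (intro powr_mono2) auto
    also have "\<dots> = C powr (1 / (2 * \<tau>)) * ?w powr (- (1 / (2 * \<tau>)))"
      using C w by (simp add: powr_mult powr_minus inverse_powr)
    finally show "x n powr (1 / (2 * \<tau>)) \<le>
        C powr (1 / (2 * \<tau>)) * ((\<lambda>(j, \<nu>). w \<nu> j powr (- (1 / \<tau>) / 2)) \<circ> k) n"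
      by (simp add: case_prod_beta mult.commute[of \<tau>])
  qed simp
qed

end


subsection \<open>The three scales of spaces\<close>

lemma summable_on_Times:
  fixes f :: "'i \<Rightarrow> real" and g :: "'j \<Rightarrow> real"
  assumes f: "f summable_on A" "\<And>x. x \<in> A \<Longrightarrow> 0 \<le> f x"
    and g: "g summable_on B" "\<And>y. y \<in> B \<Longrightarrow> 0 \<le> g y"
  shows "(\<lambda>(x, y). f x * g y) summable_on A \<times> B"
proof (rule summable_on_bounded_sums(1))
  fix S assume S: "finite S" "S \<subseteq> A \<times> B"
  have "(\<Sum>(x, y)\<in>S. f x * g y) \<le> (\<Sum>(x, y)\<in>fst ` S \<times> snd ` S. f x * g y)"
  proof (rule sum_mono2)
    show "S \<subseteq> fst ` S \<times> snd ` S"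
      by force
  qed (use S f g in \<open>auto intro!: mult_nonneg_nonneg\<close>)
  also have "\<dots> = sum f (fst ` S) * sum g (snd ` S)"
    by (simp add: sum_product sum.cartesian_product)
  also have "\<dots> \<le> infsum f A * infsum g B"
    using S f g by (intro mult_mono finite_sum_le_infsum sum_nonneg infsum_nonneg) auto
  finally show "(\<Sum>(x, y)\<in>S. f x * g y) \<le> infsum f A * infsum g B" .
qed (use f g in auto)

lemma UNIV_eq_insert_0: "(UNIV :: nat set) = insert 0 {1..}"
  by auto

context hilbert_basis
begin

lemma weighted_factors_UNIV:
  assumes w: "\<And>\<nu> j. j \<ge> 1 \<Longrightarrow> \<nu> \<ge> 1 \<Longrightarrow> 1 \<le> w \<nu> j" "\<And>j. j \<ge> 1 \<Longrightarrow> w 0 j = 1"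
    and vecs: "\<And>j. j \<ge> 1 \<Longrightarrow> vecs (X j) = {f. (\<lambda>\<nu>. w \<nu> j * (norm (ip f (e \<nu>)))\<^sup>2) summable_on {1..}}"
    and inn: "\<And>j f g. j \<ge> 1 \<Longrightarrow> inn (X j) f g = ip f (e 0) * ip (e 0) g +
      (\<Sum>\<^sub>\<infinity>\<nu>\<in>{1..}. of_real (w \<nu> j) * ip f (e \<nu>) * ip (e \<nu>) g)"
  shows "weighted_factors smul ip e X UNIV w"
proof
  fix j :: nat assume j: "j \<ge> 1"
  show w1: "1 \<le> w \<nu> j" for \<nu>
    using w j by (cases "\<nu> = 0") auto
  show w0: "w 0 j = 1"
    using w j by simp
  show summ: "sq_summable (\<lambda>\<nu>. w \<nu> j) UNIV (\<lambda>\<nu>. ip f (e \<nu>))" if "f \<in> vecs (X j)" for f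
    using that vecs[OF j] unfolding sq_summable_def UNIV_eq_insert_0 by (simp add: summable_on_insert_iff)
  show "e \<nu> \<in> vecs (X j)" for \<nu>
    unfolding vecs[OF j] mem_Collect_eq
    by (rule finite_nonzero_values_imp_summable_on, rule finite_subset[of _ "{\<nu>}"])
       (auto simp: ip_basis split: if_splits)
  interpret weights "\<lambda>\<nu>. w \<nu> j" UNIV
    by unfold_locales (use w1 in \<open>auto intro: order_trans[OF zero_le_one]\<close>)
  fix f g assume fg: "f \<in> vecs (X j)" "g \<in> vecs (X j)"
  let ?t = "\<lambda>\<nu>. of_real (w \<nu> j) * ip f (e \<nu>) * kcnj (ip g (e \<nu>))"
  have "?t summable_on UNIV"
    using fg by (intro sq_ip_summable summ)
  then have "?t summable_on {1..}"
    by (rule summable_on_subset_banach) auto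
  then have "infsum ?t UNIV = ?t 0 + infsum ?t {1..}"
    unfolding UNIV_eq_insert_0 by (intro infsum_insert) auto
  then show "inn (X j) f g = sq_ip (\<lambda>\<nu>. w \<nu> j) UNIV (\<lambda>\<nu>. ip f (e \<nu>)) (\<lambda>\<nu>. ip g (e \<nu>))"
    by (simp add: inn[OF j] sq_ip_def w0 flip: ip_commute)
qed auto

end

section \<open>The growth condition and the three decay formulas\<close>

locale tensor_setting = hilbert_basis smul ip e
  for smul :: "'k::real_or_complex \<Rightarrow> 'a::ab_group_add \<Rightarrow> 'a" and ip e +
  fixes \<alpha> :: "nat \<Rightarrow> nat \<Rightarrow> real"
  assumes \<alpha>_ge: "\<And>\<nu> j. \<nu> \<ge> 1 \<Longrightarrow> j \<ge> 1 \<Longrightarrow> \<alpha> \<nu> j \<ge> max (\<alpha> \<nu> 1) (\<alpha> 1 j)"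
    and \<alpha>_gt: "\<alpha> 1 1 > 1"
    and \<alpha>_liminf: "liminf2 (\<lambda>\<nu> j. ln (\<alpha> \<nu> j) / (ln (real \<nu>) * ln (real j))) > 0"
begin

lemma \<alpha>_gt_1: "\<nu> \<ge> 1 \<Longrightarrow> j \<ge> 1 \<Longrightarrow> \<alpha> \<nu> j > 1"
  using \<alpha>_ge[of \<nu> j] \<alpha>_ge[of 1 j] \<alpha>_gt by auto

lemma \<alpha>_growth:
  obtains c n where "c > 0" "\<And>\<nu> j. \<nu> \<ge> n \<Longrightarrow> j \<ge> n \<Longrightarrow> c * (ln (real \<nu>) * ln (real j)) \<le> ln (\<alpha> \<nu> j)"
proof -
  define x where "x \<nu> j = ln (\<alpha> \<nu> j) / (ln (real \<nu>) * ln (real j))" for \<nu> j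
  define I where "I n = (INF (\<nu>, j)\<in>{n..} \<times> {n..}. ereal (x \<nu> j))" for n
  \<comment> \<open>The infima increase with \<open>n\<close>, so the limit in
    \<open>liminf2\<close> is their supremum, and some single infimum is already positive.\<close>
  have "incseq I"
    unfolding I_def by (intro incseq_SucI INF_superset_mono) auto
  then have "I \<longlonglongrightarrow> (SUP n. I n)"
    by (rule LIMSEQ_SUP)
  then have "(SUP n. I n) = lim I"
    by (rule limI[symmetric])
  also have "\<dots> > 0"
    using \<alpha>_liminf unfolding liminf2_def I_def x_def .
  finally obtain n where "I n > 0"
    by (auto simp: less_SUP_iff)
  then obtain c where c: "0 < c" "ereal c < I n"
    using ereal_dense2[of 0 "I n"] by auto
  \<comment> \<open>From \<open>2\<close> on both logarithms are positive and the quotient can be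
    multiplied out.\<close>
  have "c * (ln (real \<nu>) * ln (real j)) \<le> ln (\<alpha> \<nu> j)" if "\<nu> \<ge> max n 2" "j \<ge> max n 2" for \<nu> j
  proof -
    have "I n \<le> ereal (x \<nu> j)"
      unfolding I_def using that by (intro INF_lower2[of "(\<nu>, j)"]) auto
    with c have "ereal c < ereal (x \<nu> j)"
      by (rule_tac less_le_trans)
    then have "c < x \<nu> j" by simp
    moreover have "ln (real \<nu>) * ln (real j) > 0"
      using that by (intro mult_pos_pos ln_gt_zero) auto
    ultimately show ?thesis
      by (simp add: x_def pos_less_divide_eq)
  qed
  with c(1) show ?thesis
    using that by blast
qed

text \<open>
  For large indices \<open>ln \<nu> * ln j\<close> dominates \<open>ln \<nu> + ln j\<close>, so that \<open>\<alpha> \<nu> j powr (- s)\<close> is at most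
  \<open>(\<nu> * j) powr (- 2)\<close>; the remaining entries lie in finitely many rows and columns, which are
  dominated by the first ones.
\<close>

lemma summable_\<alpha>:
  assumes s: "s > 0" and a: "(\<lambda>\<nu>. \<alpha> \<nu> 1 powr (- s)) summable_on {1..}"
    and b: "(\<lambda>j. \<alpha> 1 j powr (- s)) summable_on {1..}"
  shows "(\<lambda>(j, \<nu>). \<alpha> \<nu> j powr (- s)) summable_on {1..} \<times> {1..}"
proof -
  obtain c n where c: "c > 0"
    and growth: "\<And>\<nu> j. \<nu> \<ge> n \<Longrightarrow> j \<ge> n \<Longrightarrow> c * (ln (real \<nu>) * ln (real j)) \<le> ln (\<alpha> \<nu> j)"
    using \<alpha>_growth by blast
  \<comment> \<open>Beyond \<open>m\<close> logarithms are at least \<open>4 / (c * s)\<close>; then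
    \<open>c * s\<close> times the product of two of them is at least twice their sum, which
    produces the exponent \<open>- 2\<close> in \<open>far\<close>.\<close>
  obtain m where m: "real m \<ge> exp (4 / (c * s))"
    using real_arch_simple by blast
  define n0 where "n0 = max (max n m) 1"
  have ln_ge: "4 / (c * s) \<le> ln (real \<nu>)" if "\<nu> \<ge> n0" for \<nu>
  proof -
    have "real m \<le> real \<nu>"
      using that by (simp add: n0_def)
    then have "exp (4 / (c * s)) \<le> real \<nu>"
      using m by linarith
    then show ?thesis
      using that by (subst ln_ge_iff) (auto simp: n0_def)
  qed
  have far: "\<alpha> \<nu> j powr (- s) \<le> real j powr (- 2) * real \<nu> powr (- 2)" if \<nu>j: "\<nu> \<ge> n0" "j \<ge> n0" for \<nu> j
  proof -
    let ?a = "ln (real \<nu>)" and ?b = "ln (real j)"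
    have pos: "0 < 4 / (c * s)"
      using c s by simp
    have "4 / (c * s) * ?b \<le> ?a * ?b" "?a * (4 / (c * s)) \<le> ?a * ?b"
      using ln_ge[OF \<nu>j(1)] ln_ge[OF \<nu>j(2)] pos
      by (intro mult_right_mono mult_left_mono; linarith)+
    then have "4 / (c * s) * (?a + ?b) \<le> 2 * (?a * ?b)"
      by (simp only: distrib_left mult.commute[of "4 / (c * s)" ?a])
    then have "2 * (?a + ?b) \<le> s * (c * (?a * ?b))"
      using c s by (simp add: field_simps)
    also have "\<dots> \<le> s * ln (\<alpha> \<nu> j)"
      using growth[of \<nu> j] \<nu>j s by (intro mult_left_mono) (auto simp: n0_def)
    finally have "exp (- (s * ln (\<alpha> \<nu> j))) \<le> exp (- 2 * ?b + - 2 * ?a)"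
      by simp
    moreover have "\<alpha> \<nu> j > 1" "real \<nu> > 0" "real j > 0"
      using \<alpha>_gt_1[of \<nu> j] \<nu>j by (auto simp: n0_def)
    ultimately show ?thesis
      by (simp only: powr_def exp_add) (simp add: powr_def)
  qed
  \<comment> \<open>This summable indicator makes the finitely many exceptional rows and columns,
    each dominated by the first one, a product of two summable sequences.\<close>
  let ?near = "\<lambda>\<nu>. of_bool (\<nu> < n0) :: real"
  have near: "?near summable_on {1..}"
    by (rule finite_nonzero_values_imp_summable_on) (auto intro: finite_subset[of _ "{..<n0}"])
  have poly: "(\<lambda>n. real n powr (- 2)) summable_on {1..}"
    by (rule summable_real_powr) simp
  have "(\<lambda>p. (\<lambda>(j, \<nu>). \<alpha> 1 j powr (- s) * ?near \<nu>) p + (\<lambda>(j, \<nu>). ?near j * \<alpha> \<nu> 1 powr (- s)) p +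
      (\<lambda>(j, \<nu>). real j powr (- 2) * real \<nu> powr (- 2)) p) summable_on {1..} \<times> {1..}"
    by (intro summable_on_add summable_on_Times a b near poly) auto
  then show ?thesis
  proof (rule summable_on_comparison_test)
    fix p :: "nat \<times> nat" assume "p \<in> {1..} \<times> {1..}"
    then obtain j \<nu> where p: "p = (j, \<nu>)" "j \<ge> 1" "\<nu> \<ge> 1"
      by auto
    have "\<alpha> \<nu> j powr (- s) \<le> \<alpha> 1 j powr (- s)" "\<alpha> \<nu> j powr (- s) \<le> \<alpha> \<nu> 1 powr (- s)"
      using \<alpha>_ge[OF p(3,2)] \<alpha>_gt_1[OF _ p(2), of 1] \<alpha>_gt_1[OF p(3), of 1] s
      by (auto intro!: powr_mono2')
    then have "\<alpha> \<nu> j powr (- s) \<le> \<alpha> 1 j powr (- s) * ?near \<nu> + ?near j * \<alpha> \<nu> 1 powr (- s) +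
        real j powr (- 2) * real \<nu> powr (- 2)"
      using far[of \<nu> j] by (cases "\<nu> < n0"; cases "j < n0") (auto intro!: add_nonneg_nonneg add_increasing add_increasing2)
    then show "(\<lambda>(j, \<nu>). \<alpha> \<nu> j powr (- s)) p \<le> (\<lambda>(j, \<nu>). \<alpha> 1 j powr (- s) * ?near \<nu>) p +
        (\<lambda>(j, \<nu>). ?near j * \<alpha> \<nu> 1 powr (- s)) p + (\<lambda>(j, \<nu>). real j powr (- 2) * real \<nu> powr (- 2)) p"
      by (simp add: p)
  qed auto
qed

lemma inverse_powr_eq: "\<nu> \<ge> 1 \<Longrightarrow> j \<ge> 1 \<Longrightarrow> inverse (\<alpha> \<nu> j) powr s = \<alpha> \<nu> j powr (- s)"
  using \<alpha>_gt_1[of \<nu> j] by (simp add: powr_minus inverse_powr)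

lemma inverse_\<alpha>_le_1: "\<nu> \<ge> 1 \<Longrightarrow> j \<ge> 1 \<Longrightarrow> 0 \<le> inverse (\<alpha> \<nu> j) \<and> inverse (\<alpha> \<nu> j) \<le> 1"
  using \<alpha>_gt_1[of \<nu> j] by (auto simp: field_simps)

definition weight :: "nat \<Rightarrow> nat \<Rightarrow> real" where
  "weight \<nu> j = (if \<nu> = 0 then 1 else \<alpha> \<nu> j)"

lemma UNIV_minus_0: "UNIV - {0} = {1::nat..}"
  by auto

lemma dec_H: "dec_App ip (e 0) (space_H ip e \<alpha>) =
    1 / 2 * min (decay (\<lambda>\<nu>. inverse (\<alpha> \<nu> 1))) (decay (\<lambda>j. inverse (\<alpha> 1 j)))"
proof -
  interpret H: weighted_factors smul ip e "space_H ip e \<alpha>" UNIV weight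
  proof (rule weighted_factors_UNIV)
    fix j assume "j \<ge> (1::nat)"
    have "(\<lambda>\<nu>. weight \<nu> j * (norm (ip f (e \<nu>)))\<^sup>2) summable_on {1..} \<longleftrightarrow>
        (\<lambda>\<nu>. \<alpha> \<nu> j * (norm (ip f (e \<nu>)))\<^sup>2) summable_on {1..}" for f
      by (rule summable_on_cong) (auto simp: weight_def)
    then show "vecs (space_H ip e \<alpha> j) = {f. (\<lambda>\<nu>. weight \<nu> j * (norm (ip f (e \<nu>)))\<^sup>2) summable_on {1..}}"
      by (simp add: space_H_def)
    fix f g
    have "(\<Sum>\<^sub>\<infinity>\<nu>\<in>{1..}. of_real (weight \<nu> j) * ip f (e \<nu>) * ip (e \<nu>) g) =
        (\<Sum>\<^sub>\<infinity>\<nu>\<in>{1..}. of_real (\<alpha> \<nu> j) * ip f (e \<nu>) * ip (e \<nu>) g)"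
      by (rule infsum_cong) (auto simp: weight_def)
    then show "inn (space_H ip e \<alpha> j) f g = ip f (e 0) * ip (e 0) g +
        (\<Sum>\<^sub>\<infinity>\<nu>\<in>{1..}. of_real (weight \<nu> j) * ip f (e \<nu>) * ip (e \<nu>) g)"
      by (simp add: space_H_def)
  qed (use \<alpha>_gt_1 in \<open>auto simp: weight_def less_imp_le\<close>)
  \<comment> \<open>The first bound tests with all basis indices in factor \<open>1\<close>, the
    second with basis index \<open>1\<close> in all factors.\<close>
  have "dec_App ip (e 0) (space_H ip e \<alpha>) \<le> 1 / 2 * decay (\<lambda>\<nu>. inverse (\<alpha> \<nu> 1))"
    using inverse_\<alpha>_le_1
    by (intro H.dec_App_le[where C = 1 and k = "\<lambda>\<nu>. (1, \<nu>)"]) (auto simp: weight_def inj_on_def)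
  moreover have "dec_App ip (e 0) (space_H ip e \<alpha>) \<le> 1 / 2 * decay (\<lambda>j. inverse (\<alpha> 1 j))"
    using inverse_\<alpha>_le_1
    by (intro H.dec_App_le[where C = 1 and k = "\<lambda>j. (j, 1)"]) (auto simp: weight_def inj_on_def)
  ultimately have "dec_App ip (e 0) (space_H ip e \<alpha>) \<le>
      1 / 2 * min (decay (\<lambda>\<nu>. inverse (\<alpha> \<nu> 1))) (decay (\<lambda>j. inverse (\<alpha> 1 j)))"
    by (simp add: min_def)
  moreover have "1 / 2 * min (decay (\<lambda>\<nu>. inverse (\<alpha> \<nu> 1))) (decay (\<lambda>j. inverse (\<alpha> 1 j))) \<le>
      dec_App ip (e 0) (space_H ip e \<alpha>)"
  proof (rule half_min_decay_le)
    fix \<tau> :: real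
    assume \<tau>: "\<tau> > 0" "(\<lambda>n. inverse (\<alpha> n 1) powr (1 / \<tau>)) summable_on {1..}"
      "(\<lambda>n. inverse (\<alpha> 1 n) powr (1 / \<tau>)) summable_on {1..}"
    have "(\<lambda>(j, \<nu>). \<alpha> \<nu> j powr (- (1 / \<tau>))) summable_on {1..} \<times> {1..}"
    proof (rule summable_\<alpha>)
      show "(\<lambda>\<nu>. \<alpha> \<nu> 1 powr (- (1 / \<tau>))) summable_on {1..}"
        using \<tau>(2) by (rule summable_on_cong[THEN iffD1, rotated]) (simp add: inverse_powr_eq)
      show "(\<lambda>j. \<alpha> 1 j powr (- (1 / \<tau>))) summable_on {1..}"
        using \<tau>(3) by (rule summable_on_cong[THEN iffD1, rotated]) (simp add: inverse_powr_eq)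
    qed (use \<tau>(1) in simp)
    then have "(\<lambda>(j, \<nu>). weight \<nu> j powr (- (1 / \<tau>))) summable_on {1..} \<times> (UNIV - {0})"
      unfolding UNIV_minus_0
      by (rule summable_on_cong[THEN iffD1, rotated]) (auto simp: weight_def)
    then show "ennreal (\<tau> / 2) \<le> dec_App ip (e 0) (space_H ip e \<alpha>)"
      using \<tau>(1) by (intro H.dec_App_ge)
  qed (use inverse_\<alpha>_le_1 in auto)
  ultimately show ?thesis
    by (rule antisym)
qed

lemma span_e01:
  assumes "f \<in> span {e 0, e 1}" "\<nu> \<notin> {0, 1}"
  shows "ip f (e \<nu>) = 0"
  using assms(1)
proof (induction rule: span_induct_alt)
  case (step c x y)
  then show ?case
    using assms(2) by (auto simp: ip_add_left ip_scale_left ip_basis)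
qed simp

lemma dec_F: "dec_App ip (e 0) (space_F smul ip e \<alpha>) = 1 / 2 * decay (\<lambda>j. inverse (\<alpha> 1 j))"
proof -
  interpret F: weighted_factors smul ip e "space_F smul ip e \<alpha>" "{0, 1}" weight
  proof
    fix j :: nat and f g assume j: "j \<ge> 1"
    show "inn (space_F smul ip e \<alpha> j) f g =
        sq_ip (\<lambda>\<nu>. weight \<nu> j) {0, 1} (\<lambda>\<nu>. ip f (e \<nu>)) (\<lambda>\<nu>. ip g (e \<nu>))"
      by (simp add: space_F_def sq_ip_def weight_def flip: ip_commute)
  qed (use \<alpha>_gt_1[of 1] span_e01 span_base in
      \<open>auto simp: weight_def space_F_def sq_summable_def less_imp_le\<close>)
  have "dec_App ip (e 0) (space_F smul ip e \<alpha>) \<le> 1 / 2 * decay (\<lambda>j. inverse (\<alpha> 1 j))"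
    using inverse_\<alpha>_le_1
    by (intro F.dec_App_le[where C = 1 and k = "\<lambda>j. (j, 1)"]) (auto simp: weight_def inj_on_def)
  \<comment> \<open>Using the same sequence twice lets \<open>half_min_decay_le\<close> handle a
    single decay.\<close>
  moreover have "1 / 2 * min (decay (\<lambda>j. inverse (\<alpha> 1 j))) (decay (\<lambda>j. inverse (\<alpha> 1 j))) \<le>
      dec_App ip (e 0) (space_F smul ip e \<alpha>)"
  proof (rule half_min_decay_le)
    fix \<tau> :: real
    assume \<tau>: "\<tau> > 0" "(\<lambda>n. inverse (\<alpha> 1 n) powr (1 / \<tau>)) summable_on {1..}"
    have site_set: "{0, 1} - {0} = {1::nat}"
      by auto
    have "(\<lambda>(j, \<nu>). inverse (\<alpha> 1 j) powr (1 / \<tau>) * 1) summable_on {1..} \<times> {1::nat}"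
      using \<tau>(2) by (intro summable_on_Times) auto
    then have "(\<lambda>(j, \<nu>). weight \<nu> j powr (- (1 / \<tau>))) summable_on {1..} \<times> ({0, 1} - {0})"
      unfolding site_set
      by (rule summable_on_cong[THEN iffD1, rotated]) (auto simp: weight_def inverse_powr_eq)
    then show "ennreal (\<tau> / 2) \<le> dec_App ip (e 0) (space_F smul ip e \<alpha>)"
      using \<tau>(1) by (intro F.dec_App_ge)
  qed (use inverse_\<alpha>_le_1 in auto)
  ultimately show ?thesis
    by (intro antisym) auto
qed

text \<open>The lower bound is the entry \<open>\<nu> = 1\<close> of the supremum; it yields
  positivity, so dividing by \<open>gam \<alpha> j\<close> gives genuine weights.\<close>

lemma gam_bounds:
  assumes j: "j \<ge> 1"
  shows "0 < gam \<alpha> j" "gam \<alpha> j \<le> 1" "\<alpha> 1 1 * inverse (\<alpha> 1 j) \<le> gam \<alpha> j"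
proof -
  have le: "\<alpha> \<nu> 1 / \<alpha> \<nu> j \<le> 1" if "\<nu> \<ge> 1" for \<nu>
    using \<alpha>_ge[OF that j] \<alpha>_gt_1[OF that j] by simp
  show "gam \<alpha> j \<le> 1"
    unfolding gam_def by (rule cSUP_least) (use le in auto)
  show *: "\<alpha> 1 1 * inverse (\<alpha> 1 j) \<le> gam \<alpha> j"
    unfolding gam_def using le
    by (intro cSUP_upper2[where x = 1]) (auto intro!: bdd_aboveI2[where M = 1] simp: divide_inverse)
  have "0 < \<alpha> 1 1 * inverse (\<alpha> 1 j)"
    using \<alpha>_gt \<alpha>_gt_1[OF _ j, of 1] by simp
  then show "0 < gam \<alpha> j"
    using * by linarith
qed

lemma gam_1: "gam \<alpha> 1 = 1"
proof -
  have "\<alpha> \<nu> 1 / \<alpha> \<nu> 1 = 1" if "\<nu> \<in> {1..}" for \<nu>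
    using \<alpha>_gt_1[of \<nu> 1] that by simp
  then have "(\<lambda>\<nu>. \<alpha> \<nu> 1 / \<alpha> \<nu> 1) ` {1..} = (\<lambda>_. 1) ` {1::nat..}"
    by (intro image_cong) auto
  then show ?thesis
    by (simp add: gam_def)
qed

definition gweight :: "nat \<Rightarrow> nat \<Rightarrow> real" where
  "gweight \<nu> j = (if \<nu> = 0 then 1 else \<alpha> \<nu> 1 / gam \<alpha> j)"

lemma dec_G: "dec_App ip (e 0) (space_G ip e \<alpha>) =
    1 / 2 * min (decay (\<lambda>\<nu>. inverse (\<alpha> \<nu> 1))) (decay (\<lambda>j. gam \<alpha> j))"
proof -
  interpret G: weighted_factors smul ip e "space_G ip e \<alpha>" UNIV gweight
  proof (rule weighted_factors_UNIV)
    fix j assume j: "j \<ge> (1::nat)"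
    note \<gamma> = gam_bounds[OF j]
    show "1 \<le> gweight \<nu> j" if "\<nu> \<ge> 1" for \<nu>
      using \<gamma> \<alpha>_gt_1[OF that, of 1] that by (simp add: gweight_def)
    have "(\<lambda>\<nu>. gweight \<nu> j * (norm (ip f (e \<nu>)))\<^sup>2) summable_on {1..} \<longleftrightarrow>
        (\<lambda>\<nu>. 1 / gam \<alpha> j * (\<alpha> \<nu> 1 * (norm (ip f (e \<nu>)))\<^sup>2)) summable_on {1..}" for f
      by (rule summable_on_cong) (auto simp: gweight_def)
    also have "\<dots> f \<longleftrightarrow> (\<lambda>\<nu>. \<alpha> \<nu> 1 * (norm (ip f (e \<nu>)))\<^sup>2) summable_on {1..}" for f
      using \<gamma> by (intro summable_on_cmult_right') simp
    finally show "vecs (space_G ip e \<alpha> j) = {f. (\<lambda>\<nu>. gweight \<nu> j * (norm (ip f (e \<nu>)))\<^sup>2) summable_on {1..}}"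
      by (simp add: space_G_def space_H_def)
    fix f g
    have "(\<Sum>\<^sub>\<infinity>\<nu>\<in>{1..}. of_real (gweight \<nu> j) * ip f (e \<nu>) * ip (e \<nu>) g) =
        (\<Sum>\<^sub>\<infinity>\<nu>\<in>{1..}. of_real (1 / gam \<alpha> j) * (of_real (\<alpha> \<nu> 1) * ip f (e \<nu>) * ip (e \<nu>) g))"
      by (rule infsum_cong) (auto simp: gweight_def)
    also have "\<dots> = of_real (1 / gam \<alpha> j) * (\<Sum>\<^sub>\<infinity>\<nu>\<in>{1..}. of_real (\<alpha> \<nu> 1) * ip f (e \<nu>) * ip (e \<nu>) g)"
      by (rule infsum_cmult_right')
    finally show "inn (space_G ip e \<alpha> j) f g = ip f (e 0) * ip (e 0) g +
        (\<Sum>\<^sub>\<infinity>\<nu>\<in>{1..}. of_real (gweight \<nu> j) * ip f (e \<nu>) * ip (e \<nu>) g)"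
      by (simp add: space_G_def)
  qed (simp add: gweight_def)
  \<comment> \<open>As \<open>gam \<alpha> 1 = 1\<close>, factor \<open>1\<close> carries the
    weights \<open>\<alpha> \<nu> 1\<close> unchanged.\<close>
  have "dec_App ip (e 0) (space_G ip e \<alpha>) \<le> 1 / 2 * decay (\<lambda>\<nu>. inverse (\<alpha> \<nu> 1))"
    using inverse_\<alpha>_le_1 gam_1
    by (intro G.dec_App_le[where C = 1 and k = "\<lambda>\<nu>. (1, \<nu>)"]) (auto simp: gweight_def inj_on_def)
  \<comment> \<open>At basis index \<open>1\<close> the weight is
    \<open>\<alpha> 1 1 / gam \<alpha> j\<close>, so the constant \<open>\<alpha> 1 1\<close> turns
    its reciprocal into \<open>gam \<alpha> j\<close>.\<close>
  moreover have "dec_App ip (e 0) (space_G ip e \<alpha>) \<le> 1 / 2 * decay (\<lambda>j. gam \<alpha> j)"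
    using gam_bounds \<alpha>_gt
    by (intro G.dec_App_le[where C = "\<alpha> 1 1" and k = "\<lambda>j. (j, 1)"])
       (auto simp: gweight_def inj_on_def less_imp_le)
  ultimately have "dec_App ip (e 0) (space_G ip e \<alpha>) \<le>
      1 / 2 * min (decay (\<lambda>\<nu>. inverse (\<alpha> \<nu> 1))) (decay (\<lambda>j. gam \<alpha> j))"
    by (simp add: min_def)
  moreover have "1 / 2 * min (decay (\<lambda>\<nu>. inverse (\<alpha> \<nu> 1))) (decay (\<lambda>j. gam \<alpha> j)) \<le>
      dec_App ip (e 0) (space_G ip e \<alpha>)"
  proof (rule half_min_decay_le)
    fix \<tau> :: real
    assume \<tau>: "\<tau> > 0" "(\<lambda>n. inverse (\<alpha> n 1) powr (1 / \<tau>)) summable_on {1..}"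
      "(\<lambda>n. gam \<alpha> n powr (1 / \<tau>)) summable_on {1..}"
    \<comment> \<open>The reciprocal weights separate into a factor in \<open>j\<close> and a factor
      in \<open>\<nu>\<close>, so the double series is a product of two simple ones.\<close>
    have "(\<lambda>(j, \<nu>). gam \<alpha> j powr (1 / \<tau>) * inverse (\<alpha> \<nu> 1) powr (1 / \<tau>)) summable_on {1..} \<times> {1..}"
      using \<tau>(2,3) by (intro summable_on_Times) auto
    then have "(\<lambda>(j, \<nu>). gweight \<nu> j powr (- (1 / \<tau>))) summable_on {1..} \<times> (UNIV - {0})"
      unfolding UNIV_minus_0
    proof (rule summable_on_cong[THEN iffD1, rotated])
      fix p :: "nat \<times> nat" assume "p \<in> {1..} \<times> {1..}"
      then obtain j \<nu> where p: "p = (j, \<nu>)" "j \<ge> 1" "\<nu> \<ge> 1"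
        by auto
      have "0 \<le> gweight \<nu> j"
        using gam_bounds(1)[OF p(2)] \<alpha>_gt_1[OF p(3), of 1] p by (simp add: gweight_def)
      then have "gweight \<nu> j powr (- (1 / \<tau>)) = inverse (gweight \<nu> j) powr (1 / \<tau>)"
        by (simp only: powr_minus inverse_powr)
      also have "inverse (gweight \<nu> j) = gam \<alpha> j * inverse (\<alpha> \<nu> 1)"
        using p by (simp add: gweight_def divide_inverse)
      also have "\<dots> powr (1 / \<tau>) = gam \<alpha> j powr (1 / \<tau>) * inverse (\<alpha> \<nu> 1) powr (1 / \<tau>)"
        using gam_bounds(1)[OF p(2)] \<alpha>_gt_1[OF p(3), of 1] by (simp add: powr_mult)
      finally show "(case p of (j, \<nu>) \<Rightarrow> gam \<alpha> j powr (1 / \<tau>) * inverse (\<alpha> \<nu> 1) powr (1 / \<tau>)) =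
          (case p of (j, \<nu>) \<Rightarrow> gweight \<nu> j powr (- (1 / \<tau>)))"
        by (simp add: p)
    qed
    then show "ennreal (\<tau> / 2) \<le> dec_App ip (e 0) (space_G ip e \<alpha>)"
      using \<tau>(1) by (intro G.dec_App_ge)
  qed (use inverse_\<alpha>_le_1 gam_bounds in \<open>auto simp: less_imp_le\<close>)
  ultimately show ?thesis
    by (rule antisym)
qed

end

theorem theorem4p1:
  fixes smul :: "'k::real_or_complex \<Rightarrow> 'a::ab_group_add \<Rightarrow> 'a"
    and ip :: "'a \<Rightarrow> 'a \<Rightarrow> 'k"
    and e :: "nat \<Rightarrow> 'a"
    and \<alpha> :: "nat \<Rightarrow> nat \<Rightarrow> real"
  assumes "hilbert_space smul ip"
    and "orthonormal_basis smul ip e"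
    and "\<And>\<nu> j. \<nu> \<ge> 1 \<Longrightarrow> j \<ge> 1 \<Longrightarrow> \<alpha> \<nu> j \<ge> max (\<alpha> \<nu> 1) (\<alpha> 1 j)"
    and "\<alpha> 1 1 > 1"
    and "liminf2 (\<lambda>\<nu> j. ln (\<alpha> \<nu> j) / (ln (real \<nu>) * ln (real j))) > 0"
  shows "dec_App ip (e 0) (space_H ip e \<alpha>) =
           1 / 2 * min (decay (\<lambda>\<nu>. inverse (\<alpha> \<nu> 1))) (decay (\<lambda>j. inverse (\<alpha> 1 j))) \<and>
         dec_App ip (e 0) (space_F smul ip e \<alpha>) = 1 / 2 * decay (\<lambda>j. inverse (\<alpha> 1 j)) \<and>
         dec_App ip (e 0) (space_G ip e \<alpha>) =
           1 / 2 * min (decay (\<lambda>\<nu>. inverse (\<alpha> \<nu> 1))) (decay (\<lambda>j. gam \<alpha> j))"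
proof -
  interpret hilbert_space smul ip by fact
  interpret tensor_setting smul ip e \<alpha>
    using assms(2-) by unfold_locales
  show ?thesis
    using dec_H dec_F dec_G by blast
qed

end
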